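(* Let $p\in(0,1)$ be a fixed constant, and let $f(D,x,y)$ be a real-valued function, symmetric in $x$ and $y$ (i.e. $f(D,x,y)=f(D,y,x)$), such that for each distance value $D$, $$f\big(D,(1+o(1))np,(1+o(1))np\big)=(1+o(1))\,f(D,np,np)\qquad (n\to\infty).$$ Then for almost all graphs $G_p\in\mathcal{G}_{n,p}$, $$\mathscr{E}(W_f(G_p))=\Big\{\Big(\frac{8}{3\pi}\sqrt{p(1-p)}+o(1)\Big)\cdot|f(1,np,np)-f(2,np,np)|+o(|f(2,np,np)|)\Big\}\cdot n^{3/2}\quad\text{a.s.}$$ That is, if $f(1,np,np)/f(2,np,np)\nrightarrow 1$ as $n\to\infty$, then $$\mathscr{E}(W_f(G_p))=|f(1,np,np)-f(2,np,np)|\Big(\frac{8}{3\pi}\sqrt{p(1-p)}+o(1)\Big)\cdot n^{3/2}\quad\text{a.s.},$$ and if $f(1,np,np)/f(2,np,np)\to 1$ as $n\to\infty$, then $$\mathscr{E}(W_f(G_p))=o(1)\,|f(2,np,np)|\cdot n^{3/2}\quad\text{a.s.}$$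
   Context: For a simple graph $G$ on $n$ vertices, $d_i$ is the degree of vertex $i$ and $D(i,j)$ is the distance between vertices $i$ and $j$. The weighted distance matrix $W_f(G)$ is the $n\times n$ real symmetric matrix with $(i,j)$-entry $f(D(i,j),d_i,d_j)$ if $i\neq j$ and $0$ if $i=j$. The energy of a real symmetric matrix $M$ with eigenvalues $\lambda_1,\dots,\lambda_n$ is $\mathscr{E}(M)=\sum_{i=1}^n|\lambda_i|$. $\mathcal{G}_{n,p}$ is the Erdős–Rényi random graph model: graphs on $n$ vertices in which each edge is chosen independently with probability $p$, where $p\in(0,1)$ is a constant independent of $n$. "Almost all" and "a.s." mean: with probability tending to $1$ as $n\to\infty$. (With probability tending to $1$, $G_p$ is connected with diameter $2$, so the convention for distances in disconnected graphs is irrelevant.) The hypothesis on $f$ means: for each fixed $D$ and all sequences $x_n,y_n$ with $x_n/(np)\to1$ and $y_n/(np)\to 1$, one has $f(D,x_n,y_n)=(1+o(1))f(D,np,np)$. An asymptotic statement with $o(\cdot)$ terms holding a.s. means that there are deterministic sequences tending to $0$ which bound the $o(1)$ terms (respectively, the coefficient in the $o(|f(2,np,np)|)$ term) in absolute value with probability tending to $1$ as $n\to\infty$.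
   Formalization: In the first "That is" case, "f(1,np,np)/f(2,np,np) does not tend to 1" is read as "no subsequence of the ratio tends to 1"; with mere non-convergence the claim is false, e.g. f(2,x,y)=1, f(1,x,y)=1+max(0, sin ln ln(xy+3)). *)

theory Defs
  imports
    "HOL-Probability.Probability"
    "HOL-Library.Landau_Symbols"
    "HOL-Library.Extended_Nat"
    "Jordan_Normal_Form.Char_Poly"
begin

(* A simple graph on the vertex set {..<n} is represented by its set of edges, a subset of
   all_edges n. *)

type_synonym edge_set = "nat set set"

definition all_edges :: "nat \<Rightarrow> edge_set" where
  "all_edges n = {e. e \<subseteq> {..<n} \<and> card e = 2}"

definition vertex_degree :: "edge_set \<Rightarrow> nat \<Rightarrow> nat" where
  "vertex_degree E i = card {e \<in> E. i \<in> e}"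

definition adjacency :: "edge_set \<Rightarrow> (nat \<times> nat) set" where
  "adjacency E = {(u, v). {u, v} \<in> E}"

(* (i, j) : adjacency E ^^ k says that there is a walk of length k from i to j; the distance is
   infinite if there is no walk. *)
definition graph_dist :: "edge_set \<Rightarrow> nat \<Rightarrow> nat \<Rightarrow> enat" where
  "graph_dist E i j = Inf {enat k | k. (i, j) \<in> adjacency E ^^ k}"

definition weighted_distance_matrix ::
  "(enat \<Rightarrow> real \<Rightarrow> real \<Rightarrow> real) \<Rightarrow> nat \<Rightarrow> edge_set \<Rightarrow> real mat" where
  "weighted_distance_matrix f n E =
     mat n n (\<lambda>(i, j). if i = j then 0
                       else f (graph_dist E i j) (real (vertex_degree E i)) (real (vertex_degree E j)))"

(* The sum runs over the real eigenvalues with algebraic multiplicity; for a symmetric matrix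
   these are all n eigenvalues. *)
definition energy :: "real mat \<Rightarrow> real" where
  "energy M = (\<Sum>x\<in>#proots (char_poly M). \<bar>x\<bar>)"

definition erdos_renyi :: "nat \<Rightarrow> real \<Rightarrow> edge_set pmf" where
  "erdos_renyi n p =
     map_pmf (\<lambda>b. {e \<in> all_edges n. b e})
       (Pi_pmf (all_edges n) False (\<lambda>_. bernoulli_pmf p))"

definition almost_all_graphs :: "real \<Rightarrow> (nat \<Rightarrow> edge_set \<Rightarrow> bool) \<Rightarrow> bool" where
  "almost_all_graphs p P \<longleftrightarrow>
     (\<lambda>n. measure_pmf.prob (erdos_renyi n p) {E. P n E}) \<longlonglongrightarrow> 1"

(* f(D, (1 + o(1)) np, (1 + o(1)) np) = (1 + o(1)) f(D, np, np) for each distance D >= 1 between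
   distinct vertices. The relation asymp_equiv holds also where both sides vanish. *)
definition degree_stable :: "real \<Rightarrow> (enat \<Rightarrow> real \<Rightarrow> real \<Rightarrow> real) \<Rightarrow> bool" where
  "degree_stable p f \<longleftrightarrow>
     (\<forall>D\<ge>1. \<forall>x y :: nat \<Rightarrow> real.
        (\<lambda>n. x n / (real n * p)) \<longlonglongrightarrow> 1 \<longrightarrow>
        (\<lambda>n. y n / (real n * p)) \<longlonglongrightarrow> 1 \<longrightarrow>
        (\<lambda>n. f (enat D) (x n) (y n)) \<sim>[sequentially]
          (\<lambda>n. f (enat D) (real n * p) (real n * p)))"

(* The terms of r eventually keep a positive distance from c. This is stronger than the mere
   failure of convergence to c: it is what "r does not tend to c" has to mean for an asymptotic
   formula along all n, since the formula would fail along a subsequence tending to c. *)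
definition no_subseq_tendsto :: "(nat \<Rightarrow> real) \<Rightarrow> real \<Rightarrow> bool" where
  "no_subseq_tendsto r c \<longleftrightarrow> (\<forall>s. strict_mono s \<longrightarrow> \<not> (r \<circ> s) \<longlonglongrightarrow> c)"

end

theory Submission
  imports Defs "HOL-Real_Asymp.Real_Asymp"
begin

text \<open>
  Almost surely all degrees are close to \<open>np\<close> and every two vertices have a common neighbour, so all
  distances are 1 or 2. Stability of \<open>f\<close> then makes the weighted distance matrix entrywise close to
  \<open>a A + b (J - I - A)\<close>, where \<open>A\<close> is the adjacency matrix, \<open>J\<close> the all-ones matrix,
  \<open>a = f(1,np,np)\<close> and \<open>b = f(2,np,np)\<close>. The energy of a symmetric matrix is its trace norm, so it obeys the
  triangle inequality; it is at most \<open>K n\<^sup>3\<^sup>/\<^sup>2\<close> when all entries are at most \<open>K\<close>, and it is linear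
  in \<open>n\<close> for \<open>J - I\<close>. Hence everything except \<open>(a - b) (A - p (J - I))\<close> goes into the error terms
  (\<open>energy_two_valued_matrix\<close>), and what remains is the energy of the centred adjacency matrix.

  With \<open>W = (A - p (J - I)) / \<surd>n\<close> and \<open>s\<^sup>2 = p (1 - p)\<close>, the claim is that the mean absolute eigenvalue
  of \<open>W\<close> tends to \<open>8 s / (3 \<pi>)\<close>, the mean absolute value under the semicircle law. Instead of counting
  closed walks, the proof uses the integral formula of Coulson
  \<open>\<bar>x\<bar> = (2 / \<pi>) \<integral>\<^sub>0\<^sup>\<infinity> x\<^sup>2 / (x\<^sup>2 + t\<^sup>2) dt\<close>. It expresses the mean absolute eigenvalue through
  \<open>1 - t Im m(it)\<close>, where \<open>m(z)\<close> is the normalised trace of the resolvent \<open>G = (W - z)\<^sup>-\<^sup>1\<close>. Only points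
  of the imaginary axis occur, and there every entry of \<open>G\<close> is at most \<open>1 / t\<close>, whatever the graph is.

  The function \<open>m\<close> is controlled by the quantity \<open>S = 1 + z m + s\<^sup>2 m\<^sup>2\<close>, which vanishes for the semicircle law.
  The identity \<open>1 + z m = (1 / n) \<Sum> W\<^sub>i\<^sub>j G\<^sub>j\<^sub>i\<close> and the exact integration by parts for a Bernoulli variable
  (\<open>expect_integration_by_parts\<close>) turn the expectation of \<open>(1 + z m) \<phi>\<close>, for a function \<open>\<phi>\<close> of the graph, into
  an expectation of increments of \<open>G\<^sub>j\<^sub>i \<phi>\<close> under toggling of the edge \<open>ij\<close>; by the resolvent identity these
  equal \<open>- G\<^sub>i\<^sub>i G\<^sub>j\<^sub>j \<phi> / \<surd>n\<close> up to errors that are small on average. The choice of the conjugate of \<open>S\<close> for \<open>\<phi>\<close> bounds the second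
  moment of \<open>S\<close> at once (\<open>expect_defect_square\<close>), without a separate concentration argument. The polynomial
  \<open>1 + z m + s\<^sup>2 m\<^sup>2\<close> is stable at its root in the upper half plane (\<open>quadratic_stability\<close>), and dominated convergence
  in \<open>t\<close> gives \<open>wigner_mean_abs_eigenvalue\<close>.
\<close>

section \<open>Spectral theorem for real symmetric matrices\<close>

lemma sum_of_bool_mult:
  fixes f :: "nat \<Rightarrow> 'a::comm_semiring_1"
  assumes "i < n"
  shows "(\<Sum>k<n. of_bool (i = k) * f k) = f i" and "(\<Sum>k<n. of_bool (k = i) * f k) = f i"
    and "(\<Sum>k<n. f k * of_bool (i = k)) = f i" and "(\<Sum>k<n. f k * of_bool (k = i)) = f i"
  using assms by (simp_all add: of_bool_def if_distrib[of "\<lambda>x. x * _"] if_distrib[of "\<lambda>x. _ * x"] cong: if_cong)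

lemma sum_bilinear_swap:
  fixes w :: "nat \<Rightarrow> nat \<Rightarrow> 'a::comm_semiring_1"
  shows "(\<Sum>k<n. c k * (\<Sum>a<n. x a * w k a) * (\<Sum>b<n. y b * w k b)) =
    (\<Sum>a<n. \<Sum>b<n. x a * y b * (\<Sum>k<n. c k * w k a * w k b))"
proof -
  have "(\<Sum>k<n. c k * (\<Sum>a<n. x a * w k a) * (\<Sum>b<n. y b * w k b)) =
     (\<Sum>k<n. \<Sum>a<n. \<Sum>b<n. x a * y b * (c k * w k a * w k b))"
    by (simp add: sum_distrib_left sum_distrib_right ac_simps)
  also have "\<dots> = (\<Sum>a<n. \<Sum>k<n. \<Sum>b<n. x a * y b * (c k * w k a * w k b))"
    by (rule sum.swap)
  also have "\<dots> = (\<Sum>a<n. \<Sum>b<n. \<Sum>k<n. x a * y b * (c k * w k a * w k b))"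
    by (rule sum.cong[OF refl], rule sum.swap)
  finally show ?thesis by (simp add: sum_distrib_left ac_simps)
qed

text \<open>
  The row \<open>u k\<close> is the eigenvector for \<open>lam k\<close>. Orthogonality of rows and of columns are both part of
  the notion because they serve different purposes: the first one gives the eigenvalue equation, the
  second one the completeness of the eigenbasis. Matrices are functions on indices below \<open>n\<close>, which makes
  minors and sums over entries immediate.
\<close>
definition eigensystem :: "nat \<Rightarrow> (nat \<Rightarrow> nat \<Rightarrow> real) \<Rightarrow> (nat \<Rightarrow> real) \<Rightarrow> (nat \<Rightarrow> nat \<Rightarrow> real) \<Rightarrow> bool" where
  "eigensystem n M lam u \<longleftrightarrow>
     (\<forall>k<n. \<forall>l<n. (\<Sum>i<n. u k i * u l i) = of_bool (k = l)) \<and>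
     (\<forall>i<n. \<forall>j<n. (\<Sum>k<n. u k i * u k j) = of_bool (i = j)) \<and>
     (\<forall>i<n. \<forall>j<n. M i j = (\<Sum>k<n. lam k * u k i * u k j))"

lemma eigensystemD:
  assumes "eigensystem n M lam u"
  shows "k < n \<Longrightarrow> l < n \<Longrightarrow> (\<Sum>i<n. u k i * u l i) = of_bool (k = l)"
    and "i < n \<Longrightarrow> j < n \<Longrightarrow> (\<Sum>k<n. u k i * u k j) = of_bool (i = j)"
    and "i < n \<Longrightarrow> j < n \<Longrightarrow> M i j = (\<Sum>k<n. lam k * u k i * u k j)"
  using assms unfolding eigensystem_def by blast+

text \<open>
  The characteristic polynomial has a complex root. For its eigenvector \<open>w\<close>, the number \<open>w\<^sup>* M w\<close> is invariant
  under conjugation by symmetry of \<open>M\<close>, so the root is real, and the real or the imaginary part of \<open>w\<close> is a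
  real eigenvector.
\<close>
lemma symmetric_has_real_eigenvector:
  fixes M :: "nat \<Rightarrow> nat \<Rightarrow> real"
  assumes n: "n > 0" and sym: "\<And>i j. i < n \<Longrightarrow> j < n \<Longrightarrow> M i j = M j i"
  shows "\<exists>e v. (\<exists>i<n. v i \<noteq> 0) \<and> (\<forall>i<n. (\<Sum>j<n. M i j * v j) = e * v i)"
proof -
  define A where "A = mat n n (\<lambda>(i, j). complex_of_real (M i j))"
  have A: "A \<in> carrier_mat n n" by (simp add: A_def)
  have "degree (char_poly A) = n" using degree_monic_char_poly[OF A] by simp
  hence "\<not> constant (poly (char_poly A))" using n by (simp add: constant_degree)
  then obtain z where "poly (char_poly A) z = 0" using fundamental_theorem_of_algebra by blast
  hence "eigenvalue A z" using eigenvalue_root_char_poly[OF A] by simp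
  then obtain v where "eigenvector A v z" unfolding eigenvalue_def by blast
  hence v: "v \<in> carrier_vec n" "v \<noteq> 0\<^sub>v n" and Av: "A *\<^sub>v v = z \<cdot>\<^sub>v v"
    using A unfolding eigenvector_def by auto
  define w where "w i = vec_index v i" for i
  have w0: "\<exists>i<n. w i \<noteq> 0"
  proof (rule ccontr)
    assume "\<not> ?thesis"
    hence "v = 0\<^sub>v n" using v(1) by (intro eq_vecI) (auto simp: w_def)
    thus False using v(2) by simp
  qed
  have ew: "(\<Sum>j<n. complex_of_real (M i j) * w j) = z * w i" if "i < n" for i
  proof -
    have "vec_index (A *\<^sub>v v) i = (\<Sum>j<n. complex_of_real (M i j) * w j)"
      using that v(1) A by (auto simp: A_def scalar_prod_def w_def lessThan_atLeast0 intro!: sum.cong)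
    thus ?thesis using Av that v(1) by (simp add: w_def)
  qed
  define q where "q = (\<Sum>i<n. cnj (w i) * (\<Sum>j<n. complex_of_real (M i j) * w j))"
  define s where "s = (\<Sum>i<n. (cmod (w i))\<^sup>2)"
  have "q = (\<Sum>i<n. z * complex_of_real ((cmod (w i))\<^sup>2))"
    unfolding q_def
  proof (intro sum.cong refl)
    fix i assume "i \<in> {..<n}"
    hence "cnj (w i) * (\<Sum>j<n. complex_of_real (M i j) * w j) = z * (w i * cnj (w i))"
      using ew by simp
    thus "cnj (w i) * (\<Sum>j<n. complex_of_real (M i j) * w j) = z * complex_of_real ((cmod (w i))\<^sup>2)"
      by (simp only: complex_norm_square)
  qed
  hence q1: "q = z * of_real s" unfolding s_def by (simp add: sum_distrib_left)
  have "cnj q = (\<Sum>i<n. \<Sum>j<n. w i * (complex_of_real (M i j) * cnj (w j)))"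
    unfolding q_def by (simp add: sum_distrib_left)
  also have "\<dots> = (\<Sum>j<n. \<Sum>i<n. w i * (complex_of_real (M i j) * cnj (w j)))"
    by (rule sum.swap)
  also have "\<dots> = q" unfolding q_def using sym by (auto simp: sum_distrib_left ac_simps intro!: sum.cong)
  finally have q2: "cnj q = q" .
  have "s > 0"
  proof -
    from w0 obtain i where i: "i < n" "w i \<noteq> 0" by blast
    have "0 < (cmod (w i))\<^sup>2" using i by simp
    also have "\<dots> \<le> s" unfolding s_def using i by (intro member_le_sum) auto
    finally show ?thesis .
  qed
  hence "cnj z = z" using q1 q2 by simp
  then obtain e where e: "z = complex_of_real e" by (metis Reals_cases Reals_cnj_iff)
  have re: "(\<Sum>j<n. M i j * Re (w j)) = e * Re (w i)" and im: "(\<Sum>j<n. M i j * Im (w j)) = e * Im (w i)"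
    if "i < n" for i
    using arg_cong[OF ew[OF that], of Re] arg_cong[OF ew[OF that], of Im] by (simp_all add: e)
  from w0 obtain i where i: "i < n" "w i \<noteq> 0" by blast
  hence "Re (w i) \<noteq> 0 \<or> Im (w i) \<noteq> 0" by (auto simp: complex_eq_iff)
  thus ?thesis
  proof
    assume "Re (w i) \<noteq> 0"
    thus ?thesis using re i(1) by (intro exI[of _ e] exI[of _ "\<lambda>i. Re (w i)"]) auto
  next
    assume "Im (w i) \<noteq> 0"
    thus ?thesis using im i(1) by (intro exI[of _ e] exI[of _ "\<lambda>i. Im (w i)"]) auto
  qed
qed

text \<open>
  The reflection in the hyperplane orthogonal to \<open>w = v - e\<^sub>0\<close> exchanges the unit vector \<open>v\<close> with \<open>e\<^sub>0\<close>. It is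
  its own inverse and transpose, so conjugation by it needs no separate inverse matrix.
\<close>
lemma householder_reflection:
  fixes v :: "nat \<Rightarrow> real"
  assumes n: "n > 0" and v: "(\<Sum>i<n. (v i)\<^sup>2) = 1"
  shows "\<exists>H. (\<forall>i j. H i j = H j i) \<and> (\<forall>i<n. H i 0 = v i) \<and>
    (\<forall>i<n. \<forall>j<n. (\<Sum>k<n. H i k * H j k) = of_bool (i = j))"
proof -
  define w where "w i = v i - of_bool (i = 0)" for i
  define s where "s = (\<Sum>i<n. w i * w i)"
  define H where "H i j = of_bool (i = j) - 2 / s * (w i * w j)" for i j
  have s: "s = 2 - 2 * v 0"
  proof -
    define d :: "nat \<Rightarrow> real" where "d i = of_bool (i = 0)" for i
    have "s = (\<Sum>i<n. (v i)\<^sup>2) - 2 * (\<Sum>i<n. v i * d i) + (\<Sum>i<n. d i * d i)"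
      unfolding s_def w_def d_def[symmetric]
      by (simp add: algebra_simps power2_eq_square sum.distrib sum_subtractf sum_distrib_left)
    also have "(\<Sum>i<n. v i * d i) = v 0"
      using n unfolding d_def by (simp only: sum_of_bool_mult)
    also have "(\<Sum>i<n. d i * d i) = d 0"
      using n unfolding d_def by (simp only: sum_of_bool_mult)
    finally show ?thesis using v by (simp add: d_def)
  qed
  \<comment> \<open>If \<open>v = e\<^sub>0\<close>, then \<open>s = 0\<close> and, as division by zero yields zero, \<open>H\<close> is the identity, as it should be.\<close>
  have s0: "w i = 0" if "s = 0" "i < n" for i
    using that unfolding s_def by (subst (asm) sum_nonneg_eq_0_iff) auto
  have "H i 0 = v i" if i: "i < n" for i
  proof (cases "s = 0")
    case True thus ?thesis using s0[OF True i] by (simp add: H_def w_def)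
  next
    case False
    have "w 0 = - s / 2" by (simp add: w_def s)
    thus ?thesis using False by (simp add: H_def) (simp add: w_def)
  qed
  moreover have "(\<Sum>k<n. H i k * H j k) = of_bool (i = j)" if i: "i < n" and j: "j < n" for i j
  proof -
    define d :: "nat \<Rightarrow> nat \<Rightarrow> real" where "d i j = of_bool (i = j)" for i j
    define c where "c = 2 / s"
    have "(\<Sum>k<n. H i k * H j k) = (\<Sum>k<n. d i k * d j k) - c * w j * (\<Sum>k<n. d i k * w k)
       - c * w i * (\<Sum>k<n. d j k * w k) + c\<^sup>2 * w i * w j * (\<Sum>k<n. w k * w k)"
      unfolding H_def c_def[symmetric] d_def[symmetric]
      by (simp add: algebra_simps power2_eq_square sum.distrib sum_subtractf sum_distrib_left)
    also have "(\<Sum>k<n. d i k * d j k) = d j i"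
      using i unfolding d_def by (simp only: sum_of_bool_mult)
    also have "(\<Sum>k<n. d i k * w k) = w i"
      using i unfolding d_def by (simp only: sum_of_bool_mult)
    also have "(\<Sum>k<n. d j k * w k) = w j"
      using j unfolding d_def by (simp only: sum_of_bool_mult)
    finally have "(\<Sum>k<n. H i k * H j k) = of_bool (i = j) - 4 / s * w i * w j + (2 / s)\<^sup>2 * w i * w j * s"
      by (simp add: d_def c_def s_def eq_commute[of j])
    also have "\<dots> = of_bool (i = j)" by (cases "s = 0") (simp_all add: power2_eq_square field_simps)
    finally show ?thesis .
  qed
  ultimately show ?thesis by (intro exI[of _ H]) (auto simp: H_def)
qed

lemma eigensystem_conjugate:
  fixes H :: "nat \<Rightarrow> nat \<Rightarrow> real"
  assumes es: "eigensystem n A lam w"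
    and Hsym: "\<And>i j. H i j = H j i"
    and Horth: "\<And>i j. i < n \<Longrightarrow> j < n \<Longrightarrow> (\<Sum>k<n. H i k * H j k) = of_bool (i = j)"
    and M: "\<And>i j. i < n \<Longrightarrow> j < n \<Longrightarrow> M i j = (\<Sum>a<n. \<Sum>b<n. H i a * H j b * A a b)"
  shows "eigensystem n M lam (\<lambda>k i. \<Sum>a<n. H i a * w k a)"
  unfolding eigensystem_def
proof (intro conjI allI impI)
  fix k l assume kl: "k < n" "l < n"
  have "(\<Sum>i<n. (\<Sum>a<n. H i a * w k a) * (\<Sum>a<n. H i a * w l a)) =
     (\<Sum>i<n. 1 * (\<Sum>a<n. w k a * H i a) * (\<Sum>a<n. w l a * H i a))"
    by (simp add: ac_simps)
  also have "\<dots> = (\<Sum>a<n. \<Sum>b<n. w k a * w l b * (\<Sum>i<n. 1 * H i a * H i b))"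
    by (rule sum_bilinear_swap)
  also have "\<dots> = (\<Sum>a<n. \<Sum>b<n. w k a * w l b * of_bool (a = b))"
  proof (intro sum.cong refl)
    fix a b assume "a \<in> {..<n}" "b \<in> {..<n}"
    thus "w k a * w l b * (\<Sum>i<n. 1 * H i a * H i b) = w k a * w l b * of_bool (a = b)"
      using Horth[of a b] by (simp add: Hsym[of _ a] Hsym[of _ b])
  qed
  also have "\<dots> = (\<Sum>a<n. w k a * w l a)"
    by (intro sum.cong refl) (simp add: sum_of_bool_mult)
  finally show "(\<Sum>i<n. (\<Sum>a<n. H i a * w k a) * (\<Sum>a<n. H i a * w l a)) = of_bool (k = l)"
    using eigensystemD(1)[OF es] kl by simp
next
  fix i j assume ij: "i < n" "j < n"
  have "(\<Sum>k<n. (\<Sum>a<n. H i a * w k a) * (\<Sum>a<n. H j a * w k a)) =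
     (\<Sum>k<n. 1 * (\<Sum>a<n. H i a * w k a) * (\<Sum>a<n. H j a * w k a))" by simp
  also have "\<dots> = (\<Sum>a<n. \<Sum>b<n. H i a * H j b * (\<Sum>k<n. 1 * w k a * w k b))"
    by (rule sum_bilinear_swap)
  also have "\<dots> = (\<Sum>a<n. \<Sum>b<n. H i a * H j b * of_bool (a = b))"
    using eigensystemD(2)[OF es] by (intro sum.cong refl) simp
  also have "\<dots> = (\<Sum>a<n. H i a * H j a)"
    by (intro sum.cong refl) (simp add: sum_of_bool_mult)
  finally show "(\<Sum>k<n. (\<Sum>a<n. H i a * w k a) * (\<Sum>a<n. H j a * w k a)) = of_bool (i = j)"
    using Horth ij by simp
next
  fix i j assume ij: "i < n" "j < n"
  have "(\<Sum>k<n. lam k * (\<Sum>a<n. H i a * w k a) * (\<Sum>a<n. H j a * w k a)) =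
     (\<Sum>a<n. \<Sum>b<n. H i a * H j b * (\<Sum>k<n. lam k * w k a * w k b))"
    by (rule sum_bilinear_swap)
  also have "\<dots> = (\<Sum>a<n. \<Sum>b<n. H i a * H j b * A a b)"
    using eigensystemD(3)[OF es] by (intro sum.cong refl) simp
  finally show "M i j = (\<Sum>k<n. lam k * (\<Sum>a<n. H i a * w k a) * (\<Sum>a<n. H j a * w k a))"
    using M ij by simp
qed

lemma sum_involution_conjugate:
  fixes H :: "nat \<Rightarrow> nat \<Rightarrow> real"
  assumes Hsym: "\<And>i j. H i j = H j i"
    and Horth: "\<And>i j. i < n \<Longrightarrow> j < n \<Longrightarrow> (\<Sum>k<n. H i k * H j k) = of_bool (i = j)"
    and ij: "i < n" "j < n"
  shows "(\<Sum>a<n. \<Sum>b<n. H i a * H j b * (\<Sum>c<n. \<Sum>d<n. H a c * H b d * M c d)) = M i j"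
proof -
  have "(\<Sum>a<n. \<Sum>b<n. H i a * H j b * (\<Sum>c<n. \<Sum>d<n. H a c * H b d * M c d)) =
     (\<Sum>a<n. \<Sum>b<n. \<Sum>c<n. \<Sum>d<n. (H i a * H a c) * (H j b * H b d) * M c d)"
    by (simp add: sum_distrib_left ac_simps)
  also have "\<dots> = (\<Sum>a<n. \<Sum>c<n. \<Sum>b<n. \<Sum>d<n. (H i a * H a c) * (H j b * H b d) * M c d)"
    by (rule sum.cong[OF refl], rule sum.swap)
  also have "\<dots> = (\<Sum>c<n. \<Sum>a<n. \<Sum>b<n. \<Sum>d<n. (H i a * H a c) * (H j b * H b d) * M c d)"
    by (rule sum.swap)
  also have "\<dots> = (\<Sum>c<n. \<Sum>a<n. \<Sum>d<n. \<Sum>b<n. (H i a * H a c) * (H j b * H b d) * M c d)"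
    by (rule sum.cong[OF refl], rule sum.cong[OF refl], rule sum.swap)
  also have "\<dots> = (\<Sum>c<n. \<Sum>d<n. \<Sum>a<n. \<Sum>b<n. (H i a * H a c) * (H j b * H b d) * M c d)"
    by (rule sum.cong[OF refl], rule sum.swap)
  also have "\<dots> = (\<Sum>c<n. \<Sum>d<n. (\<Sum>a<n. H i a * H a c) * (\<Sum>b<n. H j b * H b d) * M c d)"
    by (simp only: sum_product) (simp only: sum_distrib_right)
  also have "\<dots> = (\<Sum>c<n. \<Sum>d<n. of_bool (i = c) * of_bool (j = d) * M c d)"
  proof (intro sum.cong refl)
    fix c d assume "c \<in> {..<n}" "d \<in> {..<n}"
    thus "(\<Sum>a<n. H i a * H a c) * (\<Sum>b<n. H j b * H b d) * M c d = of_bool (i = c) * of_bool (j = d) * M c d"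
      using Horth[of i c] Horth[of j d] ij by (simp add: Hsym[of _ c] Hsym[of _ d])
  qed
  also have "\<dots> = (\<Sum>c<n. of_bool (i = c) * (\<Sum>d<n. of_bool (j = d) * M c d))"
    by (simp only: sum_distrib_left mult.assoc)
  also have "\<dots> = M i j" using ij by (simp only: sum_of_bool_mult)
  finally show ?thesis .
qed

text \<open>
  Conjugation by the reflection that moves a unit eigenvector to \<open>e\<^sub>0\<close> makes row and column 0 vanish off the
  diagonal; the induction hypothesis applies to the remaining minor.
\<close>
theorem symmetric_eigensystem_exists:
  assumes "\<And>i j. i < n \<Longrightarrow> j < n \<Longrightarrow> M i j = M j i"
  shows "\<exists>lam u. eigensystem n M lam u"
  using assms
proof (induction n arbitrary: M)
  case 0
  show ?case by (simp add: eigensystem_def)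
next
  case (Suc n M)
  let ?N = "Suc n"
  obtain e v0 where v0: "\<exists>i<?N. v0 i \<noteq> 0" and ev0: "\<And>i. i < ?N \<Longrightarrow> (\<Sum>j<?N. M i j * v0 j) = e * v0 i"
    using symmetric_has_real_eigenvector[of ?N M] Suc.prems by blast
  define s where "s = (\<Sum>i<?N. (v0 i)\<^sup>2)"
  have s: "s > 0"
  proof -
    from v0 obtain i where i: "i < ?N" "v0 i \<noteq> 0" by blast
    have "0 < (v0 i)\<^sup>2" using i by simp
    also have "\<dots> \<le> s" unfolding s_def using i by (intro member_le_sum) auto
    finally show ?thesis .
  qed
  define v where "v i = v0 i / sqrt s" for i
  have "(\<Sum>i<?N. (v i)\<^sup>2) = 1" using s
    unfolding v_def by (simp only: power_divide sum_divide_distrib[symmetric] s_def[symmetric]) simp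
  then obtain H where Hsym: "\<And>i j. H i j = H j i" and H0: "\<And>i. i < ?N \<Longrightarrow> H i 0 = v i"
    and Horth: "\<And>i j. i < ?N \<Longrightarrow> j < ?N \<Longrightarrow> (\<Sum>k<?N. H i k * H j k) = of_bool (i = j)"
    using householder_reflection[of ?N v] by blast
  have ev: "(\<Sum>j<?N. M i j * v j) = e * v i" if "i < ?N" for i
    using ev0[OF that] unfolding v_def by (simp only: times_divide_eq_right sum_divide_distrib[symmetric])
  define A where "A a b = (\<Sum>c<?N. \<Sum>d<?N. H a c * H b d * M c d)" for a b
  have Asym: "A a b = A b a" for a b
  proof -
    have "A a b = (\<Sum>d<?N. \<Sum>c<?N. H a c * H b d * M c d)" unfolding A_def by (rule sum.swap)
    also have "\<dots> = A b a" unfolding A_def using Suc.prems by (intro sum.cong refl) (simp add: ac_simps)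
    finally show ?thesis .
  qed
  have A0: "A a 0 = e * of_bool (a = 0)" if a: "a < ?N" for a
  proof -
    have "A a 0 = (\<Sum>c<?N. H a c * (\<Sum>d<?N. M c d * v d))"
      unfolding A_def sum_distrib_left using H0 Hsym[of 0] by (intro sum.cong refl) (simp add: ac_simps)
    also have "\<dots> = (\<Sum>c<?N. H a c * (e * H 0 c))"
      using ev H0 Hsym[of 0] by (intro sum.cong refl) (simp del: sum.lessThan_Suc)
    also have "\<dots> = e * (\<Sum>c<?N. H a c * H 0 c)"
      by (simp add: sum_distrib_left ac_simps del: sum.lessThan_Suc)
    finally show ?thesis using Horth[OF a, of 0] by simp
  qed
  obtain lam u where es: "eigensystem n (\<lambda>i j. A (Suc i) (Suc j)) lam u"
    using Suc.IH[of "\<lambda>i j. A (Suc i) (Suc j)"] Asym by blast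
  define lam' where "lam' k = (case k of 0 \<Rightarrow> e | Suc k \<Rightarrow> lam k)" for k
  define w where "w k i = (case k of 0 \<Rightarrow> of_bool (i = 0) | Suc k \<Rightarrow> (case i of 0 \<Rightarrow> 0 | Suc i \<Rightarrow> u k i))" for k i :: nat
  have w: "w 0 0 = 1" "w 0 (Suc i) = 0" "w (Suc k) 0 = 0" "w (Suc k) (Suc i) = u k i" for k i
    by (simp_all add: w_def)
  have lam': "lam' 0 = e" "lam' (Suc k) = lam k" for k by (simp_all add: lam'_def)
  have "eigensystem ?N A lam' w"
    unfolding eigensystem_def
  proof (intro conjI allI impI)
    fix k l assume "k < ?N" "l < ?N"
    thus "(\<Sum>i<?N. w k i * w l i) = of_bool (k = l)"
      using eigensystemD(1)[OF es]
      by (cases k; cases l) (simp_all add: sum.lessThan_Suc_shift w del: sum.lessThan_Suc)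
  next
    fix i j assume "i < ?N" "j < ?N"
    thus "(\<Sum>k<?N. w k i * w k j) = of_bool (i = j)"
      using eigensystemD(2)[OF es]
      by (cases i; cases j) (simp_all add: sum.lessThan_Suc_shift w del: sum.lessThan_Suc)
  next
    fix i j assume "i < ?N" "j < ?N"
    thus "A i j = (\<Sum>k<?N. lam' k * w k i * w k j)"
      using eigensystemD(3)[OF es] A0[of i] A0[of j] Asym[of 0 j]
      by (cases i; cases j) (simp_all add: sum.lessThan_Suc_shift w lam' del: sum.lessThan_Suc)
  qed
  moreover have "M i j = (\<Sum>a<?N. \<Sum>b<?N. H i a * H j b * A a b)" if "i < ?N" "j < ?N" for i j
    unfolding A_def using sum_involution_conjugate[OF Hsym Horth that, of M] by simp
  ultimately have "eigensystem ?N M lam' (\<lambda>k i. \<Sum>a<?N. H i a * w k a)"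
    using eigensystem_conjugate[of ?N A lam' w H M] Hsym Horth by blast
  thus ?case by blast
qed

text \<open>
  The matrix is similar to the diagonal matrix of the \<open>lam k\<close>, so these are the roots of its characteristic
  polynomial with multiplicity.
\<close>
lemma energy_eigensystem:
  assumes es: "eigensystem n M lam u"
  shows "energy (mat n n (\<lambda>(i, j). M i j)) = (\<Sum>k<n. \<bar>lam k\<bar>)"
proof -
  define A where "A = mat n n (\<lambda>(i, j). M i j)"
  define D where "D = mat n n (\<lambda>(i, j). if i = j then lam i else 0)"
  define P where "P = mat n n (\<lambda>(i, k). u k i)"
  define Q where "Q = mat n n (\<lambda>(k, i). u k i)"
  have carr: "A \<in> carrier_mat n n" "D \<in> carrier_mat n n" "P \<in> carrier_mat n n" "Q \<in> carrier_mat n n"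
    by (simp_all add: A_def D_def P_def Q_def)
  have PQ: "P * Q = 1\<^sub>m n"
    by (rule eq_matI) (auto simp: P_def Q_def scalar_prod_def lessThan_atLeast0[symmetric] eigensystemD(2)[OF es])
  have QP: "Q * P = 1\<^sub>m n"
    by (rule eq_matI) (auto simp: P_def Q_def scalar_prod_def lessThan_atLeast0[symmetric] eigensystemD(1)[OF es])
  have DQ: "D * Q = mat n n (\<lambda>(k, i). lam k * u k i)"
  proof (rule eq_matI)
    fix k i assume "k < dim_row (mat n n (\<lambda>(k, i). lam k * u k i))" "i < dim_col (mat n n (\<lambda>(k, i). lam k * u k i))"
    hence ki: "k < n" "i < n" by auto
    have "(D * Q) $$ (k, i) = (\<Sum>l<n. of_bool (k = l) * (lam k * u l i))"
      using ki by (simp add: D_def Q_def scalar_prod_def lessThan_atLeast0[symmetric] of_bool_def cong: if_cong)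
        (intro sum.cong refl, simp)
    thus "(D * Q) $$ (k, i) = mat n n (\<lambda>(k, i). lam k * u k i) $$ (k, i)"
      using ki by (simp only: sum_of_bool_mult) simp
  qed (auto simp: D_def Q_def)
  have "A = P * (D * Q)"
    unfolding DQ
    by (rule eq_matI) (auto simp: A_def P_def scalar_prod_def lessThan_atLeast0[symmetric]
      eigensystemD(3)[OF es] ac_simps)
  hence "A = P * D * Q" using carr by simp
  hence "similar_mat A D" unfolding similar_mat_def
    using carr PQ QP by (intro exI[of _ P] exI[of _ Q] similar_mat_witI[of _ _ n]) auto
  hence "char_poly A = char_poly D" by (rule char_poly_similar)
  also have "\<dots> = (\<Prod>a\<leftarrow>diag_mat D. [:- a, 1:])"
    using carr by (intro char_poly_upper_triangular) (auto simp: D_def)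
  also have "diag_mat D = map lam [0..<n]" by (auto simp: diag_mat_def D_def)
  finally have cp: "char_poly A = (\<Prod>k\<leftarrow>[0..<n]. [:- lam k, 1:])" by (simp add: o_def)
  have "proots (\<Prod>k\<leftarrow>ks. [:- lam k, 1:]) = mset (map lam ks)" for ks
  proof (induction ks)
    case (Cons k ks)
    have "(\<Prod>k\<leftarrow>ks. [:- lam k, 1:]) \<noteq> 0" by (auto simp: prod_list_zero_iff)
    thus ?case using Cons by (simp add: proots_mult del: mult_pCons_left)
  qed simp
  hence "energy A = (\<Sum>x\<in>#mset (map lam [0..<n]). \<bar>x\<bar>)"
    unfolding energy_def cp by simp
  also have "\<dots> = (\<Sum>k<n. \<bar>lam k\<bar>)"
    by (simp only: mset_map[symmetric] sum_mset_sum_list map_map o_def) (simp add: interv_sum_list_conv_sum_set_nat lessThan_atLeast0)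
  finally show ?thesis by (simp add: A_def)
qed

section \<open>Energy as a trace norm\<close>

definition trace_norm :: "nat \<Rightarrow> (nat \<Rightarrow> nat \<Rightarrow> real) \<Rightarrow> real" where
  "trace_norm n M = energy (mat n n (\<lambda>(i, j). M i j))"

lemma trace_norm_eigensystem: "eigensystem n M lam u \<Longrightarrow> trace_norm n M = (\<Sum>k<n. \<bar>lam k\<bar>)"
  unfolding trace_norm_def by (rule energy_eigensystem)

lemma trace_norm_cong:
  assumes "\<And>i j. i < n \<Longrightarrow> j < n \<Longrightarrow> M i j = M' i j"
  shows "trace_norm n M = trace_norm n M'"
  unfolding trace_norm_def using assms by (intro arg_cong[where f = energy] cong_mat) auto

lemma parseval:
  fixes w :: "nat \<Rightarrow> nat \<Rightarrow> 'a::comm_semiring_1"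
  assumes "\<And>k l. k < n \<Longrightarrow> l < n \<Longrightarrow> (\<Sum>i<n. w i k * w i l) = of_bool (k = l)"
  shows "(\<Sum>i<n. (\<Sum>k<n. x k * w i k) * (\<Sum>k<n. y k * w i k)) = (\<Sum>k<n. x k * y k)"
proof -
  have "(\<Sum>i<n. (\<Sum>k<n. x k * w i k) * (\<Sum>k<n. y k * w i k)) =
     (\<Sum>i<n. 1 * (\<Sum>k<n. x k * w i k) * (\<Sum>k<n. y k * w i k))" by simp
  also have "\<dots> = (\<Sum>k<n. \<Sum>l<n. x k * y l * (\<Sum>i<n. 1 * w i k * w i l))"
    by (rule sum_bilinear_swap)
  also have "\<dots> = (\<Sum>k<n. \<Sum>l<n. x k * y l * of_bool (k = l))"
    using assms by (intro sum.cong refl) simp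
  also have "\<dots> = (\<Sum>k<n. x k * y k)"
    by (intro sum.cong refl) (simp add: sum_of_bool_mult)
  finally show ?thesis .
qed

lemma eigensystem_eigenvector:
  assumes es: "eigensystem n M lam u" and "i < n" "k < n"
  shows "(\<Sum>j<n. M i j * u k j) = lam k * u k i"
proof -
  have "(\<Sum>j<n. M i j * u k j) = (\<Sum>j<n. (\<Sum>l<n. lam l * u l i * u l j) * u k j)"
    using eigensystemD(3)[OF es] assms by simp
  also have "\<dots> = (\<Sum>j<n. \<Sum>l<n. lam l * u l i * (u l j * u k j))"
    by (simp add: sum_distrib_right mult.assoc)
  also have "\<dots> = (\<Sum>l<n. \<Sum>j<n. lam l * u l i * (u l j * u k j))" by (rule sum.swap)
  also have "\<dots> = (\<Sum>l<n. (lam l * u l i) * of_bool (l = k))"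
    using eigensystemD(1)[OF es] assms by (simp only: sum_distrib_left[symmetric]) simp
  also have "\<dots> = lam k * u k i" using assms by (simp only: sum_of_bool_mult)
  finally show ?thesis .
qed

definition quadratic_form :: "nat \<Rightarrow> (nat \<Rightarrow> nat \<Rightarrow> real) \<Rightarrow> (nat \<Rightarrow> real) \<Rightarrow> real" where
  "quadratic_form n M v = (\<Sum>i<n. \<Sum>j<n. v i * v j * M i j)"

lemma quadratic_form_eigensystem:
  assumes es: "eigensystem n M lam u"
  shows "quadratic_form n M v = (\<Sum>l<n. lam l * (\<Sum>i<n. v i * u l i)\<^sup>2)"
proof -
  have "(\<Sum>l<n. lam l * (\<Sum>i<n. v i * u l i)\<^sup>2) = (\<Sum>l<n. lam l * (\<Sum>i<n. v i * u l i) * (\<Sum>i<n. v i * u l i))"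
    by (simp add: power2_eq_square ac_simps)
  also have "\<dots> = (\<Sum>a<n. \<Sum>b<n. v a * v b * (\<Sum>k<n. lam k * u k a * u k b))"
    by (rule sum_bilinear_swap)
  also have "\<dots> = quadratic_form n M v" unfolding quadratic_form_def
    using eigensystemD(3)[OF es] by (intro sum.cong refl) simp
  finally show ?thesis by simp
qed

lemma quadratic_form_eigenvector:
  assumes es: "eigensystem n M lam u" and k: "k < n"
  shows "quadratic_form n M (u k) = lam k"
proof -
  have "quadratic_form n M (u k) = (\<Sum>l<n. lam l * of_bool (k = l))"
    unfolding quadratic_form_eigensystem[OF es] using eigensystemD(1)[OF es] k
    by (intro sum.cong refl) (simp add: of_bool_def)
  thus ?thesis using k by (simp only: sum_of_bool_mult)
qed

text \<open>
  This is the half of the duality between trace norm and operator norm from which the triangle inequality follows: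
  in the eigenbasis of \<open>M\<close> the left side is at most \<open>\<Sum>\<^sub>k \<Sum>\<^sub>l \<bar>lam l\<bar> \<langle>v k, u l\<rangle>\<^sup>2\<close>, and the squared coefficients of each
  \<open>u l\<close> with respect to the orthonormal basis \<open>v\<close> add up to 1.
\<close>
lemma sum_abs_quadratic_form_le_trace_norm:
  assumes es: "eigensystem n M lam u"
    and v: "\<And>i j. i < n \<Longrightarrow> j < n \<Longrightarrow> (\<Sum>k<n. v k i * v k j) = of_bool (i = j)"
  shows "(\<Sum>k<n. \<bar>quadratic_form n M (v k)\<bar>) \<le> trace_norm n M"
proof -
  have "(\<Sum>k<n. \<bar>quadratic_form n M (v k)\<bar>) \<le> (\<Sum>k<n. \<Sum>l<n. \<bar>lam l\<bar> * (\<Sum>i<n. v k i * u l i)\<^sup>2)"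
    unfolding quadratic_form_eigensystem[OF es]
    by (intro sum_mono order.trans[OF sum_abs]) (simp add: abs_mult)
  also have "\<dots> = (\<Sum>l<n. \<bar>lam l\<bar> * (\<Sum>k<n. (\<Sum>i<n. u l i * v k i) * (\<Sum>i<n. u l i * v k i)))"
    by (subst sum.swap) (simp add: sum_distrib_left power2_eq_square ac_simps)
  also have "\<dots> = (\<Sum>l<n. \<bar>lam l\<bar> * (\<Sum>i<n. u l i * u l i))"
    using v by (subst parseval) auto
  also have "\<dots> = trace_norm n M"
    using eigensystemD(1)[OF es] trace_norm_eigensystem[OF es] by simp
  finally show ?thesis .
qed

definition symmetric_on :: "nat \<Rightarrow> (nat \<Rightarrow> nat \<Rightarrow> real) \<Rightarrow> bool" where
  "symmetric_on n M \<longleftrightarrow> (\<forall>i<n. \<forall>j<n. M i j = M j i)"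

lemma symmetric_eigensystem: 
  assumes "symmetric_on n M"
  obtains lam u where "eigensystem n M lam u"
  using symmetric_eigensystem_exists[of n M] assms unfolding symmetric_on_def by blast

lemma symmetric_on_add: "symmetric_on n X \<Longrightarrow> symmetric_on n Y \<Longrightarrow> symmetric_on n (\<lambda>i j. X i j + Y i j)"
  by (simp add: symmetric_on_def)

text \<open>
  The eigenvalues of the sum are values of its quadratic form on its own eigenbasis, and there the form splits into
  the forms of the two summands.
\<close>
lemma trace_norm_triangle:
  assumes "symmetric_on n X" "symmetric_on n Y"
  shows "trace_norm n (\<lambda>i j. X i j + Y i j) \<le> trace_norm n X + trace_norm n Y"
proof -
  obtain lx ux where X: "eigensystem n X lx ux" using assms(1) by (rule symmetric_eigensystem)
  obtain ly uy where Y: "eigensystem n Y ly uy" using assms(2) by (rule symmetric_eigensystem)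
  obtain l u where XY: "eigensystem n (\<lambda>i j. X i j + Y i j) l u"
    using symmetric_on_add[OF assms] by (rule symmetric_eigensystem)
  have add: "quadratic_form n (\<lambda>i j. X i j + Y i j) v = quadratic_form n X v + quadratic_form n Y v" for v
    by (simp add: quadratic_form_def algebra_simps sum.distrib)
  have "trace_norm n (\<lambda>i j. X i j + Y i j) = (\<Sum>k<n. \<bar>quadratic_form n X (u k) + quadratic_form n Y (u k)\<bar>)"
    using trace_norm_eigensystem[OF XY] quadratic_form_eigenvector[OF XY] by (simp add: add)
  also have "\<dots> \<le> (\<Sum>k<n. \<bar>quadratic_form n X (u k)\<bar>) + (\<Sum>k<n. \<bar>quadratic_form n Y (u k)\<bar>)"
    by (simp add: sum.distrib[symmetric] sum_mono abs_triangle_ineq)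
  also have "\<dots> \<le> trace_norm n X + trace_norm n Y"
    by (intro add_mono sum_abs_quadratic_form_le_trace_norm[OF X] sum_abs_quadratic_form_le_trace_norm[OF Y]
        eigensystemD(2)[OF XY])
  finally show ?thesis .
qed

lemma trace_norm_scale:
  assumes "symmetric_on n X"
  shows "trace_norm n (\<lambda>i j. c * X i j) = \<bar>c\<bar> * trace_norm n X"
proof -
  obtain l u where X: "eigensystem n X l u" using assms by (rule symmetric_eigensystem)
  hence "eigensystem n (\<lambda>i j. c * X i j) (\<lambda>k. c * l k) u"
    by (auto simp: eigensystem_def sum_distrib_left ac_simps)
  thus ?thesis using X by (simp add: trace_norm_eigensystem abs_mult sum_distrib_left)
qed

lemma trace_norm_perturbation:
  assumes "symmetric_on n X" "symmetric_on n Y"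
  shows "\<bar>trace_norm n (\<lambda>i j. X i j + Y i j) - trace_norm n X\<bar> \<le> trace_norm n Y"
proof -
  have neg: "symmetric_on n (\<lambda>i j. - 1 * Y i j)" using assms(2) by (simp add: symmetric_on_def)
  have "trace_norm n X = trace_norm n (\<lambda>i j. (X i j + Y i j) + - 1 * Y i j)" by (simp add: algebra_simps)
  also have "\<dots> \<le> trace_norm n (\<lambda>i j. X i j + Y i j) + trace_norm n (\<lambda>i j. - 1 * Y i j)"
    by (rule trace_norm_triangle[OF symmetric_on_add[OF assms] neg])
  also have "trace_norm n (\<lambda>i j. - 1 * Y i j) = trace_norm n Y"
    by (subst trace_norm_scale[OF assms(2)]) simp
  finally show ?thesis using trace_norm_triangle[OF assms] by linarith
qed

lemma sum_eigenvalues_eq_trace: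
  assumes es: "eigensystem n M lam u"
  shows "(\<Sum>k<n. lam k) = (\<Sum>i<n. M i i)"
proof -
  have "(\<Sum>i<n. M i i) = (\<Sum>i<n. \<Sum>k<n. lam k * (u k i * u k i))"
    using eigensystemD(3)[OF es] by (simp add: ac_simps)
  also have "\<dots> = (\<Sum>k<n. lam k * (\<Sum>i<n. u k i * u k i))"
    by (subst sum.swap) (simp add: sum_distrib_left)
  also have "\<dots> = (\<Sum>k<n. lam k)" using eigensystemD(1)[OF es] by simp
  finally show ?thesis by simp
qed

lemma trace_norm_psd:
  assumes "symmetric_on n M" and "\<And>v. quadratic_form n M v \<ge> 0"
  shows "trace_norm n M = (\<Sum>i<n. M i i)"
proof -
  obtain lam u where es: "eigensystem n M lam u" using assms(1) by (rule symmetric_eigensystem)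
  have "lam k \<ge> 0" if "k < n" for k using quadratic_form_eigenvector[OF es that] assms(2)[of "u k"] by simp
  thus ?thesis using trace_norm_eigensystem[OF es] sum_eigenvalues_eq_trace[OF es] by simp
qed

lemma sum_squares_eigenvalues:
  assumes es: "eigensystem n M lam u"
  shows "(\<Sum>k<n. (lam k)\<^sup>2) = (\<Sum>i<n. \<Sum>j<n. (M i j)\<^sup>2)"
proof -
  have "(\<Sum>i<n. \<Sum>j<n. (M i j)\<^sup>2) = (\<Sum>i<n. \<Sum>j<n. \<Sum>k<n. lam k * (u k i * (M i j * u k j)))"
  proof (intro sum.cong refl)
    fix i j assume "i \<in> {..<n}" "j \<in> {..<n}"
    hence "(M i j)\<^sup>2 = M i j * (\<Sum>k<n. lam k * u k i * u k j)"
      using eigensystemD(3)[OF es] by (simp add: power2_eq_square)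
    thus "(M i j)\<^sup>2 = (\<Sum>k<n. lam k * (u k i * (M i j * u k j)))" by (simp add: sum_distrib_left ac_simps)
  qed
  also have "\<dots> = (\<Sum>i<n. \<Sum>k<n. \<Sum>j<n. lam k * (u k i * (M i j * u k j)))"
    by (rule sum.cong[OF refl], rule sum.swap)
  also have "\<dots> = (\<Sum>k<n. \<Sum>i<n. \<Sum>j<n. lam k * (u k i * (M i j * u k j)))" by (rule sum.swap)
  also have "\<dots> = (\<Sum>k<n. \<Sum>i<n. lam k * (u k i * (lam k * u k i)))"
    using eigensystem_eigenvector[OF es] by (simp add: sum_distrib_left[symmetric])
  also have "\<dots> = (\<Sum>k<n. (lam k)\<^sup>2 * (\<Sum>i<n. u k i * u k i))"
    by (simp add: sum_distrib_left power2_eq_square ac_simps)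
  also have "\<dots> = (\<Sum>k<n. (lam k)\<^sup>2)" using eigensystemD(1)[OF es] by simp
  finally show ?thesis by simp
qed

lemma powr_three_halves: "real n powr (3 / 2) = real n * sqrt n"
proof (cases "n = 0")
  case False
  hence "real n powr (3 / 2) = real n powr (1 + 1 / 2)" by simp
  also have "\<dots> = real n * sqrt n" using False by (subst powr_add) (simp add: powr_half_sqrt)
  finally show ?thesis .
qed simp

text \<open>
  The Cauchy-Schwarz inequality bounds the sum of the \<open>n\<close> absolute eigenvalues by \<open>\<surd>n\<close> times the Frobenius norm, which is at
  most \<open>K n\<close>.
\<close>
lemma trace_norm_le_of_entries:
  assumes "symmetric_on n M" and K: "K \<ge> 0" "\<And>i j. i < n \<Longrightarrow> j < n \<Longrightarrow> \<bar>M i j\<bar> \<le> K"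
  shows "trace_norm n M \<le> K * real n powr (3 / 2)"
proof -
  obtain lam u where es: "eigensystem n M lam u" using assms(1) by (rule symmetric_eigensystem)
  have "(\<Sum>k<n. (lam k)\<^sup>2) \<le> (\<Sum>i<n. \<Sum>j<n. K\<^sup>2)"
    unfolding sum_squares_eigenvalues[OF es] using K by (intro sum_mono) (simp add: abs_le_square_iff[symmetric])
  hence "L2_set lam {..<n} \<le> real n * K"
    unfolding L2_set_def using K(1) by (intro real_le_lsqrt) (auto simp: power2_eq_square ac_simps)
  note norm_lam = this
  have "trace_norm n M = (\<Sum>k<n. \<bar>1\<bar> * \<bar>lam k\<bar>)" using trace_norm_eigensystem[OF es] by simp
  also have "\<dots> \<le> L2_set (\<lambda>_. 1) {..<n} * L2_set lam {..<n}" by (rule L2_set_mult_ineq)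
  also have "\<dots> = sqrt n * L2_set lam {..<n}" by (simp add: L2_set_def)
  also have "\<dots> \<le> sqrt n * (real n * K)" using norm_lam by (intro mult_left_mono) auto
  also have "\<dots> = K * real n powr (3 / 2)" by (simp add: powr_three_halves)
  finally show ?thesis .
qed

section \<open>Resolvents on the imaginary axis\<close>

text \<open>
  A choice of eigenbasis turns the eigenvalues into a function of the matrix. Only quantities that do not depend on the choice
  are studied: the resolvent, its trace and symmetric functions of the eigenvalues.
\<close>
definition some_eigensystem :: "nat \<Rightarrow> (nat \<Rightarrow> nat \<Rightarrow> real) \<Rightarrow> (nat \<Rightarrow> real) \<times> (nat \<Rightarrow> nat \<Rightarrow> real)" where
  "some_eigensystem n M = (SOME (lam, u). eigensystem n M lam u)"

definition eigenvalues :: "nat \<Rightarrow> (nat \<Rightarrow> nat \<Rightarrow> real) \<Rightarrow> nat \<Rightarrow> real" where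
  "eigenvalues n M = fst (some_eigensystem n M)"

definition eigenvectors :: "nat \<Rightarrow> (nat \<Rightarrow> nat \<Rightarrow> real) \<Rightarrow> nat \<Rightarrow> nat \<Rightarrow> real" where
  "eigenvectors n M = snd (some_eigensystem n M)"

lemma eigensystem_some:
  assumes "symmetric_on n M"
  shows "eigensystem n M (eigenvalues n M) (eigenvectors n M)"
proof -
  have "\<exists>p. (\<lambda>(lam, u). eigensystem n M lam u) p"
    using symmetric_eigensystem[OF assms] by (metis case_prod_conv)
  from someI_ex[OF this] show ?thesis
    unfolding eigenvalues_def eigenvectors_def some_eigensystem_def by (simp add: case_prod_unfold)
qed

text \<open>
  The entries of \<open>(M - it)\<^sup>-\<^sup>1\<close>, written in the eigenbasis; this form gives existence and all norm bounds without
  matrix inversion.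
\<close>
definition resolvent :: "nat \<Rightarrow> (nat \<Rightarrow> nat \<Rightarrow> real) \<Rightarrow> real \<Rightarrow> nat \<Rightarrow> nat \<Rightarrow> complex" where
  "resolvent n M t a b =
     (\<Sum>k<n. of_real (eigenvectors n M k a) / (of_real (eigenvalues n M k) - \<i> * of_real t) * of_real (eigenvectors n M k b))"

lemma resolvent_commute: "resolvent n M t a b = resolvent n M t b a"
  unfolding resolvent_def by (simp add: ac_simps)

lemma shift_nonzero: "t > 0 \<Longrightarrow> complex_of_real x - \<i> * of_real t \<noteq> 0"
  by (simp add: complex_eq_iff)

lemma resolvent_equation:
  assumes sym: "symmetric_on n M" and t: "t > 0" and ac: "a < n" "c < n"
  shows "(\<Sum>b<n. of_real (M a b) * resolvent n M t b c) = of_bool (a = c) + \<i> * of_real t * resolvent n M t a c"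
proof -
  define lam where "lam = eigenvalues n M"
  define u where "u = eigenvectors n M"
  have es: "eigensystem n M lam u" unfolding lam_def u_def by (rule eigensystem_some[OF sym])
  define d where "d k = complex_of_real (lam k) - \<i> * of_real t" for k
  have d0: "d k \<noteq> 0" for k unfolding d_def using t by (rule shift_nonzero)
  have G: "resolvent n M t a b = (\<Sum>k<n. of_real (u k a) / d k * of_real (u k b))" for a b
    unfolding resolvent_def u_def lam_def d_def ..
  have "(\<Sum>b<n. of_real (M a b) * resolvent n M t b c) =
     (\<Sum>b<n. \<Sum>k<n. of_real (M a b * u k b) * (of_real (u k c) / d k))"
    unfolding G by (simp add: sum_distrib_left ac_simps)
  also have "\<dots> = (\<Sum>k<n. of_real (\<Sum>b<n. M a b * u k b) * (of_real (u k c) / d k))"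
    by (subst sum.swap) (simp add: sum_distrib_right sum_divide_distrib)
  also have "\<dots> = (\<Sum>k<n. of_real (u k a * u k c) + \<i> * of_real t * (of_real (u k a) / d k * of_real (u k c)))"
  proof (intro sum.cong refl)
    fix k assume "k \<in> {..<n}"
    hence "of_real (\<Sum>b<n. M a b * u k b) * (of_real (u k c) / d k) =
       (d k + \<i> * of_real t) * of_real (u k a) * (of_real (u k c) / d k)"
      using eigensystem_eigenvector[OF es ac(1)] by (simp add: d_def)
    thus "of_real (\<Sum>b<n. M a b * u k b) * (of_real (u k c) / d k) =
       of_real (u k a * u k c) + \<i> * of_real t * (of_real (u k a) / d k * of_real (u k c))"
      using d0[of k] by (simp add: field_simps)
  qed
  also have "\<dots> = of_real (\<Sum>k<n. u k a * u k c) + \<i> * of_real t * resolvent n M t a c"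
    unfolding G by (simp add: sum.distrib sum_distrib_left)
  also have "(\<Sum>k<n. u k a * u k c) = of_bool (a = c)" by (rule eigensystemD(2)[OF es ac])
  finally show ?thesis by simp
qed

text \<open>
  In the eigenbasis the row has the coefficients \<open>u k a / (lam k - it)\<close>, whose denominators have modulus at least \<open>t\<close>.
\<close>
lemma resolvent_row_norm:
  assumes sym: "symmetric_on n M" and t: "t > 0" and a: "a < n"
  shows "(\<Sum>b<n. (cmod (resolvent n M t a b))\<^sup>2) \<le> 1 / t\<^sup>2"
proof -
  define lam where "lam = eigenvalues n M"
  define u where "u = eigenvectors n M"
  have es: "eigensystem n M lam u" unfolding lam_def u_def by (rule eigensystem_some[OF sym])
  define d where "d k = complex_of_real (lam k) - \<i> * of_real t" for k
  have dt: "cmod (d k) \<ge> t" for k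
    using abs_Im_le_cmod[of "d k"] t by (simp add: d_def)
  have d0: "d k \<noteq> 0" for k using dt[of k] t by auto
  have G: "resolvent n M t a b = (\<Sum>k<n. of_real (u k a) / d k * of_real (u k b))" for a b
    unfolding resolvent_def u_def lam_def d_def ..
  have cG: "cnj (resolvent n M t a b) = (\<Sum>k<n. of_real (u k a) / cnj (d k) * of_real (u k b))" for a b
    unfolding G by simp
  have orth: "(\<Sum>i<n. complex_of_real (u k i) * of_real (u l i)) = of_bool (k = l)" if "k < n" "l < n" for k l
  proof -
    have "(\<Sum>i<n. complex_of_real (u k i) * of_real (u l i)) = of_real (\<Sum>i<n. u k i * u l i)" by simp
    thus ?thesis using eigensystemD(1)[OF es that] by simp
  qed
  have "of_real (\<Sum>b<n. (cmod (resolvent n M t a b))\<^sup>2) = (\<Sum>b<n. resolvent n M t a b * cnj (resolvent n M t a b))"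
    by (simp only: of_real_sum complex_norm_square)
  also have "\<dots> = (\<Sum>k<n. of_real (u k a) / d k * (of_real (u k a) / cnj (d k)))"
    unfolding cG unfolding G by (rule parseval) (rule orth)
  also have "\<dots> = (\<Sum>k<n. of_real ((u k a)\<^sup>2 / (cmod (d k))\<^sup>2))"
  proof (intro sum.cong refl)
    fix k
    have "complex_of_real ((u k a)\<^sup>2 / (cmod (d k))\<^sup>2) = of_real (u k a) * of_real (u k a) / of_real ((cmod (d k))\<^sup>2)"
      by (simp add: power2_eq_square)
    also have "\<dots> = of_real (u k a) * of_real (u k a) / (d k * cnj (d k))" by (simp only: complex_norm_square)
    finally show "of_real (u k a) / d k * (of_real (u k a) / cnj (d k)) = complex_of_real ((u k a)\<^sup>2 / (cmod (d k))\<^sup>2)"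
      by (simp only: times_divide_times_eq)
  qed
  finally have "complex_of_real (\<Sum>b<n. (cmod (resolvent n M t a b))\<^sup>2) = of_real (\<Sum>k<n. (u k a)\<^sup>2 / (cmod (d k))\<^sup>2)"
    by simp
  hence "(\<Sum>b<n. (cmod (resolvent n M t a b))\<^sup>2) = (\<Sum>k<n. (u k a)\<^sup>2 / (cmod (d k))\<^sup>2)"
    using of_real_eq_iff by blast
  also have "\<dots> \<le> (\<Sum>k<n. (u k a)\<^sup>2 / t\<^sup>2)"
    using t dt d0 by (intro sum_mono divide_left_mono power_mono) (auto intro!: mult_pos_pos)
  also have "\<dots> = 1 / t\<^sup>2"
    using eigensystemD(2)[OF es a a] by (simp add: sum_divide_distrib[symmetric] power2_eq_square)
  finally show ?thesis .
qed

lemma resolvent_bound: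
  assumes "symmetric_on n M" and t: "t > 0" and "a < n" "b < n"
  shows "cmod (resolvent n M t a b) \<le> 1 / t"
proof -
  have "(cmod (resolvent n M t a b))\<^sup>2 \<le> (\<Sum>b<n. (cmod (resolvent n M t a b))\<^sup>2)"
    using assms by (intro member_le_sum) auto
  also have "\<dots> \<le> (1 / t)\<^sup>2" using resolvent_row_norm[OF assms(1-3)] by (simp add: power_divide)
  finally show ?thesis using t by (simp add: abs_le_square_iff[symmetric])
qed

lemma resolvent_trace:
  assumes sym: "symmetric_on n M"
  shows "(\<Sum>a<n. resolvent n M t a a) = (\<Sum>k<n. 1 / (of_real (eigenvalues n M k) - \<i> * of_real t))"
proof -
  define lam where "lam = eigenvalues n M"
  define u where "u = eigenvectors n M"
  have es: "eigensystem n M lam u" unfolding lam_def u_def by (rule eigensystem_some[OF sym])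
  define d where "d k = complex_of_real (lam k) - \<i> * of_real t" for k
  have G: "resolvent n M t a b = (\<Sum>k<n. of_real (u k a) / d k * of_real (u k b))" for a b
    unfolding resolvent_def u_def lam_def d_def ..
  have "(\<Sum>a<n. resolvent n M t a a) = (\<Sum>k<n. of_real (\<Sum>a<n. u k a * u k a) / d k)"
    unfolding G by (subst sum.swap) (simp add: sum_divide_distrib)
  also have "\<dots> = (\<Sum>k<n. 1 / d k)" using eigensystemD(1)[OF es] by (intro sum.cong refl) simp
  finally show ?thesis by (simp add: d_def lam_def)
qed

text \<open>
  The triple product \<open>G' (M' - M) G\<close> is evaluated with \<open>G' M' = 1 + it G'\<close> in its first part and \<open>M G = 1 + it G\<close> in its
  second part.
\<close>
lemma resolvent_identity:
  assumes sym: "symmetric_on n M" "symmetric_on n M'" and t: "t > 0" and ad: "a < n" "d < n"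
  shows "(\<Sum>b<n. \<Sum>c<n. resolvent n M' t a b * of_real (M' b c - M b c) * resolvent n M t c d) =
    resolvent n M t a d - resolvent n M' t a d"
proof -
  let ?G = "resolvent n M t" and ?G' = "resolvent n M' t"
  have "(\<Sum>b<n. \<Sum>c<n. ?G' a b * of_real (M' b c - M b c) * ?G c d) =
     (\<Sum>b<n. \<Sum>c<n. ?G' a b * of_real (M' b c) * ?G c d) - (\<Sum>b<n. \<Sum>c<n. ?G' a b * of_real (M b c) * ?G c d)"
    by (simp add: algebra_simps sum_subtractf)
  also have "(\<Sum>b<n. \<Sum>c<n. ?G' a b * of_real (M' b c) * ?G c d) =
     (\<Sum>c<n. (\<Sum>b<n. of_real (M' c b) * ?G' b a) * ?G c d)"
  proof (subst sum.swap, unfold sum_distrib_right, intro sum.cong refl)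
    fix b c assume "b \<in> {..<n}" "c \<in> {..<n}"
    thus "?G' a b * of_real (M' b c) * ?G c d = of_real (M' c b) * ?G' b a * ?G c d"
      using sym(2) by (simp add: symmetric_on_def resolvent_commute[of n M' t a b])
  qed
  also have "\<dots> = (\<Sum>c<n. (of_bool (c = a) + \<i> * of_real t * ?G' c a) * ?G c d)"
    using resolvent_equation[OF sym(2) t] ad by (intro sum.cong refl) simp
  also have "\<dots> = (\<Sum>c<n. of_bool (c = a) * ?G c d) + (\<Sum>c<n. \<i> * of_real t * ?G' c a * ?G c d)"
    by (simp add: algebra_simps sum.distrib)
  also have "(\<Sum>c<n. of_bool (c = a) * ?G c d) = ?G a d" using ad by (simp only: sum_of_bool_mult)
  also have "(\<Sum>b<n. \<Sum>c<n. ?G' a b * of_real (M b c) * ?G c d) =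
     (\<Sum>b<n. ?G' a b * (\<Sum>c<n. of_real (M b c) * ?G c d))"
    by (simp add: sum_distrib_left ac_simps)
  also have "\<dots> = (\<Sum>b<n. ?G' a b * (of_bool (b = d) + \<i> * of_real t * ?G b d))"
    using resolvent_equation[OF sym(1) t] ad by (intro sum.cong refl) simp
  also have "\<dots> = (\<Sum>b<n. ?G' a b * of_bool (b = d)) + (\<Sum>c<n. \<i> * of_real t * ?G' c a * ?G c d)"
    by (simp add: algebra_simps sum.distrib resolvent_commute[of n M' t a])
  also have "(\<Sum>b<n. ?G' a b * of_bool (b = d)) = ?G' a d" using ad by (simp only: sum_of_bool_mult)
  finally show ?thesis by simp
qed

text \<open>
  The case of the resolvent identity that describes the toggling of one edge: \<open>M\<close> changes in the entries \<open>ij\<close> and \<open>ji\<close> only.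
\<close>
lemma resolvent_rank_two_update:
  assumes sym: "symmetric_on n M" "symmetric_on n M'" and t: "t > 0" and ad: "a < n" "d < n"
    and ij: "i < n" "j < n"
    and diff: "\<And>b c. b < n \<Longrightarrow> c < n \<Longrightarrow> M' b c - M b c = x * (of_bool (b = i) * of_bool (c = j) + of_bool (b = j) * of_bool (c = i))"
  shows "resolvent n M' t a d - resolvent n M t a d =
    - (of_real x * (resolvent n M' t a i * resolvent n M t j d + resolvent n M' t a j * resolvent n M t i d))"
proof -
  let ?G = "resolvent n M t" and ?G' = "resolvent n M' t"
  have "?G a d - ?G' a d = (\<Sum>b<n. \<Sum>c<n. ?G' a b * of_real (M' b c - M b c) * ?G c d)"
    using resolvent_identity[OF sym t ad] by simp
  also have "\<dots> = (\<Sum>b<n. \<Sum>c<n. of_real x * (of_bool (b = i) * (?G' a b * (of_bool (c = j) * ?G c d)) +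
       of_bool (b = j) * (?G' a b * (of_bool (c = i) * ?G c d))))"
    using diff by (intro sum.cong refl) (simp add: algebra_simps)
  also have "\<dots> = of_real x * ((\<Sum>b<n. of_bool (b = i) * (?G' a b * (\<Sum>c<n. of_bool (c = j) * ?G c d))) +
       (\<Sum>b<n. of_bool (b = j) * (?G' a b * (\<Sum>c<n. of_bool (c = i) * ?G c d))))"
    by (simp only: sum.distrib sum_distrib_left distrib_left)
  also have "\<dots> = of_real x * (?G' a i * ?G j d + ?G' a j * ?G i d)"
    using ij by (simp only: sum_of_bool_mult)
  finally show ?thesis by (simp add: algebra_simps)
qed

section \<open>Integration by parts in the random graph\<close>

lemma finite_all_edges [simp]: "finite (all_edges n)"
proof -
  have "all_edges n \<subseteq> Pow {..<n}" by (auto simp: all_edges_def)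
  thus ?thesis by (rule finite_subset) simp
qed

lemma finite_set_Pi_bernoulli: "finite A \<Longrightarrow> finite (set_pmf (Pi_pmf A False (\<lambda>_. bernoulli_pmf p)))"
  by (rule finite_subset[OF set_Pi_pmf_subset']) (auto intro!: finite_PiE_dflt)

lemma finite_set_erdos_renyi [simp]: "finite (set_pmf (erdos_renyi n p))"
  unfolding erdos_renyi_def by (simp add: finite_set_Pi_bernoulli)

lemma integrable_erdos_renyi [simp]:
  fixes F :: "edge_set \<Rightarrow> 'b::{banach, second_countable_topology}"
  shows "integrable (measure_pmf (erdos_renyi n p)) F"
  by (rule integrable_measure_pmf_finite) simp

lemma erdos_renyi_subset: "E \<in> set_pmf (erdos_renyi n p) \<Longrightarrow> E \<subseteq> all_edges n"
  unfolding erdos_renyi_def by auto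

lemma doubleton_in_all_edges: "i < n \<Longrightarrow> j < n \<Longrightarrow> i \<noteq> j \<Longrightarrow> {i, j} \<in> all_edges n"
  by (simp add: all_edges_def)

abbreviation expect :: "nat \<Rightarrow> real \<Rightarrow> (edge_set \<Rightarrow> 'b::{banach, second_countable_topology}) \<Rightarrow> 'b" where
  "expect n p F \<equiv> measure_pmf.expectation (erdos_renyi n p) F"

text \<open>
  The state of one edge is independent of all other edges, so it can be resampled with its own
  distribution.
\<close>
lemma expect_expose_edge:
  fixes F :: "edge_set \<Rightarrow> 'b::{banach, second_countable_topology}"
  assumes p: "0 \<le> p" "p \<le> 1" and e: "e \<in> all_edges n"
  shows "expect n p F = expect n p (\<lambda>E. p *\<^sub>R F (insert e E) + (1 - p) *\<^sub>R F (E - {e}))"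
proof -
  define A where "A = all_edges n - {e}"
  have A: "finite A" "e \<notin> A" "all_edges n = insert e A" using e by (auto simp: A_def)
  define Q where "Q = map_pmf (\<lambda>f. {x \<in> A. f x}) (Pi_pmf A False (\<lambda>_. bernoulli_pmf p))"
  have fin_Q: "finite (set_pmf Q)" unfolding Q_def using A by (simp add: finite_set_Pi_bernoulli)
  have e_Q: "e \<notin> S" if "S \<in> set_pmf Q" for S using that A by (auto simp: Q_def)
  have er: "erdos_renyi n p = bernoulli_pmf p \<bind> (\<lambda>y. map_pmf (\<lambda>S. if y then insert e S else S) Q)"
    unfolding erdos_renyi_def Q_def A(3) Pi_pmf_insert'[OF A(1,2)] map_bind_pmf pmf.map_comp o_def
    using A(2) by (auto simp: map_bind_pmf map_pmf_def bind_assoc_pmf bind_return_pmf intro!: bind_pmf_cong)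
  have step: "expect n p H = measure_pmf.expectation Q (\<lambda>S. p *\<^sub>R H (insert e S) + (1 - p) *\<^sub>R H S)"
    for H :: "edge_set \<Rightarrow> 'b"
  proof -
    have int: "integrable (measure_pmf Q) h" for h :: "edge_set \<Rightarrow> 'b"
      by (rule integrable_measure_pmf_finite[OF fin_Q])
    have "measure_pmf.expectation (bernoulli_pmf p \<bind> (\<lambda>y. map_pmf (\<lambda>S. if y then insert e S else S) Q)) H =
       (\<Sum>y\<in>UNIV. pmf (bernoulli_pmf p) y *\<^sub>R measure_pmf.expectation (map_pmf (\<lambda>S. if y then insert e S else S) Q) H)"
      using fin_Q by (intro pmf_expectation_bind) auto
    thus ?thesis using p int by (simp add: er UNIV_bool)
  qed
  have "expect n p F = measure_pmf.expectation Q (\<lambda>S. p *\<^sub>R F (insert e S) + (1 - p) *\<^sub>R F (S - {e}))"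
    unfolding step using e_Q by (intro integral_cong_AE) (auto simp: AE_measure_pmf_iff)
  also have "\<dots> = expect n p (\<lambda>E. p *\<^sub>R F (insert e E) + (1 - p) *\<^sub>R F (E - {e}))"
    unfolding step using e_Q
    by (intro integral_cong_AE) (auto simp: AE_measure_pmf_iff algebra_simps scaleR_add_left[symmetric])
  finally show ?thesis .
qed

text \<open>
  Exact analogue, for one Bernoulli variable, of Gaussian integration by parts: exposing the edge \<open>e\<close> leaves
  \<open>p (1 - p) F(with e)\<close> and \<open>(1 - p) (- p) F(without e)\<close>.
\<close>
lemma expect_integration_by_parts:
  fixes F :: "edge_set \<Rightarrow> 'b::{banach, second_countable_topology}"
  assumes p: "0 \<le> p" "p \<le> 1" and e: "e \<in> all_edges n"
  shows "expect n p (\<lambda>E. (of_bool (e \<in> E) - p) *\<^sub>R F E) = (p * (1 - p)) *\<^sub>R expect n p (\<lambda>E. F (insert e E) - F (E - {e}))"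
proof -
  have "expect n p (\<lambda>E. (of_bool (e \<in> E) - p) *\<^sub>R F E) =
     expect n p (\<lambda>E. (p * (1 - p)) *\<^sub>R (F (insert e E) - F (E - {e})))"
    by (subst expect_expose_edge[OF p e]) (simp add: algebra_simps)
  thus ?thesis by simp
qed

section \<open>Self-consistent equation for the Stieltjes transform\<close>

text \<open>
  The centred adjacency matrix, scaled such that the mean square eigenvalue is at most 1.
\<close>
definition wigner :: "nat \<Rightarrow> real \<Rightarrow> edge_set \<Rightarrow> nat \<Rightarrow> nat \<Rightarrow> real" where
  "wigner n p E i j = (if i = j then 0 else (of_bool ({i, j} \<in> E) - p) / sqrt n)"

lemma symmetric_wigner: "symmetric_on n (wigner n p E)"
  by (auto simp: symmetric_on_def wigner_def insert_commute)

lemma wigner_toggle_edge: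
  assumes "i \<noteq> j"
  shows "wigner n p (insert {i, j} E) b c - wigner n p (E - {{i, j}}) b c =
    1 / sqrt n * (of_bool (b = i) * of_bool (c = j) + of_bool (b = j) * of_bool (c = i))"
proof (cases "{b, c} = {i, j}")
  case True
  hence "(b = i \<and> c = j) \<or> (b = j \<and> c = i)" by (simp add: doubleton_eq_iff)
  thus ?thesis using assms by (auto simp: wigner_def insert_commute diff_divide_distrib)
next
  case False
  thus ?thesis by (auto simp: wigner_def doubleton_eq_iff)
qed

lemma norm_sum_mult_le:
  fixes x y :: "nat \<Rightarrow> complex"
  assumes "(\<Sum>a<n. (cmod (x a))\<^sup>2) \<le> K" "(\<Sum>a<n. (cmod (y a))\<^sup>2) \<le> K"
  shows "cmod (\<Sum>a<n. x a * y a) \<le> K"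
proof -
  have "cmod (\<Sum>a<n. x a * y a) \<le> (\<Sum>a<n. ((cmod (x a))\<^sup>2 + (cmod (y a))\<^sup>2) / 2)"
  proof (intro order.trans[OF norm_sum] sum_mono)
    fix a
    have "0 \<le> (cmod (x a) - cmod (y a))\<^sup>2" by simp
    thus "cmod (x a * y a) \<le> ((cmod (x a))\<^sup>2 + (cmod (y a))\<^sup>2) / 2"
      by (simp add: norm_mult power2_diff)
  qed
  also have "\<dots> = ((\<Sum>a<n. (cmod (x a))\<^sup>2) + (\<Sum>a<n. (cmod (y a))\<^sup>2)) / 2"
    by (simp add: sum.distrib sum_divide_distrib[symmetric])
  finally show ?thesis using assms by simp
qed

definition stieltjes :: "nat \<Rightarrow> real \<Rightarrow> real \<Rightarrow> edge_set \<Rightarrow> complex" where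
  "stieltjes n p t E = (\<Sum>a<n. resolvent n (wigner n p E) t a a) / of_nat n"

text \<open>
  The Stieltjes transform \<open>m\<close> of the semicircle law of variance \<open>p (1 - p)\<close> satisfies \<open>1 + z m + p (1 - p) m\<^sup>2 = 0\<close>; here
  \<open>z = it\<close>.
\<close>
definition defect :: "nat \<Rightarrow> real \<Rightarrow> real \<Rightarrow> edge_set \<Rightarrow> complex" where
  "defect n p t E = 1 + \<i> * of_real t * stieltjes n p t E + of_real (p * (1 - p)) * (stieltjes n p t E)\<^sup>2"

text \<open>
  An explicit constant makes it visible that the bound on the second moment of the defect depends on \<open>t\<close> only, which is what
  convergence for each fixed \<open>t\<close> requires. The letters are those of the estimates below: \<open>q\<close> bounds the
  resolvent entries, \<open>B\<close> the defect, and \<open>L / (n \<surd>n)\<close> its change when an edge is toggled.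
\<close>
definition defect_const :: "real \<Rightarrow> real" where
  "defect_const t = (let q = 1 / t; B = 2 + q\<^sup>2; L = (t + 2 * q) * (2 * q\<^sup>2) in
     2 * B * q\<^sup>2 + (8 * q ^ 4 * B + 4 * q ^ 3 * B + q\<^sup>2 * L + q * L) + q\<^sup>2 * B)"

context
  fixes n :: nat and p t v q N B L :: real and G :: "edge_set \<Rightarrow> nat \<Rightarrow> nat \<Rightarrow> complex"
  assumes n: "n > 0" and p: "0 < p" "p < 1" and t: "t > 0"
  defines "v \<equiv> p * (1 - p)" and "q \<equiv> 1 / t" and "N \<equiv> sqrt n" and "B \<equiv> 2 + q\<^sup>2" and "L \<equiv> (t + 2 * q) * (2 * q\<^sup>2)"
    and "G \<equiv> (\<lambda>E. resolvent n (wigner n p E) t)"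
begin

lemma const_facts: "q > 0" "N \<ge> 1" "N * N = n" "B > 0" "L > 0" "N \<le> real n"
  "0 < v" "v \<le> 1" "t * q = 1"
proof -
  show q: "q > 0" using t by (simp add: q_def)
  show "N \<ge> 1" "N * N = n" using n by (auto simp: N_def)
  thus "N \<le> real n" by (metis mult_left_mono mult.right_neutral order.trans zero_le_one)
  show "B > 0" unfolding B_def by (smt (verit) zero_le_power2)
  show "L > 0" unfolding L_def using q t by simp
  show "0 < v" using p by (simp add: v_def)
  show "v \<le> 1" using p mult_le_one[of p "1 - p"] by (simp add: v_def)
  show "t * q = 1" using t by (simp add: q_def)
qed

lemma G_row: "a < n \<Longrightarrow> (\<Sum>b<n. (cmod (G E a b))\<^sup>2) \<le> q\<^sup>2"
  unfolding G_def q_def using resolvent_row_norm[OF symmetric_wigner t] by (simp add: power_divide)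

lemma G_bound: "a < n \<Longrightarrow> b < n \<Longrightarrow> cmod (G E a b) \<le> q"
  unfolding G_def q_def by (rule resolvent_bound[OF symmetric_wigner t])

lemma G_commute: "G E a b = G E b a" unfolding G_def by (rule resolvent_commute)

lemma G_toggle:
  assumes "i < n" "j < n" "i \<noteq> j" "a < n" "d < n"
  shows "G (insert {i, j} E) a d - G (E - {{i, j}}) a d =
    - ((G (insert {i, j} E) a i * G (E - {{i, j}}) j d + G (insert {i, j} E) a j * G (E - {{i, j}}) i d) / of_real N)"
proof -
  have "G (insert {i, j} E) a d - G (E - {{i, j}}) a d =
    - (of_real (1 / sqrt n) * (G (insert {i, j} E) a i * G (E - {{i, j}}) j d + G (insert {i, j} E) a j * G (E - {{i, j}}) i d))"
    unfolding G_def using assms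
    by (intro resolvent_rank_two_update[OF symmetric_wigner symmetric_wigner t] wigner_toggle_edge) auto
  thus ?thesis by (simp add: N_def)
qed

lemma G_toggle_bound:
  assumes ij: "i < n" "j < n" "i \<noteq> j" and ad: "a < n" "d < n"
  shows "cmod (G (insert {i, j} E) a d - G (E - {{i, j}}) a d) \<le> 2 * q\<^sup>2 / N"
proof -
  let ?G1 = "G (insert {i, j} E)" and ?G0 = "G (E - {{i, j}})"
  have "cmod (?G1 a i * ?G0 j d + ?G1 a j * ?G0 i d) \<le> q * q + q * q"
    using ij ad by (intro order.trans[OF norm_triangle_ineq] add_mono) (auto simp: norm_mult intro!: mult_mono G_bound less_imp_le[OF const_facts(1)])
  thus ?thesis unfolding G_toggle[OF ij ad] using const_facts
    by (simp add: norm_divide power2_eq_square divide_right_mono)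
qed

lemma defect_v: "defect n p t E = 1 + \<i> * of_real t * stieltjes n p t E + of_real v * (stieltjes n p t E)\<^sup>2"
  by (simp add: defect_def v_def)

lemma stieltjes_G: "stieltjes n p t E = (\<Sum>a<n. G E a a) / of_nat n"
  by (simp add: stieltjes_def G_def)

lemma stieltjes_bound: "cmod (stieltjes n p t E) \<le> q"
proof -
  have "cmod (\<Sum>a<n. G E a a) \<le> (\<Sum>a<n. q)" by (intro order.trans[OF norm_sum] sum_mono G_bound) auto
  thus ?thesis using n by (simp add: stieltjes_G norm_divide field_simps)
qed

text \<open>
  The gain of a factor \<open>1 / n\<close> over the change of a single entry comes from the row norms: summation over the diagonal
  of the rank two update gives inner products of rows of two resolvents, bounded by \<open>q\<^sup>2\<close> independently of \<open>n\<close>.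
\<close>
lemma stieltjes_toggle:
  assumes ij: "i < n" "j < n" "i \<noteq> j"
  shows "cmod (stieltjes n p t (insert {i, j} E) - stieltjes n p t (E - {{i, j}})) \<le> 2 * q\<^sup>2 / (n * N)"
proof -
  let ?G1 = "G (insert {i, j} E)" and ?G0 = "G (E - {{i, j}})"
  have "stieltjes n p t (insert {i, j} E) - stieltjes n p t (E - {{i, j}}) =
     (\<Sum>a<n. ?G1 a a - ?G0 a a) / of_nat n"
    by (simp add: stieltjes_G diff_divide_distrib sum_subtractf)
  also have "(\<Sum>a<n. ?G1 a a - ?G0 a a) = (\<Sum>a<n. - ((?G1 a i * ?G0 j a + ?G1 a j * ?G0 i a) / of_real N))"
    using ij by (intro sum.cong refl G_toggle) auto
  also have "\<dots> = - (((\<Sum>a<n. ?G1 i a * ?G0 j a) + (\<Sum>a<n. ?G1 j a * ?G0 i a)) / of_real N)"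
    by (simp add: sum_negf sum_divide_distrib[symmetric] sum.distrib G_commute[of _ _ i] G_commute[of _ _ j])
  finally have eq: "cmod (stieltjes n p t (insert {i, j} E) - stieltjes n p t (E - {{i, j}})) =
     cmod ((\<Sum>a<n. ?G1 i a * ?G0 j a) + (\<Sum>a<n. ?G1 j a * ?G0 i a)) / (n * N)"
    using const_facts by (simp add: norm_divide norm_mult ac_simps del: minus_add_distrib)
  have "cmod ((\<Sum>a<n. ?G1 i a * ?G0 j a) + (\<Sum>a<n. ?G1 j a * ?G0 i a)) \<le> q\<^sup>2 + q\<^sup>2"
    using ij by (intro order.trans[OF norm_triangle_ineq] add_mono norm_sum_mult_le G_row)
  thus ?thesis unfolding eq using const_facts n by (intro divide_right_mono) auto
qed

lemma defect_bound: "cmod (defect n p t E) \<le> B"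
proof -
  let ?m = "stieltjes n p t E"
  have "cmod (defect n p t E) \<le> 1 + t * cmod ?m + v * (cmod ?m)\<^sup>2"
    unfolding defect_v using t const_facts(7)
    by (intro order.trans[OF norm_triangle_ineq] add_mono) (auto simp: norm_mult norm_power)
  also have "\<dots> \<le> 1 + t * q + 1 * q\<^sup>2"
    using const_facts stieltjes_bound t by (intro add_mono mult_mono power_mono) auto
  finally show ?thesis using const_facts by (simp add: B_def)
qed

lemma defect_toggle:
  assumes ij: "i < n" "j < n" "i \<noteq> j"
  shows "cmod (defect n p t (insert {i, j} E) - defect n p t (E - {{i, j}})) \<le> L / (n * N)"
proof -
  let ?m1 = "stieltjes n p t (insert {i, j} E)" and ?m0 = "stieltjes n p t (E - {{i, j}})"
  have "defect n p t (insert {i, j} E) - defect n p t (E - {{i, j}}) =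
     (\<i> * of_real t + of_real v * (?m1 + ?m0)) * (?m1 - ?m0)"
    by (simp add: defect_v algebra_simps power2_eq_square)
  moreover have "cmod (\<i> * of_real t + of_real v * (?m1 + ?m0)) \<le> t + 1 * (q + q)"
  proof (rule order.trans[OF norm_triangle_ineq], rule add_mono)
    have "cmod (?m1 + ?m0) \<le> q + q"
      by (intro order.trans[OF norm_triangle_ineq] add_mono stieltjes_bound)
    thus "cmod (of_real v * (?m1 + ?m0)) \<le> 1 * (q + q)"
      unfolding norm_mult using const_facts by (intro mult_mono) auto
  qed (use t in \<open>simp add: norm_mult\<close>)
  ultimately have "cmod (defect n p t (insert {i, j} E) - defect n p t (E - {{i, j}})) \<le>
     (t + 1 * (q + q)) * (2 * q\<^sup>2 / (n * N))"
    unfolding norm_mult using stieltjes_toggle[OF ij, of E] t const_facts by (simp only: norm_mult) (intro mult_mono, auto)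
  thus ?thesis by (simp add: L_def)
qed

text \<open>
  Every graph either contains \<open>e\<close> or not, so it coincides with one of its two toggled versions.
\<close>
lemma toggle_cases:
  fixes F :: "edge_set \<Rightarrow> complex"
  assumes "cmod (F (insert e E) - F (E - {e})) \<le> x"
  shows "cmod (F (insert e E) - F E) \<le> x" "cmod (F (E - {e}) - F E) \<le> x"
proof -
  have x: "x \<ge> 0" using assms norm_ge_zero order.trans by blast
  have "cmod (F (insert e E) - F E) \<le> x \<and> cmod (F (E - {e}) - F E) \<le> x"
  proof (cases "e \<in> E")
    case True
    hence "insert e E = E" by (rule insert_absorb)
    thus ?thesis using assms x by (simp only: norm_minus_commute) simp
  next
    case False
    hence "E - {e} = E" by simp
    thus ?thesis using assms x by simp
  qed
  thus "cmod (F (insert e E) - F E) \<le> x" "cmod (F (E - {e}) - F E) \<le> x" by auto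
qed

text \<open>
  The increment of \<open>G\<^sub>j\<^sub>i \<phi>\<close> under toggling of the edge \<open>ij\<close>, scaled by \<open>\<surd>n\<close>, together with the term \<open>G\<^sub>i\<^sub>i G\<^sub>j\<^sub>j \<phi>\<close> that should
  cancel it; \<open>\<phi>\<close> is the conjugate of the defect.
\<close>
definition offdiag :: "edge_set \<Rightarrow> nat \<Rightarrow> nat \<Rightarrow> complex" where
  "offdiag E i j = of_real N * (G (insert {i, j} E) j i * cnj (defect n p t (insert {i, j} E)) -
      G (E - {{i, j}}) j i * cnj (defect n p t (E - {{i, j}}))) + G E i i * G E j j * cnj (defect n p t E)"

text \<open>
  By the rank two update, the increment of \<open>G\<^sub>j\<^sub>i\<close> is \<open>- (G\<^sub>j\<^sub>i G\<^sub>j\<^sub>i + G\<^sub>j\<^sub>j G\<^sub>i\<^sub>i) / \<surd>n\<close>, where one factor belongs to the graph with the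
  edge and one to the graph without it. Replacing these by the resolvent of the graph itself costs \<open>O(1 / \<surd>n)\<close>, and the increment of
  \<open>\<phi>\<close> is even smaller. The term \<open>G\<^sub>j\<^sub>i G\<^sub>j\<^sub>i\<close> need not be small for a single pair; it is kept in the bound because its sum over a row is
  at most \<open>q\<^sup>2\<close>.
\<close>
lemma offdiag_bound:
  assumes ij: "i < n" "j < n" "i \<noteq> j"
  shows "cmod (offdiag E i j) \<le> 2 * B * (cmod (G E i j))\<^sup>2 + (8 * q ^ 4 * B + 4 * q ^ 3 * B + q\<^sup>2 * L + q * L) / N"
proof -
  let ?T = "insert {i, j} E" and ?F = "E - {{i, j}}"
  define \<phi> where "\<phi> E = cnj (defect n p t E)" for E
  define \<delta> where "\<delta> = 2 * q\<^sup>2 / N"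
  define \<kappa> where "\<kappa> = L / (n * N)"
  note cf = const_facts
  have \<delta>0: "\<delta> \<ge> 0" and \<kappa>0: "\<kappa> \<ge> 0" using cf n by (auto simp: \<delta>_def \<kappa>_def)
  have \<phi>B: "cmod (\<phi> E) \<le> B" for E unfolding \<phi>_def using defect_bound[of E] by simp
  have d\<phi>: "cmod (\<phi> ?T - \<phi> ?F) \<le> \<kappa>"
    unfolding \<phi>_def \<kappa>_def complex_cnj_diff[symmetric] complex_mod_cnj by (rule defect_toggle[OF ij])
  have dG: "cmod (G ?T a b - G ?F a b) \<le> \<delta>" if "a < n" "b < n" for a b
    unfolding \<delta>_def by (rule G_toggle_bound[OF ij that])
  have dT: "cmod (G ?T a b - G E a b) \<le> \<delta>" and dF: "cmod (G ?F a b - G E a b) \<le> \<delta>" if "a < n" "b < n" for a b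
    using toggle_cases[of "\<lambda>E. G E a b" "{i, j}" E \<delta>] dG[OF that] by auto
  have \<phi>T: "cmod (\<phi> ?T - \<phi> E) \<le> \<kappa>" using toggle_cases(1)[of \<phi> "{i, j}" E \<kappa>] d\<phi> by auto
  have N0: "complex_of_real N \<noteq> 0" using cf by auto
  have "offdiag E i j = of_real N * (G ?T j i - G ?F j i) * \<phi> ?T + G ?F j i * (of_real N * (\<phi> ?T - \<phi> ?F)) + G E i i * G E j j * \<phi> E"
    by (simp add: offdiag_def \<phi>_def algebra_simps)
  also have "of_real N * (G ?T j i - G ?F j i) = - (G ?T j i * G ?F j i + G ?T j j * G ?F i i)"
    unfolding G_toggle[OF ij(1,2,3) ij(2,1)] using N0 by simp
  \<comment> \<open>The product \<open>G\<^sub>j\<^sub>j G\<^sub>i\<^sub>i \<phi>\<close> is changed from the toggled graphs to \<open>E\<close> one factor at a time.\<close>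
  finally have eq: "offdiag E i j = - (G ?T j i * G ?F j i * \<phi> ?T) + G ?F j i * (of_real N * (\<phi> ?T - \<phi> ?F))
     + ((G E j j - G ?T j j) * G E i i * \<phi> E + G ?T j j * (G E i i - G ?F i i) * \<phi> E + G ?T j j * G ?F i i * (\<phi> E - \<phi> ?T))"
    by (simp add: algebra_simps)
  define x where "x = cmod (G E i j)"
  have GT: "cmod (G ?T j i) \<le> x + \<delta>" and GF: "cmod (G ?F j i) \<le> x + \<delta>"
    using dT[OF ij(2,1)] dF[OF ij(2,1)] norm_triangle_sub[of "G ?T j i" "G E j i"] norm_triangle_sub[of "G ?F j i" "G E j i"]
    by (auto simp: x_def G_commute[of E i j])
  have "x \<ge> 0" by (simp add: x_def)
  have A: "cmod (- (G ?T j i * G ?F j i * \<phi> ?T)) \<le> (x + \<delta>) * (x + \<delta>) * B"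
    unfolding norm_minus_cancel norm_mult using GT GF \<phi>B cf \<open>x \<ge> 0\<close> \<delta>0 by (intro mult_mono) auto
  have C: "cmod (G ?F j i * (of_real N * (\<phi> ?T - \<phi> ?F))) \<le> q * (N * \<kappa>)"
    unfolding norm_mult using d\<phi> cf ij by (intro mult_mono G_bound) auto
  have D1: "cmod ((G E j j - G ?T j j) * G E i i * \<phi> E) \<le> \<delta> * q * B"
    unfolding norm_mult using dT[OF ij(2,2)] \<delta>0 cf ij \<phi>B
    by (intro mult_mono G_bound) (auto simp: norm_minus_commute)
  have D2: "cmod (G ?T j j * (G E i i - G ?F i i) * \<phi> E) \<le> q * \<delta> * B"
    unfolding norm_mult using dF[OF ij(1,1)] \<delta>0 cf ij \<phi>B
    by (intro mult_mono G_bound) (auto simp: norm_minus_commute)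
  have D3: "cmod (G ?T j j * G ?F i i * (\<phi> E - \<phi> ?T)) \<le> q * q * \<kappa>"
    unfolding norm_mult using \<phi>T \<kappa>0 cf ij
    by (intro mult_mono G_bound) (auto simp: norm_minus_commute)
  have "cmod (offdiag E i j) \<le> (x + \<delta>) * (x + \<delta>) * B + q * (N * \<kappa>) + (\<delta> * q * B + q * \<delta> * B + q * q * \<kappa>)"
    unfolding eq by (intro order.trans[OF norm_triangle_ineq] add_mono A C D1 D2 D3)
  also have "\<dots> \<le> (2 * x\<^sup>2 + 8 * q ^ 4 / N) * B + q * (L / N) + (4 * q ^ 3 * B / N + q\<^sup>2 * (L / N))"
  proof -
    have "(x + \<delta>) * (x + \<delta>) \<le> 2 * x\<^sup>2 + 2 * \<delta>\<^sup>2"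
      using zero_le_power2[of "x - \<delta>"] by (simp add: power2_eq_square algebra_simps)
    also have "2 * \<delta>\<^sup>2 = 8 * q ^ 4 / (N * N)"
      by (simp add: \<delta>_def power_divide power_mult_distrib power2_eq_square power4_eq_xxxx)
    also have "\<dots> \<le> 8 * q ^ 4 / (N * 1)"
      using cf by (intro divide_left_mono mult_left_mono) auto
    finally have i: "(x + \<delta>) * (x + \<delta>) \<le> 2 * x\<^sup>2 + 8 * q ^ 4 / N" by simp
    have "\<kappa> \<le> L / (1 * N)" unfolding \<kappa>_def using cf n by (intro divide_left_mono mult_right_mono) auto
    hence "q * q * \<kappa> \<le> q * q * (L / N)" using cf by (intro mult_left_mono) auto
    hence iii: "\<delta> * q * B + q * \<delta> * B + q * q * \<kappa> \<le> 4 * q ^ 3 * B / N + q\<^sup>2 * (L / N)"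
      by (simp add: \<delta>_def power2_eq_square power3_eq_cube field_simps)
    have "N * \<kappa> = L / n" unfolding \<kappa>_def using cf by simp
    also have "\<dots> \<le> L / N" using cf n by (intro divide_left_mono) auto
    finally have ii: "N * \<kappa> \<le> L / N" .
    show ?thesis
      by (rule add_mono[OF add_mono[OF mult_right_mono[OF i] mult_left_mono[OF ii]] iii]) (use cf in auto)
  qed
  also have "\<dots> = 2 * B * x\<^sup>2 + (8 * q ^ 4 * B + 4 * q ^ 3 * B + q\<^sup>2 * L + q * L) / N"
    by (simp add: field_simps add_divide_distrib)
  finally show ?thesis by (simp add: x_def)
qed

text \<open>
  The contribution of the position \<open>ij\<close> to the second moment of the defect, up to the factor \<open>p (1 - p) / n\<^sup>2\<close>. There is no
  random entry on the diagonal, hence only the quadratic part of the defect contributes there.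
\<close>
definition cell :: "edge_set \<Rightarrow> nat \<Rightarrow> nat \<Rightarrow> complex" where
  "cell E i j = (if i = j then G E i i * G E i i * cnj (defect n p t E) else offdiag E i j)"

lemma expect_cell:
  assumes ij: "i < n" "j < n"
  shows "expect n p (\<lambda>E. of_real (wigner n p E i j) * G E j i * cnj (defect n p t E)) / of_nat n +
     of_real v * expect n p (\<lambda>E. G E i i * G E j j * cnj (defect n p t E)) / (of_nat n)\<^sup>2 =
     of_real v / (of_nat n)\<^sup>2 * expect n p (\<lambda>E. cell E i j)"
proof (cases "i = j")
  case True
  thus ?thesis by (simp add: wigner_def cell_def)
next
  case False
  define \<Phi> where "\<Phi> E = G E j i * cnj (defect n p t E)" for E
  have pp: "0 \<le> p" "p \<le> 1" using p by auto
  note e = doubleton_in_all_edges[OF ij False]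
  have N0: "complex_of_real N \<noteq> 0" using const_facts by auto
  have NN: "complex_of_real N * complex_of_real N = of_nat n"
    using const_facts(3) by (metis of_real_mult of_real_of_nat_eq)
  have n0: "complex_of_nat n \<noteq> 0" using n by simp
  have "expect n p (\<lambda>E. of_real (wigner n p E i j) * G E j i * cnj (defect n p t E)) =
     expect n p (\<lambda>E. ((of_bool ({i, j} \<in> E) - p) *\<^sub>R \<Phi> E) / of_real N)"
    using False by (simp add: wigner_def \<Phi>_def N_def scaleR_conv_of_real ac_simps)
  also have "\<dots> = of_real v * expect n p (\<lambda>E. \<Phi> (insert {i, j} E) - \<Phi> (E - {{i, j}})) / of_real N"
    using expect_integration_by_parts[OF pp e, of \<Phi>, folded v_def] by (simp add: scaleR_conv_of_real)
  finally have 1: "expect n p (\<lambda>E. of_real (wigner n p E i j) * G E j i * cnj (defect n p t E)) = \<dots>" .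
  have 2: "expect n p (\<lambda>E. cell E i j) = of_real N * expect n p (\<lambda>E. \<Phi> (insert {i, j} E) - \<Phi> (E - {{i, j}})) +
     expect n p (\<lambda>E. G E i i * G E j j * cnj (defect n p t E))"
    using False by (simp add: cell_def offdiag_def \<Phi>_def)
  have 3: "1 / of_real N / of_nat n = complex_of_real N / (of_nat n)\<^sup>2"
    using NN N0 n0 by (simp add: field_simps power2_eq_square)
  have 4: "x * y / of_real N / of_nat n + x * z / (of_nat n)\<^sup>2 = x / (of_nat n)\<^sup>2 * (of_real N * y + z)" for x y z :: complex
  proof -
    have "x * y / of_real N / of_nat n = x * y * (1 / of_real N / of_nat n)" by simp
    thus ?thesis unfolding 3 by (simp add: algebra_simps add_divide_distrib)
  qed
  show ?thesis unfolding 1 2 by (rule 4)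
qed

text \<open>
  One factor of the squared defect is expanded with \<open>1 + it m = (1 / n) \<Sum>\<^sub>i (W G)\<^sub>i\<^sub>i\<close>; the other one is kept as the test
  function in the integration by parts.
\<close>
lemma expect_defect_square_eq:
  "expect n p (\<lambda>E. defect n p t E * cnj (defect n p t E)) =
    of_real v / (of_nat n)\<^sup>2 * expect n p (\<lambda>E. \<Sum>i<n. \<Sum>j<n. cell E i j)"
proof -
  have n0: "complex_of_nat n \<noteq> 0" using n by simp
  have "defect n p t E * cnj (defect n p t E) =
     (\<Sum>i<n. \<Sum>j<n. of_real (wigner n p E i j) * G E j i * cnj (defect n p t E) / of_nat n +
       of_real v * (G E i i * G E j j * cnj (defect n p t E)) / (of_nat n)\<^sup>2)" for E
  proof -
    have "1 + \<i> * of_real t * stieltjes n p t E = (\<Sum>i<n. 1 + \<i> * of_real t * G E i i) / of_nat n"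
      using n0 by (simp add: stieltjes_G sum.distrib sum_distrib_left add_divide_distrib)
    also have "\<dots> = (\<Sum>i<n. \<Sum>j<n. of_real (wigner n p E i j) * G E j i) / of_nat n"
      unfolding G_def using resolvent_equation[OF symmetric_wigner t]
      by (intro arg_cong2[where f = "(/)"] sum.cong refl) simp
    finally have 1: "1 + \<i> * of_real t * stieltjes n p t E = \<dots>" .
    have 2: "(stieltjes n p t E)\<^sup>2 = (\<Sum>i<n. \<Sum>j<n. G E i i * G E j j) / (of_nat n)\<^sup>2"
      by (simp add: stieltjes_G power_divide power2_eq_square sum_product)
    have "defect n p t E = (\<Sum>i<n. \<Sum>j<n. of_real (wigner n p E i j) * G E j i / of_nat n +
        of_real v * (G E i i * G E j j) / (of_nat n)\<^sup>2)"
      unfolding defect_v 1 2 by (simp add: sum.distrib sum_divide_distrib sum_distrib_left)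
    hence "defect n p t E * x = (\<Sum>i<n. \<Sum>j<n. of_real (wigner n p E i j) * G E j i * x / of_nat n +
        of_real v * (G E i i * G E j j * x) / (of_nat n)\<^sup>2)" for x
      by (simp only: sum_distrib_right distrib_right) (simp add: mult.assoc)
    thus ?thesis .
  qed
  hence "expect n p (\<lambda>E. defect n p t E * cnj (defect n p t E)) =
     (\<Sum>i<n. \<Sum>j<n. expect n p (\<lambda>E. of_real (wigner n p E i j) * G E j i * cnj (defect n p t E)) / of_nat n +
     of_real v * expect n p (\<lambda>E. G E i i * G E j j * cnj (defect n p t E)) / (of_nat n)\<^sup>2)"
    by simp
  also have "\<dots> = (\<Sum>i<n. \<Sum>j<n. of_real v / (of_nat n)\<^sup>2 * expect n p (\<lambda>E. cell E i j))"
    by (intro sum.cong refl expect_cell) auto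
  also have "\<dots> = of_real v / (of_nat n)\<^sup>2 * expect n p (\<lambda>E. \<Sum>i<n. \<Sum>j<n. cell E i j)"
    by (simp add: sum_distrib_left)
  finally show ?thesis .
qed

lemma cell_sum_bound: "cmod (\<Sum>i<n. \<Sum>j<n. cell E i j) \<le> (real n)\<^sup>2 * (defect_const t / N)"
proof -
  define K where "K = 8 * q ^ 4 * B + 4 * q ^ 3 * B + q\<^sup>2 * L + q * L"
  note cf = const_facts
  have K0: "K \<ge> 0" using cf by (simp add: K_def)
  have cell: "cmod (cell E i j) \<le> 2 * B * (cmod (G E i j))\<^sup>2 + K / N + of_bool (i = j) * (q\<^sup>2 * B)"
    if ij: "i < n" "j < n" for i j
  proof (cases "i = j")
    case True
    have "cmod (cell E i j) = cmod (G E i i) * cmod (G E i i) * cmod (defect n p t E)"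
      using True by (simp add: cell_def norm_mult)
    also have "\<dots> \<le> q * q * B" using cf ij by (intro mult_mono G_bound defect_bound) auto
    finally show ?thesis using True K0 cf by (simp add: power2_eq_square add_nonneg_nonneg add_increasing)
  next
    case False
    thus ?thesis using offdiag_bound[OF ij False, of E] by (simp add: cell_def K_def)
  qed
  have "cmod (\<Sum>i<n. \<Sum>j<n. cell E i j) \<le>
     (\<Sum>i<n. \<Sum>j<n. 2 * B * (cmod (G E i j))\<^sup>2 + K / N + of_bool (i = j) * (q\<^sup>2 * B))"
    by (intro order.trans[OF norm_sum] sum_mono cell) auto
  also have "\<dots> = (\<Sum>i<n. 2 * B * (\<Sum>j<n. (cmod (G E i j))\<^sup>2) + n * (K / N) + q\<^sup>2 * B)"
  proof (intro sum.cong refl)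
    fix i assume "i \<in> {..<n}"
    thus "(\<Sum>j<n. 2 * B * (cmod (G E i j))\<^sup>2 + K / N + of_bool (i = j) * (q\<^sup>2 * B)) =
       2 * B * (\<Sum>j<n. (cmod (G E i j))\<^sup>2) + n * (K / N) + q\<^sup>2 * B"
      using sum_of_bool_mult(1)[of i n "\<lambda>_. q\<^sup>2 * B"]
      by (simp only: sum.distrib sum_distrib_left[symmetric]) simp
  qed
  also have "\<dots> \<le> (\<Sum>i<n. 2 * B * q\<^sup>2 + n * (K / N) + q\<^sup>2 * B)"
    using cf by (intro sum_mono add_mono mult_left_mono G_row) auto
  also have "\<dots> = n * (2 * B * q\<^sup>2 + q\<^sup>2 * B) + (real n)\<^sup>2 * (K / N)"
    by (simp add: algebra_simps power2_eq_square)
  also have "real n \<le> (real n)\<^sup>2 / N"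
    using cf n by (simp add: power2_eq_square field_simps)
  hence "n * (2 * B * q\<^sup>2 + q\<^sup>2 * B) + (real n)\<^sup>2 * (K / N) \<le> (real n)\<^sup>2 / N * (2 * B * q\<^sup>2 + q\<^sup>2 * B) + (real n)\<^sup>2 * (K / N)"
    using cf by (intro add_right_mono mult_right_mono) auto
  also have "\<dots> = (real n)\<^sup>2 * (defect_const t / N)"
    unfolding defect_const_def Let_def K_def B_def L_def q_def by (simp add: algebra_simps add_divide_distrib)
  finally show ?thesis .
qed

text \<open>
  Each of the \<open>n\<^sup>2\<close> positions contributes \<open>O(1 / \<surd>n)\<close> on average. Smallness of the second moment contains both convergence of the
  mean and concentration of the Stieltjes transform.
\<close>
lemma expect_defect_square: "expect n p (\<lambda>E. (cmod (defect n p t E))\<^sup>2) \<le> defect_const t / sqrt n"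
proof -
  note cf = const_facts
  have "complex_of_real (expect n p (\<lambda>E. (cmod (defect n p t E))\<^sup>2)) = expect n p (\<lambda>E. complex_of_real ((cmod (defect n p t E))\<^sup>2))"
    by (rule integral_complex_of_real[symmetric])
  also have "\<dots> = expect n p (\<lambda>E. defect n p t E * cnj (defect n p t E))"
    by (simp only: complex_norm_square)
  also have "\<dots> = of_real v / (of_nat n)\<^sup>2 * expect n p (\<lambda>E. \<Sum>i<n. \<Sum>j<n. cell E i j)"
    by (rule expect_defect_square_eq)
  finally have "cmod (complex_of_real (expect n p (\<lambda>E. (cmod (defect n p t E))\<^sup>2))) =
     v / (real n)\<^sup>2 * cmod (expect n p (\<lambda>E. \<Sum>i<n. \<Sum>j<n. cell E i j))"
    using cf by (simp add: norm_mult norm_divide norm_power)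
  hence "expect n p (\<lambda>E. (cmod (defect n p t E))\<^sup>2) \<le> v / (real n)\<^sup>2 * cmod (expect n p (\<lambda>E. \<Sum>i<n. \<Sum>j<n. cell E i j))"
    by simp
  also have "\<dots> \<le> 1 / (real n)\<^sup>2 * ((real n)\<^sup>2 * (defect_const t / N))"
  proof (intro mult_mono divide_right_mono)
    have "cmod (expect n p (\<lambda>E. \<Sum>i<n. \<Sum>j<n. cell E i j)) \<le> expect n p (\<lambda>E. cmod (\<Sum>i<n. \<Sum>j<n. cell E i j))"
      by (rule integral_norm_bound)
    also have "\<dots> \<le> expect n p (\<lambda>E. (real n)\<^sup>2 * (defect_const t / N))"
      by (intro integral_mono cell_sum_bound) auto
    finally show "cmod (expect n p (\<lambda>E. \<Sum>i<n. \<Sum>j<n. cell E i j)) \<le> (real n)\<^sup>2 * (defect_const t / N)"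
      by simp
  qed (use cf in auto)
  finally show ?thesis using n by (simp add: N_def)
qed

end

section \<open>Comparison with the semicircle law\<close>

text \<open>
  The Stieltjes transform of the semicircle law of variance \<open>s\<^sup>2\<close> at the point \<open>it\<close> equals \<open>i w / s\<close>, where \<open>w\<close> is this
  profile.
\<close>
definition semicircle_profile :: "real \<Rightarrow> real \<Rightarrow> real" where
  "semicircle_profile s t = (sqrt (t\<^sup>2 + 4 * s\<^sup>2) - t) / (2 * s)"

lemma semicircle_profile_equation:
  assumes "s > 0"
  shows "(semicircle_profile s t)\<^sup>2 + t * semicircle_profile s t / s = 1"
proof -
  define r where "r = sqrt (t\<^sup>2 + 4 * s\<^sup>2)"
  have r: "r\<^sup>2 = t\<^sup>2 + 4 * s\<^sup>2" unfolding r_def by (intro real_sqrt_pow2) (simp add: add_nonneg_nonneg)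
  have "(semicircle_profile s t)\<^sup>2 + t * semicircle_profile s t / s = ((r\<^sup>2 - 2 * r * t + t\<^sup>2) + 2 * t * (r - t)) / (4 * s\<^sup>2)"
    using assms unfolding semicircle_profile_def r_def[symmetric]
    by (simp add: power2_eq_square field_simps)
  also have "\<dots> = 1" unfolding r using assms by (simp add: power2_eq_square field_simps)
  finally show ?thesis .
qed

lemma semicircle_profile_bounds:
  assumes s: "s > 0" and t: "t \<ge> 0"
  shows "semicircle_profile s t > 0" and "(semicircle_profile s t)\<^sup>2 \<le> 1" and "t * semicircle_profile s t \<le> s"
proof -
  have "t = sqrt (t\<^sup>2)" using t by simp
  also have "\<dots> < sqrt (t\<^sup>2 + 4 * s\<^sup>2)" using s by (intro real_sqrt_less_mono) simp
  finally show pos: "semicircle_profile s t > 0" using s by (simp add: semicircle_profile_def)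
  note eq = semicircle_profile_equation[OF s, of t]
  have "0 \<le> t * semicircle_profile s t / s" using pos s t by simp
  thus "(semicircle_profile s t)\<^sup>2 \<le> 1" using eq by linarith
  have "t * semicircle_profile s t / s \<le> 1" using eq zero_le_power2[of "semicircle_profile s t"] by linarith
  thus "t * semicircle_profile s t \<le> s" using s by (simp add: field_simps)
qed

text \<open>
  The polynomial factors as \<open>s\<^sup>2 (m - ig) (m + i (g + h))\<close> with \<open>g = w / s\<close> and \<open>h = t / s\<^sup>2\<close>. In the upper half plane the second
  factor has modulus at least \<open>h\<close>, so the defect controls \<open>t \<bar>m - ig\<bar>\<close>.
\<close>
lemma quadratic_stability:
  assumes s: "s > 0" and t: "t > 0" and m: "Im m \<ge> 0"
  shows "\<bar>1 - t * Im m - (semicircle_profile s t)\<^sup>2\<bar> \<le> cmod (1 + \<i> * of_real t * m + of_real (s\<^sup>2) * m\<^sup>2)"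
proof -
  define w where "w = semicircle_profile s t"
  have w: "w > 0" "w\<^sup>2 + t * w / s = 1"
    using semicircle_profile_bounds(1)[OF s] semicircle_profile_equation[OF s] t by (auto simp: w_def)
  define g where "g = w / s"
  define h where "h = t / s\<^sup>2"
  define a where "a = m - \<i> * of_real g"
  define b where "b = m + \<i> * of_real (g + h)"
  have 1: "s\<^sup>2 * h = t" and 2: "s\<^sup>2 * (g * (g + h)) = 1"
    using w(2) s by (simp_all add: g_def h_def power2_eq_square field_simps)
  have "of_real (s\<^sup>2) * (a * b) = of_real (s\<^sup>2) * m\<^sup>2 + \<i> * of_real (s\<^sup>2 * h) * m + of_real (s\<^sup>2 * (g * (g + h)))"
    unfolding a_def b_def of_real_mult of_real_add
    by (simp add: algebra_simps power2_eq_square[of m])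
  hence fact: "1 + \<i> * of_real t * m + of_real (s\<^sup>2) * m\<^sup>2 = of_real (s\<^sup>2) * (a * b)"
    unfolding 1 2 by simp
  have "t / s\<^sup>2 \<le> Im b" using m w s by (simp add: b_def g_def h_def)
  also have "\<dots> \<le> cmod b" using abs_Im_le_cmod[of b] by simp
  finally have b: "t \<le> s\<^sup>2 * cmod b" using s by (simp add: field_simps)
  have "\<bar>1 - t * Im m - w\<^sup>2\<bar> = t * \<bar>Im a\<bar>"
  proof -
    have "1 - t * Im m - w\<^sup>2 = - (t * Im a)" using w(2) by (simp add: a_def g_def algebra_simps)
    thus ?thesis using t by (simp add: abs_mult)
  qed
  also have "\<dots> \<le> (s\<^sup>2 * cmod b) * cmod a"
    using b t abs_Im_le_cmod[of a] by (intro mult_mono) auto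
  also have "\<dots> = cmod (of_real (s\<^sup>2) * (a * b))" by (simp add: norm_mult norm_power)
  finally show ?thesis unfolding fact w_def .
qed

text \<open>
  The spectral mean of the integrand of Coulson's formula.
\<close>
definition spectral_average :: "nat \<Rightarrow> real \<Rightarrow> edge_set \<Rightarrow> real \<Rightarrow> real" where
  "spectral_average n p E t = (\<Sum>k<n. (eigenvalues n (wigner n p E) k)\<^sup>2 / ((eigenvalues n (wigner n p E) k)\<^sup>2 + t\<^sup>2)) / n"

lemma spectral_average_stieltjes:
  assumes n: "n > 0" and t: "t > 0"
  shows "1 - t * Im (stieltjes n p t E) = spectral_average n p E t" and "Im (stieltjes n p t E) \<ge> 0"
proof -
  define lam where "lam = eigenvalues n (wigner n p E)"
  have "Im (1 / (of_real (lam k) - \<i> * of_real t)) = t / ((lam k)\<^sup>2 + t\<^sup>2)" for k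
    by (simp add: Im_divide power2_eq_square)
  hence im: "Im (stieltjes n p t E) = (\<Sum>k<n. t / ((lam k)\<^sup>2 + t\<^sup>2)) / n"
    unfolding stieltjes_def resolvent_trace[OF symmetric_wigner] lam_def
    by (simp add: Im_divide_of_nat)
  show "Im (stieltjes n p t E) \<ge> 0" unfolding im using t by (intro divide_nonneg_nonneg sum_nonneg) auto
  have "1 - t * Im (stieltjes n p t E) = ((\<Sum>k<n. 1) - (\<Sum>k<n. t * (t / ((lam k)\<^sup>2 + t\<^sup>2)))) / n"
    unfolding im using n by (simp add: diff_divide_distrib sum_distrib_left)
  also have "(\<Sum>k<n. 1) - (\<Sum>k<n. t * (t / ((lam k)\<^sup>2 + t\<^sup>2))) = (\<Sum>k<n. (lam k)\<^sup>2 / ((lam k)\<^sup>2 + t\<^sup>2))"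
    unfolding sum_subtractf[symmetric]
  proof (intro sum.cong refl)
    fix k
    define D where "D = (lam k)\<^sup>2 + t\<^sup>2"
    have "D > 0" unfolding D_def using t by (simp add: add_nonneg_pos)
    hence "1 - t * (t / D) = (D - t\<^sup>2) / D" by (simp add: field_simps power2_eq_square)
    thus "1 - t * (t / ((lam k)\<^sup>2 + t\<^sup>2)) = (lam k)\<^sup>2 / ((lam k)\<^sup>2 + t\<^sup>2)"
      by (simp add: D_def)
  qed
  finally show "1 - t * Im (stieltjes n p t E) = spectral_average n p E t"
    by (simp add: spectral_average_def lam_def)
qed

lemma wigner_entry_bound:
  assumes "0 < p" "p < 1"
  shows "(wigner n p E i j)\<^sup>2 \<le> 1 / n"
proof -
  have "(of_bool b - p)\<^sup>2 \<le> 1" for b using assms by (cases b) (auto simp: abs_square_le_1)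
  thus ?thesis by (auto simp: wigner_def power_divide divide_right_mono)
qed

text \<open>
  A bound that is uniform in the graph and integrable in \<open>t\<close>, for use in dominated convergence. It rests on the
  mean square eigenvalue being at most 1, which holds for every graph.
\<close>
lemma spectral_average_bounds:
  assumes n: "n > 0" and p: "0 < p" "p < 1"
  shows "0 \<le> spectral_average n p E t" and "spectral_average n p E t \<le> 2 / (1 + t\<^sup>2)"
proof -
  define lam where "lam = eigenvalues n (wigner n p E)"
  have sa: "spectral_average n p E t = (\<Sum>k<n. (lam k)\<^sup>2 / ((lam k)\<^sup>2 + t\<^sup>2)) / n"
    by (simp add: spectral_average_def lam_def)
  show "0 \<le> spectral_average n p E t" unfolding sa by (intro divide_nonneg_nonneg sum_nonneg) auto
  have "(\<Sum>k<n. (lam k)\<^sup>2) = (\<Sum>i<n. \<Sum>j<n. (wigner n p E i j)\<^sup>2)"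
    unfolding lam_def by (rule sum_squares_eigenvalues[OF eigensystem_some[OF symmetric_wigner]])
  also have "\<dots> \<le> (\<Sum>i<n. \<Sum>j<n. 1 / real n)"
    by (intro sum_mono wigner_entry_bound p)
  finally have sq: "(\<Sum>k<n. (lam k)\<^sup>2) \<le> n" using n by simp
  have "(1 + t\<^sup>2) * (\<Sum>k<n. (lam k)\<^sup>2 / ((lam k)\<^sup>2 + t\<^sup>2)) \<le> (\<Sum>k<n. 1 + (lam k)\<^sup>2)"
    unfolding sum_distrib_left
  proof (intro sum_mono)
    fix k
    show "(1 + t\<^sup>2) * ((lam k)\<^sup>2 / ((lam k)\<^sup>2 + t\<^sup>2)) \<le> 1 + (lam k)\<^sup>2"
    proof (cases "(lam k)\<^sup>2 + t\<^sup>2 = 0")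
      case False
      hence pos: "(lam k)\<^sup>2 + t\<^sup>2 > 0" by (metis add_nonneg_nonneg less_le zero_le_power2)
      have "(1 + t\<^sup>2) * (lam k)\<^sup>2 \<le> (1 + (lam k)\<^sup>2) * ((lam k)\<^sup>2 + t\<^sup>2)"
        by (simp add: algebra_simps)
      thus ?thesis using pos by (simp add: field_simps)
    qed (simp add: add_nonneg_nonneg)
  qed
  also have "\<dots> \<le> 2 * n" using sq by (simp add: sum.distrib)
  finally have "(1 + t\<^sup>2) * spectral_average n p E t \<le> 2" unfolding sa using n by (simp add: field_simps)
  moreover have "1 + t\<^sup>2 > 0" by (simp add: add_pos_nonneg)
  ultimately show "spectral_average n p E t \<le> 2 / (1 + t\<^sup>2)" by (simp add: field_simps)
qed

text \<open>
  Nonnegativity of the variance.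
\<close>
lemma expect_le_sqrt:
  fixes X :: "edge_set \<Rightarrow> real"
  shows "expect n p X \<le> sqrt (expect n p (\<lambda>E. (X E)\<^sup>2))"
proof -
  define a where "a = expect n p X"
  have "0 \<le> expect n p (\<lambda>E. (X E - a)\<^sup>2)" by (intro Bochner_Integration.integral_nonneg) auto
  also have "\<dots> = expect n p (\<lambda>E. (X E)\<^sup>2 - 2 * a * X E + a\<^sup>2)"
    by (simp add: power2_eq_square algebra_simps)
  also have "\<dots> = expect n p (\<lambda>E. (X E)\<^sup>2) - 2 * a * a + a\<^sup>2"
    by (simp add: a_def)
  finally have "a\<^sup>2 \<le> expect n p (\<lambda>E. (X E)\<^sup>2)" by (simp add: power2_eq_square)
  thus ?thesis unfolding a_def by (rule real_le_rsqrt)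
qed

lemma expect_spectral_average:
  assumes n: "n > 0" and p: "0 < p" "p < 1" and t: "t > 0"
  shows "expect n p (\<lambda>E. \<bar>spectral_average n p E t - (semicircle_profile (sqrt (p * (1 - p))) t)\<^sup>2\<bar>) \<le> sqrt (defect_const t / sqrt n)"
proof -
  let ?s = "sqrt (p * (1 - p))"
  have s: "?s > 0" "?s\<^sup>2 = p * (1 - p)" using p by auto
  have "expect n p (\<lambda>E. \<bar>spectral_average n p E t - (semicircle_profile ?s t)\<^sup>2\<bar>) \<le> expect n p (\<lambda>E. cmod (defect n p t E))"
  proof (intro integral_mono)
    fix E
    show "\<bar>spectral_average n p E t - (semicircle_profile ?s t)\<^sup>2\<bar> \<le> cmod (defect n p t E)"
      using quadratic_stability[OF s(1) t spectral_average_stieltjes(2)[OF n t, of p E]]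
      unfolding spectral_average_stieltjes(1)[OF n t] s(2) defect_def .
  qed auto
  also have "\<dots> \<le> sqrt (expect n p (\<lambda>E. (cmod (defect n p t E))\<^sup>2))" by (rule expect_le_sqrt)
  also have "\<dots> \<le> sqrt (defect_const t / sqrt n)"
    by (intro real_sqrt_le_mono expect_defect_square[OF n p t])
  finally show ?thesis .
qed

section \<open>Integral formulas for the mean absolute value\<close>

lemma has_bochner_integral_FTC_atLeast:
  fixes f F :: "real \<Rightarrow> real"
  assumes meas: "f \<in> borel_measurable borel"
    and deriv: "\<And>x. 0 \<le> x \<Longrightarrow> (F has_real_derivative f x) (at x)"
    and nonneg: "\<And>x. 0 \<le> x \<Longrightarrow> 0 \<le> f x"
    and lim: "(F \<longlongrightarrow> T) at_top" and pos: "T \<ge> F 0"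
  shows "has_bochner_integral lborel (\<lambda>x. f x * indicator {0..} x) (T - F 0)"
proof (rule has_bochner_integral_nn_integral)
  have "(\<integral>\<^sup>+x. ennreal (f x * indicator {0..} x) \<partial>lborel) = (\<integral>\<^sup>+x. ennreal (f x) * indicator {0..} x \<partial>lborel)"
    by (intro nn_integral_cong) (auto split: split_indicator)
  also have "\<dots> = ennreal (T - F 0)" by (rule nn_integral_FTC_atLeast[OF meas deriv nonneg lim])
  finally show "(\<integral>\<^sup>+x. ennreal (f x * indicator {0..} x) \<partial>lborel) = ennreal (T - F 0)" .
  show "(\<lambda>x. f x * indicator {0..} x) \<in> borel_measurable lborel" using meas by simp
  show "AE x in lborel. 0 \<le> f x * indicator {0..} x" using nonneg by (auto split: split_indicator)
qed (use pos in simp)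

text \<open>
  An antiderivative is \<open>y arctan (t / y)\<close> with \<open>y = \<bar>x\<bar>\<close>.
\<close>
lemma coulson_integral:
  fixes x :: real
  shows "has_bochner_integral lborel (\<lambda>t. x\<^sup>2 / (x\<^sup>2 + t\<^sup>2) * indicator {0..} t) (pi / 2 * \<bar>x\<bar>)"
proof (cases "x = 0")
  case True
  thus ?thesis by (simp add: has_bochner_integral_zero)
next
  case False
  define y where "y = \<bar>x\<bar>"
  have y: "y > 0" "x\<^sup>2 = y\<^sup>2" using False by (auto simp: y_def)
  have "has_bochner_integral lborel (\<lambda>t. y\<^sup>2 / (y\<^sup>2 + t\<^sup>2) * indicator {0..} t) (y * (pi / 2) - y * arctan (0 / y))"
  proof (rule has_bochner_integral_FTC_atLeast[where F = "\<lambda>t. y * arctan (t / y)"])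
    fix t :: real assume "0 \<le> t"
    have "1 + (t / y)\<^sup>2 > 0" by (simp add: add_pos_nonneg)
    show "((\<lambda>t. y * arctan (t / y)) has_real_derivative y\<^sup>2 / (y\<^sup>2 + t\<^sup>2)) (at t)"
      using y by (auto intro!: derivative_eq_intros simp: field_simps power2_eq_square)
  next
    have "filterlim (\<lambda>t. t / y) at_top at_top"
      using filterlim_tendsto_pos_mult_at_top[OF tendsto_const[of "1 / y"] _ filterlim_ident] y by simp
    from filterlim_compose[OF tendsto_arctan_at_top this]
    show "((\<lambda>t. y * arctan (t / y)) \<longlongrightarrow> y * (pi / 2)) at_top"
      by (intro tendsto_intros)
  qed (use y in auto)
  thus ?thesis unfolding y(2) by (simp add: y_def ac_simps)
qed

lemma tendsto_semicircle_profile: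
  assumes s: "s > 0"
  shows "(semicircle_profile s \<longlongrightarrow> 0) at_top"
proof (rule tendsto_sandwich)
  show "eventually (\<lambda>t. 0 \<le> semicircle_profile s t) at_top"
    using eventually_ge_at_top[of 0] by eventually_elim (use semicircle_profile_bounds(1)[OF s] in \<open>force intro: less_imp_le\<close>)
  show "eventually (\<lambda>t. semicircle_profile s t \<le> s / t) at_top"
    using eventually_gt_at_top[of 0]
    by eventually_elim (use semicircle_profile_bounds(3)[OF s] in \<open>simp add: field_simps\<close>)
  show "((\<lambda>t. s / t) \<longlongrightarrow> 0) at_top"
    by (intro tendsto_divide_0[OF tendsto_const] filterlim_at_top_imp_at_infinity filterlim_ident)
qed simp

text \<open>
  The relation \<open>w\<^sup>2 + t w / s = 1\<close> means \<open>t = s (1 / w - w)\<close>, so the substitution of \<open>w\<close> for \<open>t\<close> turns the integrand into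
  \<open>- s (1 + w\<^sup>2)\<close>. This explains the antiderivative \<open>- s (w + w\<^sup>3 / 3)\<close>; \<open>w\<close> runs from 1 to 0.
\<close>
lemma semicircle_integral:
  assumes s: "s > 0"
  shows "has_bochner_integral lborel (\<lambda>t. (semicircle_profile s t)\<^sup>2 * indicator {0..} t) (4 * s / 3)"
proof -
  let ?w = "semicircle_profile s"
  let ?F = "\<lambda>t. - s * (?w t + (?w t) ^ 3 / 3)"
  have w0: "?w 0 = 1" using s by (simp add: semicircle_profile_def real_sqrt_mult)
  have "has_bochner_integral lborel (\<lambda>t. (?w t)\<^sup>2 * indicator {0..} t) (- s * (0 + 0 ^ 3 / 3) - ?F 0)"
  proof (rule has_bochner_integral_FTC_atLeast)
    show "(\<lambda>t. (?w t)\<^sup>2) \<in> borel_measurable borel"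
      unfolding semicircle_profile_def by measurable
    show "(?F \<longlongrightarrow> - s * (0 + 0 ^ 3 / 3)) at_top"
      by (intro tendsto_intros tendsto_semicircle_profile[OF s]) simp
    fix t :: real assume t: "0 \<le> t"
    define r where "r = sqrt (t\<^sup>2 + 4 * s\<^sup>2)"
    have pos: "t\<^sup>2 + 4 * s\<^sup>2 > 0" using s by (simp add: add_nonneg_pos)
    have r: "r > 0" using pos by (simp add: r_def)
    have w: "?w t = (r - t) / (2 * s)" by (simp add: semicircle_profile_def r_def)
    have "((\<lambda>t. sqrt (t\<^sup>2 + 4 * s\<^sup>2)) has_real_derivative t / r) (at t)"
      using pos by (auto intro!: derivative_eq_intros simp: r_def field_simps)
    hence "(?w has_real_derivative (t / r - 1) / (2 * s)) (at t)"
      unfolding semicircle_profile_def by (intro DERIV_cdivide DERIV_diff DERIV_ident)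
    also have "(t / r - 1) / (2 * s) = - (?w t / r)" using r s by (simp add: w field_simps)
    finally have dw: "(?w has_real_derivative - (?w t / r)) (at t)" .
    have "(?F has_real_derivative - s * (- (?w t / r) + 3 * (?w t)\<^sup>2 * (- (?w t / r)) / 3)) (at t)"
      using dw by (auto intro!: derivative_eq_intros simp: power2_eq_square)
    also have "- s * (- (?w t / r) + 3 * (?w t)\<^sup>2 * (- (?w t / r)) / 3) = ?w t / r * (s * (1 + (?w t)\<^sup>2))"
      by (simp add: algebra_simps)
    also have "s * (1 + (?w t)\<^sup>2) = ?w t * r"
    proof -
      have "s = s * ((?w t)\<^sup>2 + t * ?w t / s)" using semicircle_profile_equation[OF s, of t] by simp
      hence "s * (1 + (?w t)\<^sup>2) = 2 * s * ?w t * ?w t + t * ?w t" using s by (simp add: power2_eq_square algebra_simps)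
      also have "2 * s * ?w t = r - t" using s by (simp add: w)
      finally show ?thesis by (simp add: algebra_simps)
    qed
    also have "?w t / r * (?w t * r) = (?w t)\<^sup>2" using r by (simp add: power2_eq_square)
    finally show "(?F has_real_derivative (?w t)\<^sup>2) (at t)" .
  qed (use s in \<open>auto simp: w0\<close>)
  thus ?thesis by (simp add: w0 mult.commute)
qed

section \<open>Mean absolute eigenvalue\<close>

definition L1_deviation :: "nat \<Rightarrow> real \<Rightarrow> real \<Rightarrow> edge_set \<Rightarrow> real \<Rightarrow> real" where
  "L1_deviation n p s E t = \<bar>spectral_average n p E t - (semicircle_profile s t)\<^sup>2\<bar> * indicator {0..} t"

lemma spectral_average_integral:
  "has_bochner_integral lborel (\<lambda>t. spectral_average n p E t * indicator {0..} t) (pi / 2 * (trace_norm n (wigner n p E) / n))"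
proof -
  define lam where "lam = eigenvalues n (wigner n p E)"
  have tn: "trace_norm n (wigner n p E) = (\<Sum>k<n. \<bar>lam k\<bar>)"
    unfolding lam_def by (rule trace_norm_eigensystem[OF eigensystem_some[OF symmetric_wigner]])
  have "has_bochner_integral lborel (\<lambda>t. (\<Sum>k<n. (lam k)\<^sup>2 / ((lam k)\<^sup>2 + t\<^sup>2) * indicator {0..} t) * (1 / n)) ((\<Sum>k<n. pi / 2 * \<bar>lam k\<bar>) * (1 / n))"
    by (intro has_bochner_integral_mult_left has_bochner_integral_sum coulson_integral)
  thus ?thesis
    by (simp add: tn spectral_average_def lam_def sum_distrib_left sum_distrib_right sum_divide_distrib ac_simps)
qed

lemma integrable_L1_deviation:
  assumes s: "s > 0"
  shows "integrable lborel (L1_deviation n p s E)"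
proof -
  have "L1_deviation n p s E = (\<lambda>t. \<bar>spectral_average n p E t * indicator {0..} t - (semicircle_profile s t)\<^sup>2 * indicator {0..} t\<bar>)"
    by (auto simp: L1_deviation_def fun_eq_iff split: split_indicator)
  thus ?thesis
    using has_bochner_integral_diff[OF spectral_average_integral[of n p E] semicircle_integral[OF s]]
    by (simp add: has_bochner_integral_iff)
qed

lemma trace_norm_deviation_le_integral:
  assumes s: "s > 0"
  shows "\<bar>trace_norm n (wigner n p E) / n - 8 / (3 * pi) * s\<bar> \<le> 2 / pi * integral\<^sup>L lborel (L1_deviation n p s E)"
proof -
  note diff = has_bochner_integral_diff[OF spectral_average_integral[of n p E] semicircle_integral[OF s]]
  have "\<bar>pi / 2 * (trace_norm n (wigner n p E) / n) - 4 * s / 3\<bar> =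
     \<bar>integral\<^sup>L lborel (\<lambda>t. spectral_average n p E t * indicator {0..} t - (semicircle_profile s t)\<^sup>2 * indicator {0..} t)\<bar>"
    using has_bochner_integral_integral_eq[OF diff] by simp
  also have "\<dots> \<le> integral\<^sup>L lborel (\<lambda>t. \<bar>spectral_average n p E t * indicator {0..} t - (semicircle_profile s t)\<^sup>2 * indicator {0..} t\<bar>)"
    by (rule integral_abs_bound)
  also have "(\<lambda>t. \<bar>spectral_average n p E t * indicator {0..} t - (semicircle_profile s t)\<^sup>2 * indicator {0..} t\<bar>) = L1_deviation n p s E"
    by (auto simp: L1_deviation_def fun_eq_iff split: split_indicator)
  finally have 1: "2 / pi * \<bar>pi / 2 * (trace_norm n (wigner n p E) / n) - 4 * s / 3\<bar> \<le> 2 / pi * integral\<^sup>L lborel (L1_deviation n p s E)"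
    by (intro mult_left_mono) auto
  have 2: "2 / pi * \<bar>x\<bar> = \<bar>2 / pi * x\<bar>" for x :: real by (simp add: abs_mult)
  have 3: "2 / pi * (pi / 2 * (trace_norm n (wigner n p E) / n) - 4 * s / 3) = trace_norm n (wigner n p E) / n - 8 / (3 * pi) * s"
    by (simp add: field_simps)
  show ?thesis using 1 unfolding 2 3 .
qed

lemma expect_eq_sum: "expect n p X = (\<Sum>E\<in>set_pmf (erdos_renyi n p). X E * pmf (erdos_renyi n p) E)" for X :: "edge_set \<Rightarrow> real"
  by (rule integral_measure_pmf_real) auto

lemma integral_expect:
  fixes F :: "edge_set \<Rightarrow> real \<Rightarrow> real"
  assumes "\<And>E. integrable lborel (F E)"
  shows "integral\<^sup>L lborel (\<lambda>t. expect n p (\<lambda>E. F E t)) = expect n p (\<lambda>E. integral\<^sup>L lborel (F E))"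
    and "integrable lborel (\<lambda>t. expect n p (\<lambda>E. F E t))"
  unfolding expect_eq_sum using assms by auto

text \<open>
  For each \<open>t > 0\<close> the expected deviation of the integrand from its semicircle value tends to 0 by the second moment
  bound, and it is dominated by \<open>2 / (1 + t\<^sup>2)\<close>. Integration over \<open>t\<close> commutes with the expectation, a finite sum.
\<close>
theorem wigner_mean_abs_eigenvalue:
  assumes p: "0 < p" "p < 1"
  shows "(\<lambda>n. expect n p (\<lambda>E. \<bar>trace_norm n (wigner n p E) / n - 8 / (3 * pi) * sqrt (p * (1 - p))\<bar>)) \<longlonglongrightarrow> 0"
proof -
  define s where "s = sqrt (p * (1 - p))"
  have s: "s > 0" "s\<^sup>2 \<le> 1"
    using p mult_le_one[of p "1 - p"] by (auto simp: s_def)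
  \<comment> \<open>The shift to \<open>Suc n\<close> avoids the empty graph, for which the means over \<open>n\<close> eigenvalues are meaningless.\<close>
  define e where "e n t = expect (Suc n) p (\<lambda>E. L1_deviation (Suc n) p s E t)" for n t
  have bound: "norm (e n t) \<le> 2 * (1\<^sup>2 / (1\<^sup>2 + t\<^sup>2) * indicator {0..} t)" for n t
  proof (cases "t \<ge> 0")
    case True
    have "t\<^sup>2 * (semicircle_profile s t)\<^sup>2 \<le> s\<^sup>2"
      unfolding power_mult_distrib[symmetric]
      using semicircle_profile_bounds[OF s(1) True] True by (intro power_mono) auto
    hence "(1 + t\<^sup>2) * (semicircle_profile s t)\<^sup>2 \<le> 2"
      using semicircle_profile_bounds(2)[OF s(1) True] s(2) by (simp add: algebra_simps)
    moreover have "1 + t\<^sup>2 > 0" by (simp add: add_pos_nonneg)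
    ultimately have w: "(semicircle_profile s t)\<^sup>2 \<le> 2 / (1 + t\<^sup>2)" by (simp add: field_simps)
    have dev: "L1_deviation (Suc n) p s E t \<le> 2 / (1 + t\<^sup>2)" for E
    proof -
      have "0 \<le> spectral_average (Suc n) p E t" "spectral_average (Suc n) p E t \<le> 2 / (1 + t\<^sup>2)"
        using spectral_average_bounds[of "Suc n" p] p by auto
      thus ?thesis using w True by (simp add: L1_deviation_def abs_le_iff) (smt (verit) zero_le_power2)
    qed
    have "e n t \<le> expect (Suc n) p (\<lambda>E. 2 / (1 + t\<^sup>2))"
      unfolding e_def by (intro integral_mono dev) auto
    moreover have "e n t \<ge> 0" unfolding e_def by (intro Bochner_Integration.integral_nonneg) (auto simp: L1_deviation_def)
    ultimately show ?thesis using True by simp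
  qed (simp add: e_def L1_deviation_def)
  have lim: "(\<lambda>n. e n t) \<longlonglongrightarrow> 0" if t: "t \<noteq> 0" for t
  proof (cases "t > 0")
    case True
    show ?thesis
    proof (rule tendsto_sandwich)
      show "eventually (\<lambda>n. 0 \<le> e n t) sequentially"
        unfolding e_def by (intro always_eventually allI Bochner_Integration.integral_nonneg) (auto simp: L1_deviation_def)
      show "eventually (\<lambda>n. e n t \<le> sqrt (defect_const t / sqrt (Suc n))) sequentially"
        using expect_spectral_average[OF _ p True] True
        by (intro always_eventually allI) (auto simp: e_def L1_deviation_def s_def simp del: of_nat_Suc)
      have "filterlim (\<lambda>n. sqrt (real (Suc n))) at_top sequentially"
        by (intro filterlim_compose[OF sqrt_at_top] filterlim_compose[OF filterlim_real_sequentially] filterlim_Suc)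
      hence "(\<lambda>n. sqrt (defect_const t / sqrt (Suc n))) \<longlonglongrightarrow> sqrt 0"
        by (intro tendsto_real_sqrt tendsto_divide_0[OF tendsto_const] filterlim_at_top_imp_at_infinity)
      thus "(\<lambda>n. sqrt (defect_const t / sqrt (Suc n))) \<longlonglongrightarrow> 0" by simp
    qed simp
  next
    case False
    thus ?thesis using t by (simp add: e_def L1_deviation_def)
  qed
  have int_e: "integrable lborel (e n)" "integral\<^sup>L lborel (e n) = expect (Suc n) p (\<lambda>E. integral\<^sup>L lborel (L1_deviation (Suc n) p s E))" for n
    using integral_expect[of "L1_deviation (Suc n) p s" "Suc n" p] integrable_L1_deviation[OF s(1)]
    unfolding e_def[abs_def] by auto
  have "(\<lambda>n. integral\<^sup>L lborel (e n)) \<longlonglongrightarrow> integral\<^sup>L lborel (\<lambda>t::real. 0)"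
  proof (rule integral_dominated_convergence[where M = lborel and s = e and f = "\<lambda>_. 0" and w = "\<lambda>t. 2 * (1\<^sup>2 / (1\<^sup>2 + t\<^sup>2) * indicator {0..} t)"])
    show "integrable lborel (\<lambda>t::real. 2 * (1\<^sup>2 / (1\<^sup>2 + t\<^sup>2) * indicator {0..} t :: real))"
      using coulson_integral[of 1] unfolding has_bochner_integral_iff by (intro integrable_mult_right) auto
    \<comment> \<open>At \<open>t = 0\<close> the resolvent bounds are void; a single point does not matter.\<close>
    show "AE t in lborel. (\<lambda>n. e n t) \<longlonglongrightarrow> 0"
      using AE_lborel_singleton[of 0] by eventually_elim (rule lim)
    show "e n \<in> borel_measurable lborel" for n using int_e(1)[of n] by auto
  qed (use bound in auto)
  hence to0: "(\<lambda>n. 2 / pi * integral\<^sup>L lborel (e n)) \<longlonglongrightarrow> 0"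
    using tendsto_mult_right_zero by force
  have "(\<lambda>n. expect (Suc n) p (\<lambda>E. \<bar>trace_norm (Suc n) (wigner (Suc n) p E) / Suc n - 8 / (3 * pi) * s\<bar>)) \<longlonglongrightarrow> 0"
  proof (rule tendsto_sandwich[OF _ _ tendsto_const to0])
    show "eventually (\<lambda>n. 0 \<le> expect (Suc n) p (\<lambda>E. \<bar>trace_norm (Suc n) (wigner (Suc n) p E) / Suc n - 8 / (3 * pi) * s\<bar>)) sequentially"
      by (intro always_eventually allI Bochner_Integration.integral_nonneg) auto
    show "eventually (\<lambda>n. expect (Suc n) p (\<lambda>E. \<bar>trace_norm (Suc n) (wigner (Suc n) p E) / Suc n - 8 / (3 * pi) * s\<bar>) \<le> 2 / pi * integral\<^sup>L lborel (e n)) sequentially"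
    proof (intro always_eventually allI)
      fix n
      have "expect (Suc n) p (\<lambda>E. \<bar>trace_norm (Suc n) (wigner (Suc n) p E) / Suc n - 8 / (3 * pi) * s\<bar>) \<le>
         expect (Suc n) p (\<lambda>E. 2 / pi * integral\<^sup>L lborel (L1_deviation (Suc n) p s E))"
        by (intro integral_mono trace_norm_deviation_le_integral[OF s(1)]) auto
      thus "expect (Suc n) p (\<lambda>E. \<bar>trace_norm (Suc n) (wigner (Suc n) p E) / Suc n - 8 / (3 * pi) * s\<bar>) \<le> 2 / pi * integral\<^sup>L lborel (e n)"
        unfolding int_e(2) by simp
    qed
  qed
  thus ?thesis unfolding s_def by (rule LIMSEQ_imp_Suc)
qed

section \<open>Statements about almost all graphs\<close>

lemma almost_all_graphs_iff:
  "almost_all_graphs p P \<longleftrightarrow> (\<lambda>n. measure_pmf.prob (erdos_renyi n p) {E. \<not> P n E}) \<longlonglongrightarrow> 0"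
proof -
  have "measure_pmf.prob (erdos_renyi n p) {E. \<not> P n E} = 1 - measure_pmf.prob (erdos_renyi n p) {E. P n E}" for n
    using measure_pmf.prob_compl[of "{E. P n E}" "erdos_renyi n p"] by (simp add: Compl_eq_Diff_UNIV[symmetric] Collect_neg_eq)
  moreover have "(\<lambda>n. 1 - x n) \<longlonglongrightarrow> 0 \<longleftrightarrow> x \<longlonglongrightarrow> 1" for x :: "nat \<Rightarrow> real"
  proof
    assume "(\<lambda>n. 1 - x n) \<longlonglongrightarrow> 0"
    from tendsto_diff[OF tendsto_const[of 1] this] show "x \<longlonglongrightarrow> 1" by simp
  next
    assume "x \<longlonglongrightarrow> 1"
    from tendsto_diff[OF tendsto_const[of 1] this] show "(\<lambda>n. 1 - x n) \<longlonglongrightarrow> 0" by simp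
  qed
  ultimately show ?thesis unfolding almost_all_graphs_def by simp
qed

lemma almost_all_graphs_bound:
  assumes "r \<longlonglongrightarrow> 0" and "eventually (\<lambda>n. measure_pmf.prob (erdos_renyi n p) {E. \<not> P n E} \<le> r n) sequentially"
  shows "almost_all_graphs p P"
  unfolding almost_all_graphs_iff
  by (rule tendsto_sandwich[OF _ assms(2) tendsto_const assms(1)]) simp

lemma almost_all_graphs_mono:
  assumes P: "almost_all_graphs p P"
    and imp: "eventually (\<lambda>n. \<forall>E\<subseteq>all_edges n. P n E \<longrightarrow> Q n E) sequentially"
  shows "almost_all_graphs p Q"
proof (rule almost_all_graphs_bound)
  show "(\<lambda>n. measure_pmf.prob (erdos_renyi n p) {E. \<not> P n E}) \<longlonglongrightarrow> 0"
    using P by (simp add: almost_all_graphs_iff)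
  show "eventually (\<lambda>n. measure_pmf.prob (erdos_renyi n p) {E. \<not> Q n E} \<le> measure_pmf.prob (erdos_renyi n p) {E. \<not> P n E}) sequentially"
    using imp
  proof eventually_elim
    case (elim n)
    show ?case
      using elim erdos_renyi_subset[of _ n p]
      by (intro measure_pmf.finite_measure_mono_AE) (auto simp: AE_measure_pmf_iff)
  qed
qed

lemma almost_all_graphs_conj:
  assumes "almost_all_graphs p P" "almost_all_graphs p Q"
  shows "almost_all_graphs p (\<lambda>n E. P n E \<and> Q n E)"
proof (rule almost_all_graphs_bound)
  let ?pr = "\<lambda>n. measure_pmf.prob (erdos_renyi n p)"
  show "(\<lambda>n. ?pr n {E. \<not> P n E} + ?pr n {E. \<not> Q n E}) \<longlonglongrightarrow> 0"
    using tendsto_add[OF assms[unfolded almost_all_graphs_iff]] by simp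
  have "?pr n {E. \<not> (P n E \<and> Q n E)} \<le> ?pr n {E. \<not> P n E} + ?pr n {E. \<not> Q n E}" for n
  proof -
    have "{E. \<not> (P n E \<and> Q n E)} = {E. \<not> P n E} \<union> {E. \<not> Q n E}" by auto
    thus ?thesis by (simp add: measure_Un_le)
  qed
  thus "eventually (\<lambda>n. ?pr n {E. \<not> (P n E \<and> Q n E)} \<le> ?pr n {E. \<not> P n E} + ?pr n {E. \<not> Q n E}) sequentially"
    by simp
qed

lemma prob_le_expect:
  fixes X :: "edge_set \<Rightarrow> real"
  assumes "\<And>E. X E \<ge> 0" and "\<And>E. E \<in> A \<Longrightarrow> X E \<ge> 1"
  shows "measure_pmf.prob (erdos_renyi n p) A \<le> expect n p X"
proof -
  have "measure_pmf.prob (erdos_renyi n p) A = expect n p (indicator A)" by simp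
  also have "\<dots> \<le> expect n p X"
    using assms by (intro integral_mono) (auto split: split_indicator)
  finally show ?thesis .
qed

lemma almost_all_graphs_markov:
  fixes X :: "nat \<Rightarrow> edge_set \<Rightarrow> real"
  assumes "(\<lambda>n. expect n p (X n)) \<longlonglongrightarrow> 0" and "\<And>n E. X n E \<ge> 0" and \<epsilon>: "\<epsilon> > 0"
  shows "almost_all_graphs p (\<lambda>n E. X n E \<le> \<epsilon>)"
proof (rule almost_all_graphs_bound)
  show "(\<lambda>n. expect n p (X n) / \<epsilon>) \<longlonglongrightarrow> 0"
    using tendsto_divide[OF assms(1) tendsto_const[of \<epsilon>]] \<epsilon> by simp
  have "measure_pmf.prob (erdos_renyi n p) {E. \<not> X n E \<le> \<epsilon>} \<le> expect n p (\<lambda>E. X n E / \<epsilon>)" for n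
    using assms(2) \<epsilon> by (intro prob_le_expect) auto
  thus "eventually (\<lambda>n. measure_pmf.prob (erdos_renyi n p) {E. \<not> X n E \<le> \<epsilon>} \<le> expect n p (X n) / \<epsilon>) sequentially"
    by simp
qed

text \<open>
  From one statement for each fixed tolerance to a deterministic sequence of tolerances. The sequence is, up to \<open>1 / (n + 1)\<close>, the Ky Fan
  distance to perfect accuracy: the least \<open>\<epsilon>\<close> for which the failure probability at tolerance \<open>\<epsilon>\<close> is at most
  \<open>\<epsilon>\<close>.
\<close>
lemma almost_all_graphs_diagonal:
  assumes mono: "\<And>n E \<epsilon> \<epsilon>'. P n \<epsilon> E \<Longrightarrow> \<epsilon> \<le> \<epsilon>' \<Longrightarrow> P n \<epsilon>' E"
    and P: "\<And>\<epsilon>::real. \<epsilon> > 0 \<Longrightarrow> almost_all_graphs p (\<lambda>n E. P n \<epsilon> E)"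
  shows "\<exists>\<delta>. \<delta> \<longlonglongrightarrow> 0 \<and> (\<forall>n. \<delta> n > 0) \<and> almost_all_graphs p (\<lambda>n E. P n (\<delta> n) E)"
proof -
  define r where "r n \<epsilon> = measure_pmf.prob (erdos_renyi n p) {E. \<not> P n \<epsilon> E}" for n \<epsilon>
  define S where "S n = {\<epsilon>. \<epsilon> > 0 \<and> r n \<epsilon> \<le> \<epsilon>}" for n
  \<comment> \<open>The summand \<open>1 / Suc n\<close> is needed because the infimum itself may fail to lie in \<open>S n\<close>.\<close>
  define \<delta> where "\<delta> n = Inf (S n) + 1 / real (Suc n)" for n
  have one: "1 \<in> S n" for n by (simp add: S_def r_def)
  have bdd: "bdd_below (S n)" for n by (rule bdd_belowI[of _ 0]) (simp add: S_def)
  have Inf0: "Inf (S n) \<ge> 0" for n 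
  proof (rule cInf_greatest)
    show "S n \<noteq> {}" using one by blast
  qed (simp add: S_def)
  have \<delta>pos: "\<delta> n > 0" for n using Inf0[of n] by (simp add: \<delta>_def add_nonneg_pos)
  have r\<delta>: "r n (\<delta> n) \<le> \<delta> n" for n
  proof -
    have "Inf (S n) < \<delta> n" by (simp add: \<delta>_def)
    then obtain \<epsilon> where \<epsilon>: "\<epsilon> \<in> S n" "\<epsilon> < \<delta> n" using cInf_lessD[of "S n"] one by blast
    have "r n (\<delta> n) \<le> r n \<epsilon>" unfolding r_def
      using mono[of n \<epsilon> _ "\<delta> n"] \<epsilon> by (intro measure_pmf.finite_measure_mono) auto
    thus ?thesis using \<epsilon> by (simp add: S_def)
  qed
  have lim: "\<delta> \<longlonglongrightarrow> 0"
  proof (rule LIMSEQ_I)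
    fix \<eta> :: real assume \<eta>: "\<eta> > 0"
    have "(\<lambda>n. r n (\<eta> / 2)) \<longlonglongrightarrow> 0"
      using P[of "\<eta> / 2"] \<eta> unfolding almost_all_graphs_iff r_def by simp
    hence "eventually (\<lambda>n. r n (\<eta> / 2) < \<eta> / 2) sequentially"
      using \<eta> by (intro order_tendstoD) auto
    moreover have "eventually (\<lambda>n. 1 / real (Suc n) < \<eta> / 2) sequentially"
      using \<eta> by (intro order_tendstoD[OF LIMSEQ_Suc[OF lim_1_over_n]]) auto
    ultimately have "eventually (\<lambda>n. norm (\<delta> n - 0) < \<eta>) sequentially"
    proof eventually_elim
      case (elim n)
      have "Inf (S n) \<le> \<eta> / 2" using elim \<eta> by (intro cInf_lower bdd) (simp add: S_def)
      hence "\<delta> n < \<eta>" using elim unfolding \<delta>_def by linarith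
      thus ?case using \<delta>pos[of n] by simp
    qed
    thus "\<exists>no. \<forall>n\<ge>no. norm (\<delta> n - 0) < \<eta>" by (simp add: eventually_sequentially)
  qed
  have "almost_all_graphs p (\<lambda>n E. P n (\<delta> n) E)"
    by (rule almost_all_graphs_bound[OF lim]) (use r\<delta> in \<open>simp add: r_def\<close>)
  thus ?thesis using lim \<delta>pos by blast
qed

section \<open>Degrees and distances\<close>

lemma card_edges_at_vertex:
  assumes i: "i < n"
  shows "card {e \<in> all_edges n. i \<in> e} = n - 1"
proof -
  have "{e \<in> all_edges n. i \<in> e} = (\<lambda>j. {i, j}) ` ({..<n} - {i})"
  proof (intro equalityI subsetI)
    fix e assume "e \<in> {e \<in> all_edges n. i \<in> e}"
    hence e: "e \<subseteq> {..<n}" "card e = 2" "i \<in> e" by (auto simp: all_edges_def)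
    then obtain j where "e = {i, j}" "j \<noteq> i" by (metis card_2_iff doubleton_eq_iff insertE singletonD)
    thus "e \<in> (\<lambda>j. {i, j}) ` ({..<n} - {i})" using e by auto
  qed (use i in \<open>auto intro: doubleton_in_all_edges\<close>)
  moreover have "inj_on (\<lambda>j. {i, j}) ({..<n} - {i})" by (auto simp: inj_on_def doubleton_eq_iff)
  ultimately show ?thesis using i by (simp add: card_image)
qed

lemma vertex_degree_distribution:
  assumes p: "0 \<le> p" "p \<le> 1" and i: "i < n"
  shows "map_pmf (\<lambda>E. vertex_degree E i) (erdos_renyi n p) = binomial_pmf (n - 1) p"
proof -
  let ?A = "{e \<in> all_edges n. i \<in> e}"
  have "binomial_pmf (n - 1) p = map_pmf (\<lambda>f. card {x \<in> ?A. f x}) (Pi_pmf ?A False (\<lambda>_. bernoulli_pmf p))"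
    using p card_edges_at_vertex[OF i] by (intro binomial_pmf_altdef') auto
  also have "Pi_pmf ?A False (\<lambda>_. bernoulli_pmf p) =
     map_pmf (\<lambda>f x. if x \<in> ?A then f x else False) (Pi_pmf (all_edges n) False (\<lambda>_. bernoulli_pmf p))"
    by (rule Pi_pmf_subset) auto
  finally have "binomial_pmf (n - 1) p = map_pmf (\<lambda>f. card {x \<in> ?A. if x \<in> ?A then f x else False}) (Pi_pmf (all_edges n) False (\<lambda>_. bernoulli_pmf p))"
    by (simp add: pmf.map_comp o_def)
  moreover have "map_pmf (\<lambda>E. vertex_degree E i) (erdos_renyi n p) =
    map_pmf (\<lambda>b. vertex_degree {e \<in> all_edges n. b e} i) (Pi_pmf (all_edges n) False (\<lambda>_. bernoulli_pmf p))"
    by (simp add: erdos_renyi_def pmf.map_comp o_def)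
  moreover have "vertex_degree {e \<in> all_edges n. b e} i = card {x \<in> ?A. if x \<in> ?A then b x else False}" for b
    unfolding vertex_degree_def by (rule arg_cong[where f = card]) auto
  ultimately show ?thesis by simp
qed

lemma prob_degree_deviation:
  assumes p: "0 \<le> p" "p \<le> 1" and i: "i < n" and n: "n \<ge> 2" and \<eta>: "\<eta> \<ge> 0"
  shows "measure_pmf.prob (erdos_renyi n p) {E. \<bar>vertex_degree E i / real (n - 1) - p\<bar> \<ge> \<eta>} \<le> 2 * exp (- 2 * real (n - 1) * \<eta>\<^sup>2)"
proof -
  note degree = vertex_degree_distribution[OF p i]
  interpret binomial_distribution "n - 1" p by unfold_locales (use p in auto)
  have "measure_pmf.prob (erdos_renyi n p) {E. \<bar>vertex_degree E i / real (n - 1) - p\<bar> \<ge> \<eta>} =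
     measure_pmf.prob (map_pmf (\<lambda>E. vertex_degree E i) (erdos_renyi n p)) {x. \<bar>real x / real (n - 1) - p\<bar> \<ge> \<eta>}"
    by (simp add: vimage_def)
  also have "\<dots> \<le> 2 * exp (- 2 * real (n - 1) * \<eta>\<^sup>2)"
    unfolding degree using prob_abs_ge'[OF _ \<eta>] n by simp
  finally show ?thesis .
qed

text \<open>
  Union bound.
\<close>
lemma almost_all_graphs_for_all_vertices:
  fixes r :: "nat \<Rightarrow> real"
  assumes "(\<lambda>n. real n * r n) \<longlonglongrightarrow> 0"
    and "eventually (\<lambda>n. \<forall>i<n. measure_pmf.prob (erdos_renyi n p) {E. \<not> P n i E} \<le> r n) sequentially"
  shows "almost_all_graphs p (\<lambda>n E. \<forall>i<n. P n i E)"
proof (rule almost_all_graphs_bound[OF assms(1)])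
  show "eventually (\<lambda>n. measure_pmf.prob (erdos_renyi n p) {E. \<not> (\<forall>i<n. P n i E)} \<le> n * r n) sequentially"
    using assms(2)
  proof eventually_elim
    case (elim n)
    have "{E. \<not> (\<forall>i<n. P n i E)} = (\<Union>i<n. {E. \<not> P n i E})" by auto
    hence "measure_pmf.prob (erdos_renyi n p) {E. \<not> (\<forall>i<n. P n i E)} \<le> (\<Sum>i<n. measure_pmf.prob (erdos_renyi n p) {E. \<not> P n i E})"
      by (simp add: measure_pmf.finite_measure_subadditive_finite)
    also have "\<dots> \<le> (\<Sum>i<n. r n)" using elim by (intro sum_mono) auto
    finally show ?case by simp
  qed
qed

text \<open>
  Hoeffding's inequality makes the failure probability of one vertex exponentially small, so the union bound applies. Closeness of
  all degrees is essential, as \<open>f\<close> is uncontrolled away from \<open>np\<close>.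
\<close>
lemma almost_all_degrees_close:
  fixes p \<epsilon> :: real
  assumes p: "0 < p" "p < 1" and \<epsilon>: "\<epsilon> > 0"
  shows "almost_all_graphs p (\<lambda>n E. \<forall>i<n. \<bar>vertex_degree E i / (n * p) - 1\<bar> \<le> \<epsilon>)"
proof (rule almost_all_graphs_for_all_vertices)
  \<comment> \<open>Half of \<open>\<epsilon>\<close> is reserved for the difference between \<open>(n - 1) p\<close>, the mean degree, and \<open>n p\<close>.\<close>
  define \<eta> where "\<eta> = \<epsilon> * p / 2"
  have \<eta>: "\<eta> > 0" using p \<epsilon> by (simp add: \<eta>_def)
  show "(\<lambda>n. real n * (2 * exp (- 2 * (real n - 1) * \<eta>\<^sup>2))) \<longlonglongrightarrow> 0" using \<eta> by real_asymp
  have "eventually (\<lambda>n. 1 / real n \<le> \<epsilon> / 2) sequentially"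
    using \<epsilon> by (intro less_imp_le eventually_mono[OF order_tendstoD(2)[OF lim_1_over_n, of "\<epsilon> / 2"]]) auto
  thus "eventually (\<lambda>n. \<forall>i<n. measure_pmf.prob (erdos_renyi n p) {E. \<not> \<bar>vertex_degree E i / (n * p) - 1\<bar> \<le> \<epsilon>}
      \<le> 2 * exp (- 2 * (real n - 1) * \<eta>\<^sup>2)) sequentially"
    using eventually_ge_at_top[of 2]
  proof eventually_elim
    case (elim n)
    show ?case
    proof (intro allI impI)
      fix i assume i: "i < n"
      have "\<bar>real d / (n * p) - 1\<bar> \<le> \<epsilon>" if "\<bar>real d / real (n - 1) - p\<bar> < \<eta>" for d
      proof -
        define N where "N = real (n - 1)"
        have N: "N > 0" "real n = N + 1" using elim(2) by (auto simp: N_def)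
        have dev: "\<bar>real d / N - p\<bar> \<le> \<eta>" using that unfolding N_def by simp
        have "\<bar>real d - N * p\<bar> = N * \<bar>real d / N - p\<bar>"
        proof -
          have "real d - N * p = N * (real d / N - p)" using N by (simp add: field_simps)
          thus ?thesis using N by (simp add: abs_mult)
        qed
        also have "\<dots> \<le> N * \<eta>" using dev N(1) by (intro mult_left_mono) auto
        finally have close: "\<bar>real d - N * p\<bar> \<le> N * \<eta>" .
        have "real d - n * p = (real d - N * p) - p" using N by (simp add: algebra_simps)
        hence "\<bar>real d - n * p\<bar> \<le> N * \<eta> + p" using close p by linarith
        also have "\<dots> \<le> n * \<eta> + p" using N \<eta> by simp
        finally have "\<bar>real d - n * p\<bar> / (n * p) \<le> (n * \<eta> + p) / (n * p)"
          using p by (intro divide_right_mono) auto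
        also have "(n * \<eta> + p) / (n * p) = \<epsilon> / 2 + 1 / n"
          using p elim(2) by (simp add: \<eta>_def add_divide_distrib)
        also have "\<dots> \<le> \<epsilon>" using elim(1) by simp
        also have "\<bar>real d - n * p\<bar> / (n * p) = \<bar>real d / (n * p) - 1\<bar>"
        proof -
          have "real d / (n * p) - 1 = (real d - n * p) / (n * p)" using p N by (simp add: diff_divide_distrib)
          thus ?thesis using p by (simp add: abs_divide abs_mult)
        qed
        finally show ?thesis .
      qed
      hence "measure_pmf.prob (erdos_renyi n p) {E. \<not> \<bar>vertex_degree E i / (n * p) - 1\<bar> \<le> \<epsilon>} \<le>
          measure_pmf.prob (erdos_renyi n p) {E. \<bar>vertex_degree E i / real (n - 1) - p\<bar> \<ge> \<eta>}"
        by (intro measure_pmf.finite_measure_mono) (auto simp: not_less[symmetric])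
      also have "\<dots> \<le> 2 * exp (- 2 * real (n - 1) * \<eta>\<^sup>2)"
        using p i elim \<eta> by (intro prob_degree_deviation) auto
      finally show "measure_pmf.prob (erdos_renyi n p) {E. \<not> \<bar>vertex_degree E i / (n * p) - 1\<bar> \<le> \<epsilon>} \<le> 2 * exp (- 2 * (real n - 1) * \<eta>\<^sup>2)"
        using elim(2) by (simp add: of_nat_diff)
    qed
  qed
qed

text \<open>
  The product is the indicator that no vertex of \<open>K\<close> is adjacent to both \<open>i\<close> and \<open>j\<close>. Exposing the two edges from one
  vertex \<open>k\<close> gives a factor \<open>p (1 - p) + (1 - p) = 1 - p\<^sup>2\<close> and leaves the other factors unchanged.
\<close>
lemma expect_no_common_neighbour:
  assumes p: "0 \<le> p" "p \<le> 1" and ij: "i < n" "j < n" "i \<noteq> j"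
    and K: "finite K" "K \<subseteq> {..<n} - {i, j}"
  shows "expect n p (\<lambda>E. \<Prod>k\<in>K. 1 - of_bool ({i, k} \<in> E) * of_bool ({j, k} \<in> E)) = (1 - p\<^sup>2) ^ card K"
  using K
proof (induction K rule: finite_induct)
  case (insert k K)
  define X :: "edge_set \<Rightarrow> real" where "X E = (\<Prod>k\<in>K. 1 - of_bool ({i, k} \<in> E) * of_bool ({j, k} \<in> E))" for E
  have k: "k < n" "k \<noteq> i" "k \<noteq> j" and Kk: "K \<subseteq> {..<n} - {i, j}" using insert by auto
  have X: "X (Set.insert {i, k} E) = X E" "X (E - {{i, k}}) = X E" "X (Set.insert {j, k} E) = X E" "X (E - {{j, k}}) = X E" for E
    unfolding X_def using insert.hyps Kk ij k by (auto intro!: prod.cong simp: doubleton_eq_iff)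
  have e: "{i, k} \<in> all_edges n" "{j, k} \<in> all_edges n" using ij k by (auto intro: doubleton_in_all_edges)
  have ne: "{i, k} \<noteq> {j, k}" using ij k by (auto simp: doubleton_eq_iff)
  have "expect n p (\<lambda>E. \<Prod>k\<in>Set.insert k K. 1 - of_bool ({i, k} \<in> E) * of_bool ({j, k} \<in> E)) =
     expect n p (\<lambda>E. (1 - of_bool ({i, k} \<in> E) * of_bool ({j, k} \<in> E)) * X E)"
    using insert.hyps by (simp add: X_def)
  also have "\<dots> = expect n p (\<lambda>E. p * ((1 - of_bool ({j, k} \<in> E)) * X E) + (1 - p) * X E)"
    by (subst expect_expose_edge[OF p e(1)]) (use ne in \<open>simp add: X\<close>)
  also have "\<dots> = p * expect n p (\<lambda>E. (1 - of_bool ({j, k} \<in> E)) * X E) + (1 - p) * expect n p X"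
    by simp
  also have "expect n p (\<lambda>E. (1 - of_bool ({j, k} \<in> E)) * X E) = (1 - p) * expect n p X"
    by (subst expect_expose_edge[OF p e(2)]) (simp add: X)
  also have "expect n p X = (1 - p\<^sup>2) ^ card K" unfolding X_def by (rule insert.IH[OF Kk])
  also have "p * ((1 - p) * (1 - p\<^sup>2) ^ card K) + (1 - p) * (1 - p\<^sup>2) ^ card K = (1 - p\<^sup>2) ^ card (Set.insert k K)"
    using insert.hyps by (simp add: algebra_simps power2_eq_square)
  finally show ?case .
qed simp

definition common_neighbours :: "nat \<Rightarrow> edge_set \<Rightarrow> bool" where
  "common_neighbours n E \<longleftrightarrow> (\<forall>i<n. \<forall>j<n. i \<noteq> j \<longrightarrow> (\<exists>k. {i, k} \<in> E \<and> {k, j} \<in> E))"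

text \<open>
  A fixed pair fails with probability \<open>(1 - p\<^sup>2)\<^sup>n\<^sup>-\<^sup>2\<close>, and there are at most \<open>n\<^sup>2\<close> pairs.
\<close>
lemma almost_all_common_neighbours:
  assumes p: "0 < p" "p < 1"
  shows "almost_all_graphs p common_neighbours"
  unfolding common_neighbours_def
proof (rule almost_all_graphs_for_all_vertices)
  define c where "c = 1 - p\<^sup>2"
  have c: "0 < c" "c < 1" using p by (auto simp: c_def abs_square_less_1)
  \<comment> \<open>The quotient stands for \<open>c ^ (n - 2)\<close> with truncated subtraction, which agrees with it for \<open>n \<ge> 2\<close>.\<close>
  show "(\<lambda>n. real n * (real n * (c ^ n / c ^ 2))) \<longlonglongrightarrow> 0" using c by real_asymp
  show "eventually (\<lambda>n. \<forall>i<n. measure_pmf.prob (erdos_renyi n p) {E. \<not> (\<forall>j<n. i \<noteq> j \<longrightarrow> (\<exists>k. {i, k} \<in> E \<and> {k, j} \<in> E))}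
      \<le> real n * (c ^ n / c ^ 2)) sequentially"
    using eventually_ge_at_top[of 2]
  proof (eventually_elim, intro allI impI)
    fix n i :: nat assume n: "n \<ge> 2" and i: "i < n"
    let ?pr = "measure_pmf.prob (erdos_renyi n p)"
    have pair: "?pr {E. i \<noteq> j \<and> \<not> (\<exists>k. {i, k} \<in> E \<and> {k, j} \<in> E)} \<le> c ^ n / c ^ 2" if j: "j < n" for j
    proof (cases "i = j")
      case True
      thus ?thesis using c by simp
    next
      case False
      let ?K = "{..<n} - {i, j}"
      have "?pr {E. i \<noteq> j \<and> \<not> (\<exists>k. {i, k} \<in> E \<and> {k, j} \<in> E)} \<le>
        expect n p (\<lambda>E. \<Prod>k\<in>?K. 1 - of_bool ({i, k} \<in> E) * of_bool ({j, k} \<in> E))"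
      proof (rule prob_le_expect)
        fix E show "0 \<le> (\<Prod>k\<in>?K. 1 - of_bool ({i, k} \<in> E) * of_bool ({j, k} \<in> E) :: real)"
          by (intro prod_nonneg) auto
        assume "E \<in> {E. i \<noteq> j \<and> \<not> (\<exists>k. {i, k} \<in> E \<and> {k, j} \<in> E)}"
        hence "(\<Prod>k\<in>?K. 1 - of_bool ({i, k} \<in> E) * of_bool ({j, k} \<in> E) :: real) = (\<Prod>k\<in>?K. 1)"
          by (intro prod.cong refl) (auto simp: insert_commute)
        thus "1 \<le> (\<Prod>k\<in>?K. 1 - of_bool ({i, k} \<in> E) * of_bool ({j, k} \<in> E) :: real)" by simp
      qed
      also have "\<dots> = c ^ card ?K"
        unfolding c_def using p i j False by (intro expect_no_common_neighbour) auto
      also have "card ?K = n - 2" using i j False by (simp add: card_Diff_subset)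
      also have "c ^ (n - 2) = c ^ n / c ^ 2" using c n by (intro power_diff) auto
      finally show ?thesis .
    qed
    have "{E. \<not> (\<forall>j<n. i \<noteq> j \<longrightarrow> (\<exists>k. {i, k} \<in> E \<and> {k, j} \<in> E))} = (\<Union>j<n. {E. i \<noteq> j \<and> \<not> (\<exists>k. {i, k} \<in> E \<and> {k, j} \<in> E)})"
      by auto
    hence "?pr {E. \<not> (\<forall>j<n. i \<noteq> j \<longrightarrow> (\<exists>k. {i, k} \<in> E \<and> {k, j} \<in> E))} \<le> (\<Sum>j<n. ?pr {E. i \<noteq> j \<and> \<not> (\<exists>k. {i, k} \<in> E \<and> {k, j} \<in> E)})"
      by (simp add: measure_pmf.finite_measure_subadditive_finite)
    also have "\<dots> \<le> (\<Sum>j<n. c ^ n / c ^ 2)" using pair by (intro sum_mono) auto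
    finally show "?pr {E. \<not> (\<forall>j<n. i \<noteq> j \<longrightarrow> (\<exists>k. {i, k} \<in> E \<and> {k, j} \<in> E))} \<le> real n * (c ^ n / c ^ 2)" by simp
  qed
qed

lemma graph_dist_adjacent:
  assumes "{i, j} \<in> E" "i \<noteq> j"
  shows "graph_dist E i j = 1"
  unfolding graph_dist_def
proof (rule antisym)
  show "Inf {enat k |k. (i, j) \<in> adjacency E ^^ k} \<le> 1"
    using assms by (intro Inf_lower) (auto simp: adjacency_def one_enat_def intro!: exI[of _ "Suc 0"])
  show "1 \<le> Inf {enat k |k. (i, j) \<in> adjacency E ^^ k}"
  proof (intro Inf_greatest)
    fix d assume "d \<in> {enat k |k. (i, j) \<in> adjacency E ^^ k}"
    then obtain k where "d = enat k" "(i, j) \<in> adjacency E ^^ k" by blast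
    thus "1 \<le> d" using assms(2) by (cases k) (auto simp: one_enat_def)
  qed
qed

lemma graph_dist_common_neighbour:
  assumes "{i, j} \<notin> E" "i \<noteq> j" and k: "{i, k} \<in> E" "{k, j} \<in> E"
  shows "graph_dist E i j = 2"
  unfolding graph_dist_def
proof (rule antisym)
  have "(i, j) \<in> adjacency E ^^ Suc (Suc 0)" using k by (auto simp: adjacency_def)
  thus "Inf {enat k |k. (i, j) \<in> adjacency E ^^ k} \<le> 2"
    by (intro Inf_lower) (auto simp: numeral_eq_enat numeral_2_eq_2 intro!: exI[of _ "Suc (Suc 0)"])
  show "2 \<le> Inf {enat k |k. (i, j) \<in> adjacency E ^^ k}"
  proof (intro Inf_greatest)
    fix d assume "d \<in> {enat k |k. (i, j) \<in> adjacency E ^^ k}"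
    then obtain k where k: "d = enat k" "(i, j) \<in> adjacency E ^^ k" by blast
    have "k \<noteq> 0" using k assms(2) by (cases k) auto
    moreover have "k \<noteq> 1" using k assms(1) by (auto simp: adjacency_def)
    ultimately have "2 \<le> k" by linarith
    thus "2 \<le> d" using k by (simp add: numeral_eq_enat)
  qed
qed

section \<open>Energy of the weighted distance matrix\<close>

text \<open>
  Stability along all sequences implies uniformity over shrinking boxes: apply it to a sequence that picks a violation in every box
  that contains one.
\<close>
lemma degree_stable_uniform:
  fixes p \<epsilon> :: real
  assumes p: "p > 0" and stab: "degree_stable p f" and D: "D \<ge> 1" and \<delta>: "\<delta> \<longlonglongrightarrow> 0" and \<epsilon>: "\<epsilon> > 0"
  shows "eventually (\<lambda>n. \<forall>x y. \<bar>x / (n * p) - 1\<bar> \<le> \<delta> n \<longrightarrow> \<bar>y / (n * p) - 1\<bar> \<le> \<delta> n \<longrightarrow>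
     \<bar>f (enat D) x y - f (enat D) (n * p) (n * p)\<bar> \<le> \<epsilon> * \<bar>f (enat D) (n * p) (n * p)\<bar>) sequentially"
proof -
  define bad where "bad n z \<longleftrightarrow> \<bar>fst z / (real n * p) - 1\<bar> \<le> \<delta> n \<and> \<bar>snd z / (real n * p) - 1\<bar> \<le> \<delta> n \<and>
     \<not> \<bar>f (enat D) (fst z) (snd z) - f (enat D) (n * p) (n * p)\<bar> \<le> \<epsilon> * \<bar>f (enat D) (n * p) (n * p)\<bar>" for n and z :: "real \<times> real"
  define z where "z n = (if \<exists>z. bad n z then SOME z. bad n z else (n * p, n * p))" for n :: nat
  have z_bad: "bad n (z n)" if "\<exists>z. bad n z" for n
    using someI_ex[OF that] that by (simp add: z_def)
  have z_box: "\<bar>fst (z n) / (real n * p) - 1\<bar> \<le> \<bar>\<delta> n\<bar> \<and> \<bar>snd (z n) / (real n * p) - 1\<bar> \<le> \<bar>\<delta> n\<bar>" if n: "n > 0" for n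
  proof (cases "\<exists>z. bad n z")
    case True
    from z_bad[OF this] show ?thesis unfolding bad_def by linarith
  next
    case False
    hence "z n = (n * p, n * p)" by (simp only: z_def if_False)
    thus ?thesis using n p by simp
  qed
  have lim: "(\<lambda>n. g (z n) / (real n * p)) \<longlonglongrightarrow> 1" if "g = fst \<or> g = snd" for g
  proof -
    have "(\<lambda>n. g (z n) / (real n * p) - 1) \<longlonglongrightarrow> 0"
    proof (rule Lim_null_comparison)
      show "eventually (\<lambda>n. norm (g (z n) / (real n * p) - 1) \<le> \<bar>\<delta> n\<bar>) sequentially"
        using eventually_gt_at_top[of 0] by eventually_elim (use z_box that in auto)
      show "(\<lambda>n. \<bar>\<delta> n\<bar>) \<longlonglongrightarrow> 0" using \<delta> by (rule tendsto_rabs_zero)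
    qed
    from tendsto_add[OF this tendsto_const[of 1]] show ?thesis by simp
  qed
  have "(\<lambda>n. f (enat D) (fst (z n)) (snd (z n))) \<sim>[sequentially] (\<lambda>n. f (enat D) (real n * p) (real n * p))"
    using stab D lim[of fst] lim[of snd] unfolding degree_stable_def by auto
  hence "(\<lambda>n. f (enat D) (fst (z n)) (snd (z n)) - f (enat D) (real n * p) (real n * p)) \<in>
     o[sequentially](\<lambda>n. f (enat D) (real n * p) (real n * p))"
    by (simp add: asymp_equiv_altdef)
  from landau_o.smallD[OF this \<epsilon>]
  have "eventually (\<lambda>n. \<not> bad n (z n)) sequentially"
    by eventually_elim (simp add: bad_def)
  thus ?thesis
  proof eventually_elim
    case (elim n)
    hence no: "\<not> bad n (x, y)" for x y using z_bad by blast
    show ?case using no by (auto simp: bad_def)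
  qed
qed

text \<open>
  The matrices \<open>J\<close> and \<open>I\<close> are positive semidefinite, so their trace norms are their traces.
\<close>
lemma trace_norm_off_diagonal_ones:
  "trace_norm n (\<lambda>i j. of_bool (i \<noteq> j)) \<le> 2 * real n"
proof -
  have J: "symmetric_on n (\<lambda>i j. 1)" "symmetric_on n (\<lambda>i j. of_bool (i = j))"
    by (auto simp: symmetric_on_def)
  have qJ: "quadratic_form n (\<lambda>i j. 1) v = (\<Sum>i<n. v i)\<^sup>2" for v
    by (simp add: quadratic_form_def power2_eq_square sum_product)
  have qI: "quadratic_form n (\<lambda>i j. of_bool (i = j)) v = (\<Sum>i<n. (v i)\<^sup>2)" for v
  proof -
    have "quadratic_form n (\<lambda>i j. of_bool (i = j)) v = (\<Sum>i<n. v i * (\<Sum>j<n. v j * of_bool (i = j)))"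
      unfolding quadratic_form_def sum_distrib_left by (simp only: mult.assoc)
    also have "\<dots> = (\<Sum>i<n. v i * v i)"
      by (intro sum.cong refl arg_cong2[where f = "(*)"] sum_of_bool_mult) auto
    finally show ?thesis by (simp add: power2_eq_square)
  qed
  have tJ: "trace_norm n (\<lambda>i j. 1) = n" by (subst trace_norm_psd[OF J(1)]) (auto simp: qJ)
  have tI: "trace_norm n (\<lambda>i j. of_bool (i = j)) = n"
    by (subst trace_norm_psd[OF J(2)]) (auto simp: qI intro!: sum_nonneg)
  have "trace_norm n (\<lambda>i j. of_bool (i \<noteq> j)) = trace_norm n (\<lambda>i j. 1 + - 1 * of_bool (i = j))"
    by (rule trace_norm_cong) auto
  also have "\<dots> \<le> trace_norm n (\<lambda>i j. 1) + trace_norm n (\<lambda>i j. - 1 * of_bool (i = j))"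
    using J by (intro trace_norm_triangle) (auto simp: symmetric_on_def)
  also have "trace_norm n (\<lambda>i j. - 1 * of_bool (i = j)) = n"
    using tI by (subst trace_norm_scale[OF J(2)]) simp
  finally show ?thesis using tJ by simp
qed

text \<open>
  The decomposition \<open>W = (a - b) \<surd>n wigner + ((a - b) p + b) (J - I) + Z\<close>: the first two terms add up to \<open>a\<close> on edges and
  \<open>b\<close> on non-edges, so the entries of \<open>Z\<close> are at most \<open>K\<close>.
\<close>
lemma energy_two_valued_matrix:
  fixes W :: "nat \<Rightarrow> nat \<Rightarrow> real"
  assumes n: "n > 0" and symW: "symmetric_on n W" and diag: "\<And>i. i < n \<Longrightarrow> W i i = 0"
    and edge: "\<And>i j. i < n \<Longrightarrow> j < n \<Longrightarrow> i \<noteq> j \<Longrightarrow> {i, j} \<in> E \<Longrightarrow> \<bar>W i j - a\<bar> \<le> K"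
    and nonedge: "\<And>i j. i < n \<Longrightarrow> j < n \<Longrightarrow> i \<noteq> j \<Longrightarrow> {i, j} \<notin> E \<Longrightarrow> \<bar>W i j - b\<bar> \<le> K"
    and K: "K \<ge> 0"
  shows "\<bar>trace_norm n W - \<bar>a - b\<bar> * (sqrt n * trace_norm n (wigner n p E))\<bar> \<le>
    \<bar>(a - b) * p + b\<bar> * (2 * n) + K * real n powr (3 / 2)"
proof -
  define \<kappa> where "\<kappa> = (a - b) * p + b"
  define X where "X i j = ((a - b) * sqrt n) * wigner n p E i j" for i j
  define Y where "Y i j = \<kappa> * of_bool (i \<noteq> j)" for i j :: nat
  define Z where "Z i j = W i j - X i j - Y i j" for i j
  note sw = symmetric_wigner[of n p E]
  have sX: "symmetric_on n X" using sw by (simp add: symmetric_on_def X_def)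
  have sY: "symmetric_on n Y" by (auto simp: symmetric_on_def Y_def)
  have sZ: "symmetric_on n Z" using sX sY symW by (simp add: symmetric_on_def Z_def)
  have Zb: "\<bar>Z i j\<bar> \<le> K" if ij: "i < n" "j < n" for i j
  proof (cases "i = j")
    case True
    thus ?thesis using diag ij K by (simp add: Z_def X_def Y_def wigner_def)
  next
    case False
    have "X i j + Y i j = (if {i, j} \<in> E then a else b)"
    proof -
      have "X i j = (a - b) * (of_bool ({i, j} \<in> E) - p)" using False n by (simp add: X_def wigner_def)
      thus ?thesis using False by (cases "{i, j} \<in> E") (simp_all add: Y_def \<kappa>_def algebra_simps)
    qed
    hence "Z i j = W i j - (if {i, j} \<in> E then a else b)" unfolding Z_def by linarith
    thus ?thesis using edge nonedge ij False by simp
  qed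
  have "W = (\<lambda>i j. X i j + (Y i j + Z i j))" by (simp add: Z_def)
  hence "\<bar>trace_norm n W - trace_norm n X\<bar> \<le> trace_norm n (\<lambda>i j. Y i j + Z i j)"
    using trace_norm_perturbation[OF sX symmetric_on_add[OF sY sZ]] by simp
  also have "\<dots> \<le> trace_norm n Y + trace_norm n Z" by (rule trace_norm_triangle[OF sY sZ])
  also have "trace_norm n Y \<le> \<bar>\<kappa>\<bar> * (2 * n)"
  proof -
    have "symmetric_on n (\<lambda>i j. of_bool (i \<noteq> j))" by (auto simp: symmetric_on_def)
    from trace_norm_scale[OF this, of \<kappa>] have "trace_norm n Y = \<bar>\<kappa>\<bar> * trace_norm n (\<lambda>i j. of_bool (i \<noteq> j))"
      unfolding Y_def .
    thus ?thesis using trace_norm_off_diagonal_ones[of n] by (simp add: mult_left_mono)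
  qed
  also have "trace_norm n Z \<le> K * real n powr (3 / 2)" by (rule trace_norm_le_of_entries[OF sZ K Zb])
  also have "trace_norm n X = \<bar>a - b\<bar> * (sqrt n * trace_norm n (wigner n p E))"
    unfolding X_def by (subst trace_norm_scale[OF sw]) (simp add: abs_mult)
  finally show ?thesis unfolding \<kappa>_def by simp
qed

text \<open>
  One tolerance for both error terms; \<open>bounded_combination\<close> separates them later.
\<close>
definition energy_close :: "real \<Rightarrow> (enat \<Rightarrow> real \<Rightarrow> real \<Rightarrow> real) \<Rightarrow> nat \<Rightarrow> real \<Rightarrow> edge_set \<Rightarrow> bool" where
  "energy_close p f n \<epsilon> E \<longleftrightarrow>
     (let a = f 1 (n * p) (n * p); b = f 2 (n * p) (n * p); c = 8 / (3 * pi) * sqrt (p * (1 - p)) in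
      \<bar>energy (weighted_distance_matrix f n E) - c * \<bar>a - b\<bar> * real n powr (3 / 2)\<bar>
        \<le> \<epsilon> * (\<bar>a - b\<bar> + \<bar>b\<bar>) * real n powr (3 / 2))"

lemma energy_close_mono: "energy_close p f n \<epsilon> E \<Longrightarrow> \<epsilon> \<le> \<epsilon>' \<Longrightarrow> energy_close p f n \<epsilon>' E"
  unfolding energy_close_def Let_def by (erule order.trans) (intro mult_right_mono, auto)

text \<open>
  The three errors come from the centred adjacency matrix, from the multiple of \<open>J - I\<close>, where the energy of \<open>J - I\<close> is at most
  \<open>2 n \<le> \<epsilon> n\<^sup>3\<^sup>/\<^sup>2\<close>, and from the deviation of the entries from \<open>a\<close> and \<open>b\<close>. Since \<open>\<bar>a\<bar> \<le> \<bar>a - b\<bar> + \<bar>b\<bar>\<close>, all of them are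
  multiples of \<open>\<epsilon> (\<bar>a - b\<bar> + \<bar>b\<bar>) n\<^sup>3\<^sup>/\<^sup>2\<close>.
\<close>
lemma energy_close_of_typical_graph:
  fixes p \<epsilon> \<delta> :: real and n :: nat and f :: "enat \<Rightarrow> real \<Rightarrow> real \<Rightarrow> real"
  defines "a \<equiv> f 1 (n * p) (n * p)" and "b \<equiv> f 2 (n * p) (n * p)"
  assumes p: "0 < p" "p < 1" and f_sym: "\<And>D x y. f D x y = f D y x" and \<epsilon>: "\<epsilon> > 0"
    and n: "n > 0" "2 / \<epsilon> \<le> sqrt n"
    and deg: "\<forall>i<n. \<bar>vertex_degree E i / (n * p) - 1\<bar> \<le> \<delta>"
    and f1: "\<forall>x y. \<bar>x / (n * p) - 1\<bar> \<le> \<delta> \<longrightarrow> \<bar>y / (n * p) - 1\<bar> \<le> \<delta> \<longrightarrow> \<bar>f 1 x y - a\<bar> \<le> \<epsilon> * \<bar>a\<bar>"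
    and f2: "\<forall>x y. \<bar>x / (n * p) - 1\<bar> \<le> \<delta> \<longrightarrow> \<bar>y / (n * p) - 1\<bar> \<le> \<delta> \<longrightarrow> \<bar>f 2 x y - b\<bar> \<le> \<epsilon> * \<bar>b\<bar>"
    and nbr: "common_neighbours n E"
    and wig: "\<bar>trace_norm n (wigner n p E) / n - 8 / (3 * pi) * sqrt (p * (1 - p))\<bar> \<le> \<epsilon>"
  shows "energy_close p f n (4 * \<epsilon>) E"
proof -
  define W where "W i j = (if i = j then 0 else f (if {i, j} \<in> E then 1 else 2) (real (vertex_degree E i)) (real (vertex_degree E j)))" for i j
  define N where "N = real n powr (3 / 2)"
  define c where "c = 8 / (3 * pi) * sqrt (p * (1 - p))"
  define K where "K = \<epsilon> * (\<bar>a\<bar> + \<bar>b\<bar>)"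
  define x where "x = \<bar>a - b\<bar>"
  have N0: "N \<ge> 0" by (simp add: N_def)
  have W: "energy (weighted_distance_matrix f n E) = trace_norm n W"
    unfolding trace_norm_def weighted_distance_matrix_def
  proof (intro arg_cong[where f = energy] cong_mat refl)
    fix i j assume ij: "i < n" "j < n"
    have "graph_dist E i j = (if {i, j} \<in> E then 1 else 2)" if "i \<noteq> j"
      using that nbr ij graph_dist_adjacent[of i j E] graph_dist_common_neighbour[of i j E]
      unfolding common_neighbours_def by (metis (full_types))
    thus "(case (i, j) of (i, j) \<Rightarrow> if i = j then 0 else f (graph_dist E i j) (real (vertex_degree E i)) (real (vertex_degree E j))) =
       (case (i, j) of (i, j) \<Rightarrow> W i j)" by (simp add: W_def)
  qed
  have bound: "\<bar>trace_norm n W - x * (sqrt n * trace_norm n (wigner n p E))\<bar> \<le>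
    \<bar>(a - b) * p + b\<bar> * (2 * n) + K * real n powr (3 / 2)"
    unfolding x_def
  proof (rule energy_two_valued_matrix[OF n(1)])
    show "symmetric_on n W" using f_sym by (auto simp: symmetric_on_def W_def insert_commute)
    show "\<bar>W i j - a\<bar> \<le> K" if "i < n" "j < n" "i \<noteq> j" "{i, j} \<in> E" for i j
    proof -
      have "\<bar>W i j - a\<bar> \<le> \<epsilon> * \<bar>a\<bar>" using that deg f1 by (simp add: W_def)
      thus ?thesis using \<epsilon> by (simp add: K_def algebra_simps add_increasing2)
    qed
    show "\<bar>W i j - b\<bar> \<le> K" if "i < n" "j < n" "i \<noteq> j" "{i, j} \<notin> E" for i j
    proof -
      have "\<bar>W i j - b\<bar> \<le> \<epsilon> * \<bar>b\<bar>" using that deg f2 by (simp add: W_def)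
      thus ?thesis using \<epsilon> by (simp add: K_def algebra_simps add_increasing)
    qed
  qed (use \<epsilon> in \<open>auto simp: W_def K_def\<close>)
  have n2: "2 * real n \<le> \<epsilon> * N"
  proof -
    have "2 \<le> \<epsilon> * sqrt n" using n(2) \<epsilon> by (simp add: field_simps)
    hence "2 * real n \<le> (\<epsilon> * sqrt n) * real n" by (rule mult_right_mono) simp
    thus ?thesis unfolding N_def powr_three_halves by (simp add: ac_simps)
  qed
  have "\<bar>(a - b) * p + b\<bar> \<le> x * 1 + \<bar>b\<bar>"
    unfolding x_def using p by (intro order.trans[OF abs_triangle_ineq] add_mono) (auto simp: abs_mult intro!: mult_left_le)
  hence t1: "\<bar>(a - b) * p + b\<bar> * (2 * n) \<le> (x + \<bar>b\<bar>) * (\<epsilon> * N)"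
    using n2 by (intro mult_mono) (auto simp: x_def)
  have "\<bar>a\<bar> \<le> x + \<bar>b\<bar>" unfolding x_def by linarith
  hence "K \<le> \<epsilon> * (x + 2 * \<bar>b\<bar>)" unfolding K_def using \<epsilon> by (intro mult_left_mono) auto
  hence t2: "K * N \<le> \<epsilon> * (x + 2 * \<bar>b\<bar>) * N" using N0 by (rule mult_right_mono)
  have "sqrt n * trace_norm n (wigner n p E) = N * (trace_norm n (wigner n p E) / n)"
    using n(1) by (simp add: N_def powr_three_halves)
  hence "x * (sqrt n * trace_norm n (wigner n p E)) - c * x * N = x * N * (trace_norm n (wigner n p E) / n - c)"
    by (simp add: algebra_simps)
  hence "\<bar>x * (sqrt n * trace_norm n (wigner n p E)) - c * x * N\<bar> = x * N * \<bar>trace_norm n (wigner n p E) / n - c\<bar>"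
    using N0 by (simp add: abs_mult x_def)
  also have "\<dots> \<le> x * N * \<epsilon>" using wig N0 unfolding c_def by (intro mult_left_mono) (auto simp: x_def)
  finally have t3: "\<bar>x * (sqrt n * trace_norm n (wigner n p E)) - c * x * N\<bar> \<le> x * N * \<epsilon>" .
  have "\<bar>trace_norm n W - c * x * N\<bar> \<le> x * N * \<epsilon> + ((x + \<bar>b\<bar>) * (\<epsilon> * N) + \<epsilon> * (x + 2 * \<bar>b\<bar>) * N)"
    using bound[folded N_def] t1 t2 t3 by linarith
  also have "\<dots> = 3 * (\<epsilon> * x * N) + 3 * (\<epsilon> * \<bar>b\<bar> * N)" by (simp add: algebra_simps)
  also have "\<dots> \<le> 4 * (\<epsilon> * x * N) + 4 * (\<epsilon> * \<bar>b\<bar> * N)"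
    using \<epsilon> N0 by (intro add_mono mult_right_mono) (auto simp: x_def)
  also have "\<dots> = 4 * \<epsilon> * (x + \<bar>b\<bar>) * N" by (simp add: algebra_simps)
  finally show ?thesis
    unfolding energy_close_def Let_def W a_def[symmetric] b_def[symmetric] c_def[symmetric] x_def N_def .
qed

lemma almost_all_energy_close:
  assumes p: "0 < p" "p < 1" and f_sym: "\<And>D x y. f D x y = f D y x" and stab: "degree_stable p f" and \<epsilon>: "\<epsilon> > 0"
  shows "almost_all_graphs p (\<lambda>n E. energy_close p f n (4 * \<epsilon>) E)"
proof -
  obtain \<delta> where \<delta>: "\<delta> \<longlonglongrightarrow> 0" and deg: "almost_all_graphs p (\<lambda>n E. \<forall>i<n. \<bar>vertex_degree E i / (n * p) - 1\<bar> \<le> \<delta> n)"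
    using almost_all_graphs_diagonal[of "\<lambda>n \<epsilon> E. \<forall>i<n. \<bar>vertex_degree E i / (n * p) - 1\<bar> \<le> \<epsilon>" p]
      almost_all_degrees_close[OF p] by (meson order.trans)
  have wig: "almost_all_graphs p (\<lambda>n E. \<bar>trace_norm n (wigner n p E) / n - 8 / (3 * pi) * sqrt (p * (1 - p))\<bar> \<le> \<epsilon>)"
    by (rule almost_all_graphs_markov[OF wigner_mean_abs_eigenvalue[OF p] _ \<epsilon>]) simp
  note typical = almost_all_graphs_conj[OF deg almost_all_graphs_conj[OF almost_all_common_neighbours[OF p] wig]]
  have large: "eventually (\<lambda>n. 2 / \<epsilon> \<le> sqrt (real n)) sequentially"
    using filterlim_compose[OF sqrt_at_top filterlim_real_sequentially]
    by (auto simp: filterlim_at_top)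
  have "1 \<le> (2::nat)" by simp
  note stable = degree_stable_uniform[OF p(1) stab order.refl \<delta> \<epsilon>] degree_stable_uniform[OF p(1) stab this \<delta> \<epsilon>]
  have enat: "enat 1 = 1" "enat 2 = 2" by (simp_all add: one_enat_def numeral_eq_enat)
  have "eventually (\<lambda>n. \<forall>E\<subseteq>all_edges n. (\<forall>i<n. \<bar>vertex_degree E i / (n * p) - 1\<bar> \<le> \<delta> n) \<and> common_neighbours n E \<and>
      \<bar>trace_norm n (wigner n p E) / n - 8 / (3 * pi) * sqrt (p * (1 - p))\<bar> \<le> \<epsilon> \<longrightarrow> energy_close p f n (4 * \<epsilon>) E) sequentially"
    using large stable[unfolded enat] eventually_gt_at_top[of 0]
  proof eventually_elim
    case (elim n)
    show ?case
    proof (intro allI impI, elim conjE)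
      fix E
      assume "\<forall>i<n. \<bar>vertex_degree E i / (n * p) - 1\<bar> \<le> \<delta> n" "common_neighbours n E"
        "\<bar>trace_norm n (wigner n p E) / n - 8 / (3 * pi) * sqrt (p * (1 - p))\<bar> \<le> \<epsilon>"
      thus "energy_close p f n (4 * \<epsilon>) E"
        by (intro energy_close_of_typical_graph[OF p f_sym \<epsilon> elim(4) elim(1) _ elim(2) elim(3)])
    qed
  qed
  thus ?thesis by (rule almost_all_graphs_mono[OF typical])
qed

text \<open>
  The ratio \<open>q\<close> of \<open>r\<close> to its bound lies in \<open>[-1, 1]\<close>, so \<open>d = q \<delta>\<close> and \<open>e = q \<epsilon>\<close> work.
\<close>
lemma bounded_combination:
  fixes r A B \<delta> \<epsilon> :: real
  assumes "\<bar>r\<bar> \<le> \<delta> * A + \<epsilon> * B" and "\<delta> \<ge> 0" "\<epsilon> \<ge> 0" "A \<ge> 0" "B \<ge> 0"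
  shows "\<exists>d e. \<bar>d\<bar> \<le> \<delta> \<and> \<bar>e\<bar> \<le> \<epsilon> \<and> r = d * A + e * B"
proof (cases "\<delta> * A + \<epsilon> * B = 0")
  case True
  thus ?thesis using assms by (intro exI[of _ 0]) auto
next
  case False
  define s where "s = \<delta> * A + \<epsilon> * B"
  have s: "s > 0" using False assms by (auto simp: s_def less_le)
  define q where "q = r / s"
  have q: "\<bar>q\<bar> \<le> 1" using assms(1) s by (simp add: q_def abs_divide s_def)
  have "\<bar>q * \<delta>\<bar> \<le> \<delta>" "\<bar>q * \<epsilon>\<bar> \<le> \<epsilon>"
    using q assms(2,3) by (auto simp: abs_mult intro: mult_left_le_one_le)
  moreover have "r = q * \<delta> * A + q * \<epsilon> * B"
  proof -
    have "q * \<delta> * A + q * \<epsilon> * B = q * s" by (simp add: s_def algebra_simps)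
    thus ?thesis using s by (simp add: q_def)
  qed
  ultimately show ?thesis by blast
qed

text \<open>
  Otherwise a subsequence with distance less than \<open>1 / (k + 1)\<close> from \<open>c\<close> at its \<open>k\<close>-th term can be chosen recursively.
\<close>
lemma no_subseq_tendsto_away:
  assumes "no_subseq_tendsto r c"
  shows "\<exists>\<eta>>0. eventually (\<lambda>n. \<bar>r n - c\<bar> \<ge> \<eta>) sequentially"
proof (rule ccontr)
  assume contra: "\<not> ?thesis"
  have ex: "\<exists>n>m. \<bar>r n - c\<bar> < 1 / real (Suc k)" for m k
  proof -
    have "\<not> eventually (\<lambda>n. \<bar>r n - c\<bar> \<ge> 1 / real (Suc k)) sequentially"
      using contra by (metis of_nat_0_less_iff zero_less_Suc zero_less_divide_1_iff)
    thus ?thesis unfolding eventually_sequentially by (metis Suc_le_lessD not_le)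
  qed
  define s where "s = rec_nat (SOME n. \<bar>r n - c\<bar> < 1 / real (Suc 0)) (\<lambda>k m. SOME n. n > m \<and> \<bar>r n - c\<bar> < 1 / real (Suc (Suc k)))"
  have s0: "\<bar>r (s 0) - c\<bar> < 1 / real (Suc 0)"
    unfolding s_def using someI_ex[of "\<lambda>n. \<bar>r n - c\<bar> < 1 / real (Suc 0)"] ex[of 0 0] by auto
  have sS: "s (Suc k) > s k \<and> \<bar>r (s (Suc k)) - c\<bar> < 1 / real (Suc (Suc k))" for k
    using someI_ex[of "\<lambda>n. n > s k \<and> \<bar>r n - c\<bar> < 1 / real (Suc (Suc k))"] ex[of "s k" "Suc k"]
    by (simp add: s_def)
  have "strict_mono s" using sS by (simp add: strict_mono_Suc_iff)
  moreover have "\<bar>r (s k) - c\<bar> < 1 / real (Suc k)" for k using s0 sS by (cases k) auto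
  hence "(\<lambda>k. r (s k) - c) \<longlonglongrightarrow> 0"
    by (intro Lim_null_comparison[OF _ LIMSEQ_Suc[OF lim_1_over_n]] always_eventually allI) (simp add: less_imp_le)
  hence "(r \<circ> s) \<longlonglongrightarrow> c" by (simp add: LIM_zero_iff o_def)
  ultimately show False using assms unfolding no_subseq_tendsto_def by blast
qed

text \<open>
  The second claim absorbs \<open>e \<bar>b\<bar>\<close> into \<open>d \<bar>a - b\<bar>\<close>, because \<open>\<bar>b\<bar>\<close> is at most a constant multiple of \<open>\<bar>a - b\<bar>\<close>; this includes the
  case \<open>b = 0\<close>. The third claim absorbs \<open>(c + d) \<bar>a - b\<bar>\<close> into \<open>e \<bar>b\<bar>\<close>, because \<open>\<bar>a - b\<bar> / \<bar>b\<bar>\<close> tends to 0.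
\<close>
theorem theorem1p7:
  fixes p :: real
    and f :: "enat \<Rightarrow> real \<Rightarrow> real \<Rightarrow> real"
    and a b :: "nat \<Rightarrow> real"
    and c :: real
  assumes p: "0 < p" "p < 1"
    and f_sym: "\<And>D x y. f D x y = f D y x"
    and f_stable: "degree_stable p f"
  defines "a \<equiv> (\<lambda>n. f 1 (real n * p) (real n * p))"
    and "b \<equiv> (\<lambda>n. f 2 (real n * p) (real n * p))"
    and "c \<equiv> 8 / (3 * pi) * sqrt (p * (1 - p))"
  shows
    "(\<exists>\<delta> \<epsilon>. \<delta> \<longlonglongrightarrow> 0 \<and> \<epsilon> \<longlonglongrightarrow> 0 \<and>
        almost_all_graphs p (\<lambda>n G. \<exists>d e. \<bar>d\<bar> \<le> \<delta> n \<and> \<bar>e\<bar> \<le> \<epsilon> n \<and>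
          energy (weighted_distance_matrix f n G) =
            ((c + d) * \<bar>a n - b n\<bar> + e * \<bar>b n\<bar>) * real n powr (3 / 2))) \<and>
     (no_subseq_tendsto (\<lambda>n. a n / b n) 1 \<longrightarrow>
        (\<exists>\<delta>. \<delta> \<longlonglongrightarrow> 0 \<and>
          almost_all_graphs p (\<lambda>n G. \<exists>d. \<bar>d\<bar> \<le> \<delta> n \<and>
            energy (weighted_distance_matrix f n G) =
              \<bar>a n - b n\<bar> * (c + d) * real n powr (3 / 2)))) \<and>
     ((\<lambda>n. a n / b n) \<longlonglongrightarrow> 1 \<longrightarrow>
        (\<exists>\<epsilon>. \<epsilon> \<longlonglongrightarrow> 0 \<and>
          almost_all_graphs p (\<lambda>n G. \<exists>e. \<bar>e\<bar> \<le> \<epsilon> n \<and>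
            energy (weighted_distance_matrix f n G) =
              e * \<bar>b n\<bar> * real n powr (3 / 2))))"
proof -
  obtain \<delta> where \<delta>: "\<delta> \<longlonglongrightarrow> 0" "\<And>n. \<delta> n > 0" and close: "almost_all_graphs p (\<lambda>n E. energy_close p f n (\<delta> n) E)"
  proof -
    have "almost_all_graphs p (\<lambda>n E. energy_close p f n \<epsilon> E)" if "\<epsilon> > 0" for \<epsilon>
      using almost_all_energy_close[OF p f_sym f_stable, of "\<epsilon> / 4"] that by simp
    thus thesis
      using almost_all_graphs_diagonal[of "energy_close p f" p] energy_close_mono that by blast
  qed
  have exact: "\<exists>d e. \<bar>d\<bar> \<le> \<delta> n \<and> \<bar>e\<bar> \<le> \<delta> n \<and> energy (weighted_distance_matrix f n E) =
      ((c + d) * \<bar>a n - b n\<bar> + e * \<bar>b n\<bar>) * real n powr (3 / 2)"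
    if "energy_close p f n (\<delta> n) E" for n E
  proof -
    let ?N = "real n powr (3 / 2)"
    let ?r = "energy (weighted_distance_matrix f n E) - c * \<bar>a n - b n\<bar> * ?N"
    have "\<bar>?r\<bar> \<le> \<delta> n * (\<bar>a n - b n\<bar> * ?N) + \<delta> n * (\<bar>b n\<bar> * ?N)"
      using that unfolding energy_close_def Let_def a_def b_def c_def by (simp add: algebra_simps)
    then obtain d e where "\<bar>d\<bar> \<le> \<delta> n" "\<bar>e\<bar> \<le> \<delta> n" "?r = d * (\<bar>a n - b n\<bar> * ?N) + e * (\<bar>b n\<bar> * ?N)"
      using bounded_combination[of ?r "\<delta> n" "\<bar>a n - b n\<bar> * ?N" "\<delta> n" "\<bar>b n\<bar> * ?N"] \<delta>(2)[of n] by auto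
    thus ?thesis by (intro exI[of _ d] exI[of _ e]) (simp add: algebra_simps)
  qed
  have part1: "almost_all_graphs p (\<lambda>n G. \<exists>d e. \<bar>d\<bar> \<le> \<delta> n \<and> \<bar>e\<bar> \<le> \<delta> n \<and>
          energy (weighted_distance_matrix f n G) =
            ((c + d) * \<bar>a n - b n\<bar> + e * \<bar>b n\<bar>) * real n powr (3 / 2))"
    by (rule almost_all_graphs_mono[OF close]) (use exact in \<open>auto intro!: always_eventually\<close>)
  have part2: "\<exists>\<delta>. \<delta> \<longlonglongrightarrow> 0 \<and>
          almost_all_graphs p (\<lambda>n G. \<exists>d. \<bar>d\<bar> \<le> \<delta> n \<and>
            energy (weighted_distance_matrix f n G) =
              \<bar>a n - b n\<bar> * (c + d) * real n powr (3 / 2))"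
    if away: "no_subseq_tendsto (\<lambda>n. a n / b n) 1"
  proof -
    obtain \<eta> where \<eta>: "\<eta> > 0" "eventually (\<lambda>n. \<bar>a n / b n - 1\<bar> \<ge> \<eta>) sequentially"
      using no_subseq_tendsto_away[OF away] by blast
    have lim: "(\<lambda>n. \<delta> n * (1 + 1 / \<eta>)) \<longlonglongrightarrow> 0"
      using tendsto_mult[OF \<delta>(1) tendsto_const[of "1 + 1 / \<eta>"]] by simp
    have "eventually (\<lambda>n. \<forall>E\<subseteq>all_edges n.
        (\<exists>d e. \<bar>d\<bar> \<le> \<delta> n \<and> \<bar>e\<bar> \<le> \<delta> n \<and> energy (weighted_distance_matrix f n E) =
            ((c + d) * \<bar>a n - b n\<bar> + e * \<bar>b n\<bar>) * real n powr (3 / 2)) \<longrightarrow>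
        (\<exists>d. \<bar>d\<bar> \<le> \<delta> n * (1 + 1 / \<eta>) \<and> energy (weighted_distance_matrix f n E) =
              \<bar>a n - b n\<bar> * (c + d) * real n powr (3 / 2))) sequentially"
      using \<eta>(2)
    proof (eventually_elim, intro allI impI, elim exE conjE)
      fix n E d e
      assume far: "\<eta> \<le> \<bar>a n / b n - 1\<bar>" and d: "\<bar>d\<bar> \<le> \<delta> n" and e: "\<bar>e\<bar> \<le> \<delta> n"
        and en: "energy (weighted_distance_matrix f n E) = ((c + d) * \<bar>a n - b n\<bar> + e * \<bar>b n\<bar>) * real n powr (3 / 2)"
      define q where "q = \<bar>b n\<bar> / \<bar>a n - b n\<bar>"
      have "\<bar>b n\<bar> * \<eta> \<le> \<bar>a n - b n\<bar>"
      proof (cases "b n = 0")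
        case False
        hence "\<bar>a n - b n\<bar> = \<bar>b n\<bar> * \<bar>a n / b n - 1\<bar>" by (simp add: abs_mult[symmetric] field_simps)
        thus ?thesis using far by (simp add: mult_left_mono)
      qed simp
      hence b: "\<bar>b n\<bar> = q * \<bar>a n - b n\<bar>" and q: "0 \<le> q" "q \<le> 1 / \<eta>"
        using \<eta>(1) by (auto simp: q_def field_simps divide_le_eq mult_le_0_iff)
      have "\<bar>e * q\<bar> = \<bar>e\<bar> * q" using q by (simp add: abs_mult)
      also have "\<dots> \<le> \<delta> n * (1 / \<eta>)" using e q \<delta>(2)[of n] by (intro mult_mono) auto
      finally have "\<bar>d + e * q\<bar> \<le> \<delta> n + \<delta> n * (1 / \<eta>)" using d by linarith
      moreover have "energy (weighted_distance_matrix f n E) = \<bar>a n - b n\<bar> * (c + (d + e * q)) * real n powr (3 / 2)"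
        unfolding en b by (simp add: algebra_simps)
      ultimately show "\<exists>d. \<bar>d\<bar> \<le> \<delta> n * (1 + 1 / \<eta>) \<and> energy (weighted_distance_matrix f n E) =
              \<bar>a n - b n\<bar> * (c + d) * real n powr (3 / 2)"
        by (intro exI[of _ "d + e * q"]) (simp add: algebra_simps)
    qed
    from almost_all_graphs_mono[OF part1 this] show ?thesis using lim by blast
  qed
  have part3: "\<exists>\<epsilon>. \<epsilon> \<longlonglongrightarrow> 0 \<and>
          almost_all_graphs p (\<lambda>n G. \<exists>e. \<bar>e\<bar> \<le> \<epsilon> n \<and>
            energy (weighted_distance_matrix f n G) =
              e * \<bar>b n\<bar> * real n powr (3 / 2))"
    if ratio: "(\<lambda>n. a n / b n) \<longlonglongrightarrow> 1"
  proof -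
    define \<epsilon> where "\<epsilon> n = (c + \<delta> n) * \<bar>a n / b n - 1\<bar> + \<delta> n" for n
    have "(\<lambda>n. \<bar>a n / b n - 1\<bar>) \<longlonglongrightarrow> \<bar>1 - 1\<bar>" by (rule tendsto_rabs[OF tendsto_diff[OF ratio tendsto_const]])
    from tendsto_add[OF tendsto_mult[OF tendsto_add[OF tendsto_const[of c] \<delta>(1)] this] \<delta>(1)]
    have "\<epsilon> \<longlonglongrightarrow> (c + 0) * \<bar>1 - 1\<bar> + 0" unfolding \<epsilon>_def .
    hence lim: "\<epsilon> \<longlonglongrightarrow> 0" by simp
    have c0: "c \<ge> 0" using p by (simp add: c_def)
    have "eventually (\<lambda>n. 0 < a n / b n) sequentially" by (rule order_tendstoD(1)[OF ratio]) simp
    hence "eventually (\<lambda>n. \<forall>E\<subseteq>all_edges n.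
        (\<exists>d e. \<bar>d\<bar> \<le> \<delta> n \<and> \<bar>e\<bar> \<le> \<delta> n \<and> energy (weighted_distance_matrix f n E) =
            ((c + d) * \<bar>a n - b n\<bar> + e * \<bar>b n\<bar>) * real n powr (3 / 2)) \<longrightarrow>
        (\<exists>e. \<bar>e\<bar> \<le> \<epsilon> n \<and> energy (weighted_distance_matrix f n E) = e * \<bar>b n\<bar> * real n powr (3 / 2))) sequentially"
    proof (eventually_elim, intro allI impI, elim exE conjE)
      fix n E d e
      assume pos: "0 < a n / b n" and d: "\<bar>d\<bar> \<le> \<delta> n" and e: "\<bar>e\<bar> \<le> \<delta> n"
        and en: "energy (weighted_distance_matrix f n E) = ((c + d) * \<bar>a n - b n\<bar> + e * \<bar>b n\<bar>) * real n powr (3 / 2)"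
      define q where "q = \<bar>a n / b n - 1\<bar>"
      have "b n \<noteq> 0" using pos by auto
      hence ab: "\<bar>a n - b n\<bar> = q * \<bar>b n\<bar>" by (simp add: q_def abs_mult[symmetric] field_simps)
      have "\<bar>c + d\<bar> \<le> c + \<delta> n" using d c0 by linarith
      hence "\<bar>(c + d) * q + e\<bar> \<le> \<epsilon> n"
        unfolding \<epsilon>_def q_def[symmetric] using e
        by (intro order.trans[OF abs_triangle_ineq] add_mono) (auto simp: abs_mult q_def intro!: mult_right_mono)
      moreover have "energy (weighted_distance_matrix f n E) = ((c + d) * q + e) * \<bar>b n\<bar> * real n powr (3 / 2)"
        unfolding en ab by (simp add: algebra_simps)
      ultimately show "\<exists>e. \<bar>e\<bar> \<le> \<epsilon> n \<and> energy (weighted_distance_matrix f n E) = e * \<bar>b n\<bar> * real n powr (3 / 2)"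
        by blast
    qed
    from almost_all_graphs_mono[OF part1 this] show ?thesis using lim by blast
  qed
  show ?thesis using part1 part2 part3 \<delta>(1) by blast
qed

end
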